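(* Let $d\in\mathbb{N}$, $0<\alpha<2\wedge d$, $\delta\in[0,(d-\alpha)/2]$, $1<p<\infty$ and $0<t<\infty$. Let $\tilde P_t$ be the Feynman–Kac operator corresponding to $\Delta^{\alpha/2}+\kappa_\delta|x|^{-\alpha}$. Then $\tilde P_t$ is a contraction on $L^p(\mathbb{R}^d)$ if and only if $\kappa_\delta\le\kappa_{(d-\alpha)/p}$.
   Context: $a\wedge b=\min\{a,b\}$. For $0\le\beta\le d-\alpha$, $$\kappa_\beta=\frac{2^\alpha\Gamma\big(\frac{\beta+\alpha}{2}\big)\Gamma\big(\frac{d-\beta}{2}\big)}{\Gamma\big(\frac{\beta}{2}\big)\Gamma\big(\frac{d-\beta-\alpha}{2}\big)},$$ where $1/\Gamma(0)=0$, so $\kappa_0=0$. Let $g_s(x)=(4\pi s)^{-d/2}e^{-|x|^2/(4s)}$ for $s>0$, $x\in\mathbb{R}^d$, and let $\eta_t\ge0$ be the density function of the $\alpha/2$-stable subordinator at time $t>0$, i.e. $\eta_t(s)=0$ for $s\le0$ and $\int_0^\infty e^{-us}\eta_t(s)\,ds=e^{-tu^{\alpha/2}}$ for $u\ge0$. Set $p_t(x)=\int_0^\infty g_s(x)\eta_t(s)\,ds$ and $p_t(x,y)=p_t(y-x)$ (the transition density of the semigroup generated by the fractional Laplacian $\Delta^{\alpha/2}=-(-\Delta)^{\alpha/2}$). Let $q(x)=\kappa_\delta|x|^{-\alpha}$. The Schrödinger perturbation of $p_t$ by $q$ is $\tilde p_t=\sum_{n=0}^\infty p_t^{(n)}$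 with values in $[0,\infty]$, where $p^{(0)}_t(x,y)=p_t(x,y)$ and $$p_t^{(n)}(x,y)=\int_0^t\int_{\mathbb{R}^d}p_s(x,z)\,q(z)\,p^{(n-1)}_{t-s}(z,y)\,dz\,ds,\qquad n\ge1 .$$ For $t>0$ and $x\ne0$ let $\tilde P_tf(x)=\int_{\mathbb{R}^d}\tilde p_t(x,y)f(y)\,dy$. "$\tilde P_t$ is a contraction on $L^p(\mathbb{R}^d)$" means that for every (real-valued) $f\in L^p(\mathbb{R}^d)$ the integral defining $\tilde P_tf(x)$ converges absolutely for almost every $x$ and $\|\tilde P_tf\|_p\le\|f\|_p$. *)

theory Defs
  imports "HOL-Analysis.Analysis"
begin

text \<open>
  The constant \<open>\<kappa>\<^sub>\<beta>\<close> in dimension \<open>d\<close>, for \<open>0 \<le> \<beta> \<le> d - \<alpha>\<close>.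
  The function \<open>rGamma = 1 / \<Gamma>\<close> is entire with \<open>rGamma 0 = 0\<close>, which is exactly the
  convention needed at the end points \<open>\<beta> = 0\<close> and \<open>\<beta> = d - \<alpha>\<close>.
\<close>

definition kappa :: "nat \<Rightarrow> real \<Rightarrow> real \<Rightarrow> real" where
  "kappa d \<alpha> \<beta> =
     2 powr \<alpha> * Gamma ((\<beta> + \<alpha>) / 2) * Gamma ((real d - \<beta>) / 2) *
     rGamma (\<beta> / 2) * rGamma ((real d - \<beta> - \<alpha>) / 2)"

definition gauss_kernel :: "real \<Rightarrow> 'a::euclidean_space \<Rightarrow> real" where
  "gauss_kernel s x = (4 * pi * s) powr (- real DIM('a) / 2) * exp (- (norm x)\<^sup>2 / (4 * s))"

text \<open>
  \<open>\<eta> t\<close> is, for each \<open>t > 0\<close>, a density of the \<open>\<sigma>\<close>-stable subordinator at time \<open>t\<close>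
  (with \<open>0 < \<sigma> < 1\<close>), normalised by its Laplace transform \<open>exp (- t * u powr \<sigma>)\<close>.
  This determines \<open>\<eta> t\<close> almost everywhere, hence determines \<open>stable_density\<close> below.
\<close>

definition stable_subordinator_density :: "real \<Rightarrow> (real \<Rightarrow> real \<Rightarrow> real) \<Rightarrow> bool" where
  "stable_subordinator_density \<sigma> \<eta> \<longleftrightarrow>
     (\<forall>t>0. \<eta> t \<in> borel_measurable borel \<and>
        (\<forall>s. 0 \<le> \<eta> t s) \<and> (\<forall>s\<le>0. \<eta> t s = 0) \<and>
        (\<forall>u\<ge>0. has_bochner_integral lborel (\<lambda>s. exp (- u * s) * \<eta> t s)
                  (exp (- t * u powr \<sigma>))))"

definition stable_density ::
    "(real \<Rightarrow> real \<Rightarrow> real) \<Rightarrow> real \<Rightarrow> 'a::euclidean_space \<Rightarrow> ennreal" where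
  "stable_density \<eta> t x = (\<integral>\<^sup>+ s\<in>{0<..}. ennreal (gauss_kernel s x * \<eta> t s) \<partial>lborel)"

definition stable_kernel ::
    "(real \<Rightarrow> real \<Rightarrow> real) \<Rightarrow> real \<Rightarrow> 'a::euclidean_space \<Rightarrow> 'a \<Rightarrow> ennreal" where
  "stable_kernel \<eta> t x y = stable_density \<eta> t (y - x)"

text \<open>
  At the origin \<open>0 powr (- \<alpha>) = 0\<close>, so the potential takes the value 0 there; a single
  point has measure zero and does not affect any of the integrals below.
\<close>

definition hardy_potential :: "real \<Rightarrow> real \<Rightarrow> 'a::euclidean_space \<Rightarrow> real" where
  "hardy_potential \<alpha> \<delta> x = kappa DIM('a) \<alpha> \<delta> * norm x powr (- \<alpha>)"

primrec perturbation_term ::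
    "(real \<Rightarrow> 'a::euclidean_space \<Rightarrow> 'a \<Rightarrow> ennreal) \<Rightarrow> ('a \<Rightarrow> real) \<Rightarrow> nat \<Rightarrow>
     real \<Rightarrow> 'a \<Rightarrow> 'a \<Rightarrow> ennreal" where
  "perturbation_term p q 0 = p"
| "perturbation_term p q (Suc n) = (\<lambda>t x y.
     \<integral>\<^sup>+ s\<in>{0<..<t}. (\<integral>\<^sup>+ z. p s x z * ennreal (q z) * perturbation_term p q n (t - s) z y
       \<partial>lborel) \<partial>lborel)"

definition schroedinger_perturbation ::
    "(real \<Rightarrow> 'a::euclidean_space \<Rightarrow> 'a \<Rightarrow> ennreal) \<Rightarrow> ('a \<Rightarrow> real) \<Rightarrow>
     real \<Rightarrow> 'a \<Rightarrow> 'a \<Rightarrow> ennreal" where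
  "schroedinger_perturbation p q t x y = (\<Sum>n. perturbation_term p q n t x y)"

definition Lp_space :: "real \<Rightarrow> ('a::euclidean_space \<Rightarrow> real) set" where
  "Lp_space p =
     {f \<in> borel_measurable lebesgue. integrable lebesgue (\<lambda>x. \<bar>f x\<bar> powr p)}"

definition Lp_norm :: "real \<Rightarrow> ('a::euclidean_space \<Rightarrow> real) \<Rightarrow> real" where
  "Lp_norm p f = (\<integral>x. \<bar>f x\<bar> powr p \<partial>lebesgue) powr (1 / p)"

text \<open>
  Integral operators whose kernel has values in \<open>[0, \<infinity>]\<close>. If the integral converges
  absolutely at \<open>x\<close>, then \<open>f\<close> vanishes at almost every \<open>y\<close> with \<open>K x y = \<infinity>\<close>, so the
  convention \<open>enn2real \<infinity> = 0\<close> does not influence the value of the operator.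
\<close>

definition kernel_integral_converges ::
    "('a::euclidean_space \<Rightarrow> 'a \<Rightarrow> ennreal) \<Rightarrow> ('a \<Rightarrow> real) \<Rightarrow> 'a \<Rightarrow> bool" where
  "kernel_integral_converges K f x \<longleftrightarrow>
     (\<integral>\<^sup>+ y. K x y * ennreal \<bar>f y\<bar> \<partial>lebesgue) < \<infinity>"

definition kernel_operator ::
    "('a::euclidean_space \<Rightarrow> 'a \<Rightarrow> ennreal) \<Rightarrow> ('a \<Rightarrow> real) \<Rightarrow> 'a \<Rightarrow> real" where
  "kernel_operator K f x = (\<integral>y. enn2real (K x y) * f y \<partial>lebesgue)"

text \<open>
  Membership of the image in \<open>Lp_space\<close> is part of the bound on its norm: \<open>Lp_norm\<close> is
  a Bochner integral and would be 0 for functions that are not in \<open>L\<^sup>p\<close>.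
\<close>

definition Lp_contraction ::
    "real \<Rightarrow> ('a::euclidean_space \<Rightarrow> 'a \<Rightarrow> ennreal) \<Rightarrow> bool" where
  "Lp_contraction p K \<longleftrightarrow>
     (\<forall>f\<in>Lp_space p.
        (AE x in lebesgue. kernel_integral_converges K f x) \<and>
        kernel_operator K f \<in> Lp_space p \<and>
        Lp_norm p (kernel_operator K f) \<le> Lp_norm p f)"

definition feynman_kac_kernel ::
    "(real \<Rightarrow> real \<Rightarrow> real) \<Rightarrow> real \<Rightarrow> real \<Rightarrow> real \<Rightarrow> 'a::euclidean_space \<Rightarrow> 'a \<Rightarrow> ennreal" where
  "feynman_kac_kernel \<eta> \<alpha> \<delta> =
     schroedinger_perturbation (stable_kernel \<eta>) (hardy_potential \<alpha> \<delta>)"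

end

theory Submission
  imports Defs "HOL-Probability.Probability"
begin

text \<open>
  Let \<open>d\<close> be the dimension, \<open>Q x = |x|\<^sup>-\<^sup>\<alpha>\<close>, \<open>\<beta> = (d - \<alpha>) / p\<close> and \<open>\<beta>' = d - \<alpha> - \<beta> = \<beta> (p - 1)\<close>.
  Let \<open>P\<^sub>t\<close> be the unperturbed semigroup and \<open>K\<close> the perturbed kernel at time \<open>t\<close>. Both directions
  rest on the powers \<open>h = |x|\<close> to the \<open>-\<beta>\<close> and \<open>h' = |x|\<close> to the \<open>-\<beta>'\<close>. They satisfy
  \<open>h' = h\<^sup>p\<^sup>-\<^sup>1\<close> and, since \<open>\<kappa>\<close> is symmetric under \<open>\<beta> \<mapsto> d - \<alpha> - \<beta>\<close>, they belong to the same
  constant \<open>\<kappa>\<^sub>\<beta>\<close>: formally \<open>\<Delta>\<^sup>\<alpha>\<^sup>/\<^sup>2 h = - \<kappa>\<^sub>\<beta> Q h\<close>, and likewise for \<open>h'\<close>. The integrated form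
  \<open>h = P\<^sub>t h + \<kappa>\<^sub>\<beta> \<integral>\<^sub>0\<^sup>t P\<^sub>s (Q h) ds\<close> is \<open>npow_eq_P_plus\<close>. It is obtained by subordination: a power is
  a mixture of Gaussian kernels, the potential of the subordinator has a power density, and the
  potential of a power becomes a Beta integral (\<open>potential_npow\<close>).

  Sufficiency. If \<open>\<kappa>\<^sub>\<delta> \<le> \<kappa>\<^sub>\<beta>\<close>, then the identity above and induction over the partial sums of the
  perturbation series give \<open>K h \<le> h\<close> and \<open>K h' \<le> h'\<close> (\<open>feynman_kac_npow_le\<close>). The kernel \<open>K\<close> is
  symmetric, so Jensen's inequality for the subprobability measures \<open>K(x,y) h(y) / h(x) dy\<close>, followed
  by integration against \<open>h' = h\<^sup>p\<^sup>-\<^sup>1\<close>, yields the contraction (\<open>Lp_contraction_of_Schur\<close>).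

  Necessity. Contractivity implies \<open>\<langle>g, K f\<rangle> \<le> \<langle>g, f\<rangle>\<close> for \<open>f \<ge> 0\<close> in \<open>L\<^sup>p\<close> and \<open>g = f\<^sup>p\<^sup>-\<^sup>1\<close>
  (\<open>Lp_contraction_test\<close>). Take \<open>f\<close> to be the positive part of \<open>h - c\<close>, where \<open>c\<close> is the value of
  \<open>h\<close> at distance \<open>R\<close>, and keep the first two terms of the perturbation series. As \<open>f\<close> is the maximum
  of \<open>h - c\<close> and \<open>0\<close>, it satisfies \<open>P\<^sub>t f - f \<ge> P\<^sub>t h - h\<close> on \<open>|x| < R\<close>, the set that carries \<open>g\<close>;
  hence the contributions of order zero cancel and
  \<open>\<kappa>\<^sub>\<delta> \<integral>\<^sub>0\<^sup>t \<langle>P\<^sub>s g, Q P\<^sub>t\<^sub>-\<^sub>s f\<rangle> ds \<le> \<kappa>\<^sub>\<beta> \<integral>\<^sub>0\<^sup>t \<langle>P\<^sub>s g, Q h\<rangle> ds\<close>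
  remains (\<open>contraction_imp_occupation_bound\<close>). On \<open>M \<le> |z| \<le> \<theta> R\<close>, \<open>\<theta>\<close> small, the function
  \<open>P\<^sub>t\<^sub>-\<^sub>s f\<close> is nearly \<open>h\<close>. So if \<open>\<kappa>\<^sub>\<delta> > \<kappa>\<^sub>\<beta>\<close>, the mass of \<open>Q h \<integral>\<^sub>0\<^sup>t P\<^sub>s g ds\<close> on this annulus is
  controlled by its mass outside, which stays bounded as \<open>R \<rightarrow> \<infinity>\<close> (\<open>occ_npow_near_zero\<close>,
  \<open>occupation_far_bound\<close>). But the total mass tends to \<open>\<integral> Q h \<integral>\<^sub>0\<^sup>t P\<^sub>s h' ds dz\<close>, whose integrand
  is comparable with \<open>Q h h' = |z|\<^sup>-\<^sup>d\<close> at infinity, so that it diverges logarithmically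
  (\<open>nn_integral_npow_occ_infinite\<close>).
\<close>

section \<open>Measures determined by their Laplace transform\<close>

lemma integrable_unit_interval:
  fixes F :: "real \<Rightarrow> real"
  assumes "finite_borel_measure M" "AE x in M. x \<in> {0..1}"
    and "continuous_on UNIV F"
  shows "integrable M F"
proof -
  interpret finite_borel_measure M by fact
  have "compact (F ` {0..1})"
    using assms(3) by (intro compact_continuous_image) (auto intro: continuous_on_subset)
  then obtain B where B: "\<And>y. y \<in> {0..1} \<Longrightarrow> norm (F y) \<le> B"
    by (metis (mono_tags, lifting) bounded_pos compact_imp_bounded imageI)
  have [measurable]: "F \<in> borel_measurable M"
    using borel_measurable_continuous_onI[OF assms(3)] M_is_borel
    by (simp cong: measurable_cong_sets)
  show ?thesis
    by (rule integrable_const_bound[where B=B]) (use assms(2) in eventually_elim, use B in auto)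
qed

text \<open>
  The Bernstein polynomials approximate \<open>F\<close> uniformly, and the integrals of polynomials are
  determined by the moments.
\<close>

lemma continuous_integrals_eq_of_moments_eq:
  fixes F :: "real \<Rightarrow> real"
  assumes M: "finite_borel_measure M" "AE x in M. x \<in> {0..1}"
    and N: "finite_borel_measure N" "AE x in N. x \<in> {0..1}"
    and eq: "\<And>k. (\<integral>x. x ^ k \<partial>M) = (\<integral>x. x ^ k \<partial>N)"
    and F: "continuous_on UNIV F"
  shows "(\<integral>x. F x \<partial>M) = (\<integral>x. F x \<partial>N)"
proof -
  have poly: "(\<integral>x. poly q x \<partial>M) = (\<integral>x. poly q x \<partial>N)" for q :: "real poly"
  proof -
    have "(\<integral>x. poly q x \<partial>L) = (\<Sum>i\<le>degree q. coeff q i * (\<integral>x. x ^ i \<partial>L))"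
      if "finite_borel_measure L" "AE x in L. x \<in> {0..1}" for L
      unfolding poly_altdef
      by (subst Bochner_Integration.integral_sum)
        (auto intro!: integrable_unit_interval[OF that] continuous_intros)
    then show ?thesis using M N eq by simp
  qed
  have approx: "\<bar>(\<integral>x. F x \<partial>L) - (\<integral>x. poly q x \<partial>L)\<bar> \<le> e * measure L (space L)"
    if L: "finite_borel_measure L" "AE x in L. x \<in> {0..1}"
      and q: "\<And>x. x \<in> {0..1} \<Longrightarrow> \<bar>F x - poly q x\<bar> < e" for L q e
  proof -
    interpret finite_borel_measure L by fact
    have i: "integrable L F" "integrable L (poly q)"
      using F by (auto intro!: integrable_unit_interval[OF L] continuous_intros)
    have "\<bar>(\<integral>x. F x \<partial>L) - (\<integral>x. poly q x \<partial>L)\<bar> = \<bar>\<integral>x. F x - poly q x \<partial>L\<bar>"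
      using i by simp
    also have "\<dots> \<le> (\<integral>x. \<bar>F x - poly q x\<bar> \<partial>L)"
      using integral_norm_bound[of L "\<lambda>x. F x - poly q x"] by simp
    also have "\<dots> \<le> (\<integral>x. e \<partial>L)"
    proof (rule integral_mono_AE)
      show "AE x in L. \<bar>F x - poly q x\<bar> \<le> e"
        using L(2) by eventually_elim (use q in \<open>auto intro: less_imp_le\<close>)
    qed (use i in auto)
    finally show ?thesis by (simp add: mult.commute)
  qed
  define m where "m = measure M (space M) + measure N (space N)"
  have "\<bar>(\<integral>x. F x \<partial>M) - (\<integral>x. F x \<partial>N)\<bar> \<le> 0 + r" if r: "r > 0" for r
  proof -
    define e where "e = r / (m + 1)"
    have m: "m \<ge> 0" by (simp add: m_def)
    then have e: "e > 0" "e * m \<le> r" using r by (auto simp: e_def field_simps)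
    obtain n where n: "\<And>x. x \<in> {0..1} \<Longrightarrow> \<bar>F x - (\<Sum>k\<le>n. F (k/n) * Bernstein n k x)\<bar> < e"
      using Bernstein_Weierstrass[OF continuous_on_subset[OF F, of "{0..1}"] e(1)] by auto
    define q where "q = (\<Sum>k\<le>n. Polynomial.smult (F (k/n) * of_nat (n choose k)) ([:0,1:]^k * [:1,-1:]^(n-k)))"
    have q: "\<bar>F x - poly q x\<bar> < e" if "x \<in> {0..1}" for x
      using n[OF that] by (simp add: q_def poly_sum poly_power Bernstein_def mult.assoc)
    show ?thesis
      using approx[OF M q] approx[OF N q] poly[of q] e(2) by (simp add: m_def algebra_simps)
  qed
  then have "\<bar>(\<integral>x. F x \<partial>M) - (\<integral>x. F x \<partial>N)\<bar> \<le> 0" by (rule field_le_epsilon)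
  then show ?thesis by simp
qed

text \<open>
  The distribution functions agree because the indicator of \<open>{..a}\<close> is a bounded pointwise limit
  of continuous functions.
\<close>

lemma measure_eq_of_moments_eq:
  assumes M: "finite_borel_measure M" "AE x in M. x \<in> {0..1}"
    and N: "finite_borel_measure N" "AE x in N. x \<in> {0..1}"
    and eq: "\<And>k. (\<integral>x. x ^ k \<partial>M) = (\<integral>x. x ^ k \<partial>N)"
  shows "M = N"
proof (rule cdf_unique'[OF M(1) N(1)], rule ext)
  fix a :: real
  define F where "F = (\<lambda>n x. max 0 (min 1 (1 - real n * (x - a))))"
  have lim: "(\<lambda>n. \<integral>x. F n x \<partial>L) \<longlonglongrightarrow> cdf L a" if "finite_borel_measure L" for L
  proof -
    interpret finite_borel_measure L by fact
    have [measurable_cong]: "sets L = sets borel" by (rule M_is_borel)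
    have "(\<lambda>n. \<integral>x. F n x \<partial>L) \<longlonglongrightarrow> (\<integral>x. indicator {..a} x \<partial>L)"
    proof (rule integral_dominated_convergence[where w="\<lambda>_. 1"])
      show "AE x in L. (\<lambda>n. F n x) \<longlonglongrightarrow> indicator {..a} x"
      proof (rule AE_I2)
        fix x
        show "(\<lambda>n. F n x) \<longlonglongrightarrow> indicator {..a} x"
        proof (cases "x \<le> a")
          case True
          then have "F n x = 1" for n
            by (auto simp: F_def min_def mult_nonneg_nonpos)
          then show ?thesis using True by simp
        next
          case False
          obtain m :: nat where m: "1 / (x - a) < real m" using reals_Archimedean2 by blast
          have "F n x = 0" if "n \<ge> m" for n
          proof -
            have "1 < real m * (x - a)" using m False by (simp add: field_simps)
            also have "\<dots> \<le> real n * (x - a)" using that False by (intro mult_right_mono) auto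
            finally show ?thesis by (simp add: F_def)
          qed
          then have "\<forall>\<^sub>F n in sequentially. F n x = 0" by (auto simp: eventually_sequentially)
          then show ?thesis using False by (simp add: tendsto_eventually)
        qed
      qed
    qed (auto simp: F_def)
    then show ?thesis by (simp add: cdf_def)
  qed
  have "(\<integral>x. F n x \<partial>M) = (\<integral>x. F n x \<partial>N)" for n
    by (rule continuous_integrals_eq_of_moments_eq[OF M N eq]) (auto simp: F_def intro!: continuous_intros)
  then show "cdf M a = cdf N a"
    using lim[OF M(1)] lim[OF N(1)] LIMSEQ_unique by simp
qed

text \<open>
  The substitution \<open>x = exp (- s)\<close> maps the half-line into the unit interval and turns the values of
  the Laplace transform at the natural numbers into moments.
\<close>

lemma measure_eq_of_Laplace_eq:
  assumes M: "finite_borel_measure M" "AE x in M. 0 \<le> x"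
    and N: "finite_borel_measure N" "AE x in N. 0 \<le> x"
    and eq: "\<And>k::nat. (\<integral>x. exp (- k * x) \<partial>M) = (\<integral>x. exp (- k * x) \<partial>N)"
  shows "M = N"
proof -
  have *: "finite_borel_measure (distr L borel (\<lambda>s. exp (-s)))" (is ?A)
      "AE x in distr L borel (\<lambda>s. exp (-s)). x \<in> {0..1}" (is ?B)
      "(\<integral>x. x ^ k \<partial>(distr L borel (\<lambda>s. exp (-s)))) = (\<integral>x. exp (- k * x) \<partial>L)" (is ?C)
      "L = distr (distr L borel (\<lambda>s. exp (-s))) borel (\<lambda>x. - ln x)" (is ?D)
    if "finite_borel_measure L" "AE x in L. 0 \<le> x" for L k
  proof -
    interpret finite_borel_measure L by fact
    have [measurable_cong]: "sets L = sets borel" by (rule M_is_borel)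
    interpret finite_measure "distr L borel (\<lambda>s. exp (-s))" by (rule finite_measure_distr) simp
    show ?A by unfold_locales simp
    show ?B using that(2) by (subst AE_distr_iff) auto
    show ?C by (subst integral_distr) (simp_all add: exp_of_nat_mult[symmetric])
    show ?D by (simp add: distr_distr o_def M_is_borel distr_id2)
  qed
  have "distr M borel (\<lambda>s. exp (-s)) = distr N borel (\<lambda>s. exp (-s))"
    using *(1,2)[OF M] *(1,2)[OF N]
    by (rule measure_eq_of_moments_eq) (simp only: *(3)[OF M] *(3)[OF N] eq)
  then have "distr (distr M borel (\<lambda>s. exp (-s))) borel (\<lambda>x. - ln x) = distr (distr N borel (\<lambda>s. exp (-s))) borel (\<lambda>x. - ln x)"
    by (rule arg_cong)
  then show ?thesis by (rule trans[OF trans[OF *(4)[OF M]] *(4)[OF N, symmetric]])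
qed

text \<open>
  For densities the nonnegative integral needs no prior integrability; finiteness of the second
  measure follows from the transform at \<open>0\<close>.
\<close>

lemma measure_eq_of_nn_Laplace_eq:
  assumes M: "sets M = sets borel" "AE x in M. 0 \<le> x" "emeasure M (space M) < \<infinity>"
    and N: "sets N = sets borel" "AE x in N. 0 \<le> x"
    and eq: "\<And>k::nat. (\<integral>\<^sup>+x. ennreal (exp (- k * x)) \<partial>M) = (\<integral>\<^sup>+x. ennreal (exp (- k * x)) \<partial>N)"
  shows "M = N"
proof -
  have 0: "emeasure M (space M) = emeasure N (space N)" using eq[of 0] by simp
  have fin: "finite_borel_measure M" "finite_borel_measure N"
    using M N 0 by (auto intro!: finite_borel_measure.intro finite_measureI simp: finite_borel_measure_axioms_def)
  have [measurable_cong]: "sets M = sets borel" "sets N = sets borel" by fact+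
  show ?thesis
    using fin(1) M(2) fin(2) N(2)
    by (rule measure_eq_of_Laplace_eq) (subst (1 2) integral_eq_nn_integral; simp add: eq[simplified])
qed

section \<open>Power substitutions and Euler integrals\<close>

text \<open>
  In the logarithmic coordinate every power map of the half-line is affine. This measure identity
  reduces all the power substitutions below, increasing or decreasing, to affine ones.
\<close>

lemma lborel_Ioi_eq_distr_exp:
  "density lborel (\<lambda>x. ennreal (indicator {0<..} x)) = distr (density lborel (\<lambda>y::real. ennreal (exp y))) borel exp"
proof (rule measure_eqI)
  fix A :: "real set"
  assume "A \<in> sets (density lborel (\<lambda>x. ennreal (indicator {0<..} x)))"
  then have [measurable]: "A \<in> sets borel" by simp
  define I where "I n = {exp (- real n)..exp (real n)}" for n
  let ?a = "\<lambda>n x. indicator A x * (indicator (I n) x :: ennreal)"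
    and ?b = "\<lambda>n y. ennreal (indicator A (exp y)) * ennreal (exp y) * (indicator {- real n..real n} y :: ennreal)"
    and ?M = "density lborel (\<lambda>x. ennreal (indicator {0<..} x))"
    and ?N = "distr (density lborel (\<lambda>y::real. ennreal (exp y))) borel exp"
  have I1: "incseq (\<lambda>n x. ?a n x)"
  proof -
    have "I m \<subseteq> I n" if "m \<le> n" for m n
      unfolding I_def using that by (intro iffD2[OF atLeastatMost_subset_iff]) auto
    then show ?thesis by (fastforce simp: incseq_def le_fun_def split: split_indicator)
  qed
  have I2: "incseq (\<lambda>n y. ?b n y)"
    by (auto simp: incseq_def le_fun_def split: split_indicator)
  have S1: "(SUP n. ?a n x) = indicator A x * ennreal (indicator {0<..} x)" for x
  proof (cases "x > 0")
    case True
    obtain n :: nat where "\<bar>ln x\<bar> < n" using reals_Archimedean2 by blast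
    then have "x \<in> I n" using True unfolding I_def by (auto simp: ln_ge_iff[symmetric] abs_less_iff)
      (metis True exp_ln exp_le_cancel_iff less_eq_real_def)+
    then have "(SUP n. ?a n x) = indicator A x"
      by (intro antisym SUP_least SUP_upper2[of n]) (auto split: split_indicator)
    then show ?thesis using True by simp
  next
    case False
    then have "x \<notin> I n" for n by (auto simp: I_def) (meson exp_gt_zero less_le_trans)
    then show ?thesis using False by simp
  qed
  have S2: "(SUP n. ?b n y) = ennreal (exp y) * indicator A (exp y)" for y
  proof -
    obtain n :: nat where "\<bar>y\<bar> < n" using reals_Archimedean2 by blast
    then show ?thesis
      by (intro antisym SUP_least SUP_upper2[of n]) (auto split: split_indicator)
  qed
  have eq: "(\<integral>\<^sup>+x. ?a n x \<partial>lborel) =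
      (\<integral>\<^sup>+y. ?b n y \<partial>lborel)" for n
  proof -
    have "(\<integral>\<^sup>+x. ennreal (indicator A x * indicator {exp (- real n)..exp (real n)} x) \<partial>lborel) =
      (\<integral>\<^sup>+y. ennreal (indicator A (exp y) * exp y * indicator {- real n..real n} y) \<partial>lborel)"
      by (rule nn_integral_substitution[where f="indicator A" and g=exp and g'=exp])
        (auto intro!: derivative_eq_intros continuous_intros simp: set_borel_measurable_def)
    then show ?thesis by (simp add: I_def ennreal_mult'' ennreal_indicator)
  qed
  have "emeasure ?M A = (\<integral>\<^sup>+x. (SUP n. ?a n x) \<partial>lborel)"
    by (simp add: emeasure_density S1 mult.commute)
  also have "\<dots> = (SUP n. \<integral>\<^sup>+x. ?a n x \<partial>lborel)"
    using I1 by (intro nn_integral_monotone_convergence_SUP) (auto simp: I_def)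
  also have "\<dots> = (\<integral>\<^sup>+y. (SUP n. ?b n y) \<partial>lborel)"
    using I2 by (subst nn_integral_monotone_convergence_SUP) (auto simp: eq)
  also have "\<dots> = emeasure ?N A"
    by (simp add: S2 nn_integral_indicator[symmetric] nn_integral_distr nn_integral_density del: nn_integral_indicator)
  finally show "emeasure ?M A = emeasure ?N A" .
qed simp

lemma nn_integral_Ioi_exp:
  fixes F :: "real \<Rightarrow> ennreal"
  assumes [measurable]: "F \<in> borel_measurable borel"
  shows "(\<integral>\<^sup>+x\<in>{0<..}. F x \<partial>lborel) = (\<integral>\<^sup>+y. ennreal (exp y) * F (exp y) \<partial>lborel)"
proof -
  have "(\<integral>\<^sup>+x\<in>{0<..}. F x \<partial>lborel) = (\<integral>\<^sup>+x. F x \<partial>density lborel (\<lambda>x. ennreal (indicator {0<..} x)))"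
    by (simp add: nn_integral_density ennreal_indicator mult.commute)
  also have "\<dots> = (\<integral>\<^sup>+y. ennreal (exp y) * F (exp y) \<partial>lborel)"
    by (simp add: lborel_Ioi_eq_distr_exp nn_integral_distr nn_integral_density)
  finally show ?thesis .
qed

lemma nn_integral_Ioi_powr:
  fixes F :: "real \<Rightarrow> ennreal" and b c :: real
  assumes [measurable]: "F \<in> borel_measurable borel" and c: "c \<noteq> 0" and b: "b > 0"
  shows "(\<integral>\<^sup>+x\<in>{0<..}. F x \<partial>lborel) = (\<integral>\<^sup>+x\<in>{0<..}. ennreal (\<bar>c\<bar> * b * x powr (c - 1)) * F (b * x powr c) \<partial>lborel)"
proof -
  let ?d = "\<lambda>y. \<bar>c\<bar> * b * exp y powr (c - 1)"
  have "(\<integral>\<^sup>+x\<in>{0<..}. F x \<partial>lborel) = (\<integral>\<^sup>+y. ennreal (exp y) * F (exp y) \<partial>lborel)"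
    by (rule nn_integral_Ioi_exp) simp
  also have "\<dots> = ennreal \<bar>c\<bar> * (\<integral>\<^sup>+y. ennreal (exp (ln b + c * y)) * F (exp (ln b + c * y)) \<partial>lborel)"
    by (rule nn_integral_real_affine) (use c in auto)
  also have "\<dots> = (\<integral>\<^sup>+y. ennreal \<bar>c\<bar> * (ennreal (exp (ln b + c * y)) * F (exp (ln b + c * y))) \<partial>lborel)"
    by (rule nn_integral_cmult[symmetric]) simp
  also have "\<dots> = (\<integral>\<^sup>+y. ennreal (exp y) * (ennreal (?d y) * F (b * exp y powr c)) \<partial>lborel)"
  proof (rule nn_integral_cong)
    fix y
    have 1: "exp (ln b + c * y) = b * exp y powr c" using b by (simp add: exp_add powr_def)
    have 2: "\<bar>c\<bar> * (b * exp y powr c) = exp y * (?d y)"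
      by (simp add: powr_diff)
    have "ennreal \<bar>c\<bar> * ennreal (b * exp y powr c) = ennreal (exp y) * ennreal (?d y)"
      using arg_cong[OF 2, of ennreal] b by (simp add: ennreal_mult[symmetric])
    then show "ennreal \<bar>c\<bar> * (ennreal (exp (ln b + c * y)) * F (exp (ln b + c * y))) =
      ennreal (exp y) * (ennreal (?d y) * F (b * exp y powr c))"
      by (simp only: 1 mult.assoc[symmetric])
  qed
  also have "\<dots> = (\<integral>\<^sup>+x\<in>{0<..}. ennreal (\<bar>c\<bar> * b * x powr (c - 1)) * F (b * x powr c) \<partial>lborel)"
    by (rule nn_integral_Ioi_exp[symmetric]) simp
  finally show ?thesis .
qed

lemma nn_integral_Gamma:
  assumes "a > 0" "b > 0"
  shows "(\<integral>\<^sup>+x\<in>{0<..}. ennreal (x powr (a - 1) * exp (- b * x)) \<partial>lborel) = ennreal (Gamma a * b powr (- a))"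
proof -
  let ?I = "\<integral>\<^sup>+x\<in>{0<..}. ennreal (x powr (a - 1) * exp (- b * x)) \<partial>lborel"
  have "ennreal (Gamma a) = (\<integral>\<^sup>+t. ennreal (indicator {0..} t * t powr (a - 1) / exp t) \<partial>lborel)"
    using Gamma_conv_nn_integral_real[OF assms(1)] by simp
  also have "\<dots> = (\<integral>\<^sup>+t\<in>{0<..}. ennreal (t powr (a - 1) * exp (- t)) \<partial>lborel)"
    by (intro nn_integral_cong) (auto split: split_indicator simp: exp_minus field_simps)
  also have "\<dots> = (\<integral>\<^sup>+x\<in>{0<..}. ennreal (\<bar>1\<bar> * b * x powr (1 - 1)) * ennreal ((b * x powr 1) powr (a - 1) * exp (- (b * x powr 1))) \<partial>lborel)"
    using assms by (intro nn_integral_Ioi_powr) auto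
  also have "\<dots> = (\<integral>\<^sup>+x. ennreal (b powr a) * (ennreal (x powr (a - 1) * exp (- b * x)) * indicator {0<..} x) \<partial>lborel)"
    using assms by (intro nn_integral_cong)
      (auto split: split_indicator simp: ennreal_mult[symmetric] powr_mult powr_diff)
  also have "\<dots> = ennreal (b powr a) * ?I"
    by (rule nn_integral_cmult) simp
  finally have "ennreal (b powr (- a)) * ennreal (Gamma a) = ennreal (b powr (- a)) * (ennreal (b powr a) * ?I)"
    by simp
  also have "\<dots> = ?I"
    using assms by (simp add: mult.assoc[symmetric] ennreal_mult[symmetric] powr_add[symmetric])
  finally show ?thesis using assms by (simp add: ennreal_mult'[symmetric] mult.commute)
qed

lemma nn_integral_Beta:
  assumes "a > 0" "b > 0" "v > 0"
  shows "(\<integral>\<^sup>+x\<in>{0<..<v}. ennreal (x powr (a - 1) * (v - x) powr (b - 1)) \<partial>lborel)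
       = ennreal (Beta a b * v powr (a + b - 1))"
proof -
  let ?I = "\<integral>\<^sup>+x\<in>{0<..<v}. ennreal (x powr (a - 1) * (v - x) powr (b - 1)) \<partial>lborel"
  let ?F = "\<lambda>t. ennreal ((0 + 1/v * t) powr (a - 1) * (1 - (0 + 1/v * t)) powr (b - 1)) * indicator {0..1} (0 + 1/v * t)"
  have "ennreal (Beta a b) = (\<integral>\<^sup>+t. ennreal (t powr (a - 1) * (1 - t) powr (b - 1)) * indicator {0..1} t \<partial>lborel)"
    using assms by (intro nn_integral_has_integral_lebesgue'[symmetric] has_integral_Beta_real) auto
  also have "\<dots> = ennreal \<bar>1/v\<bar> * (\<integral>\<^sup>+t. ?F t \<partial>lborel)"
    using assms by (intro nn_integral_real_affine) auto
  finally have "ennreal (v powr (a + b - 1)) * ennreal (Beta a b) = 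
     ennreal (v powr (a + b - 1)) * (ennreal \<bar>1/v\<bar> * (\<integral>\<^sup>+t. ?F t \<partial>lborel))"
    by simp
  also have "\<dots> = (\<integral>\<^sup>+t. ennreal (v powr (a + b - 2)) * (?F t) \<partial>lborel)"
  proof -
    have "v powr (a + b - 1) * \<bar>1/v\<bar> = v powr (a + b - 2)"
      using assms by (simp add: powr_diff power2_eq_square)
    then show ?thesis
      by (subst nn_integral_cmult) (simp_all add: mult.assoc[symmetric] ennreal_mult[symmetric])
  qed
  also have "\<dots> = ?I"
  proof (rule nn_integral_cong, goal_cases)
    case (1 t)
    show ?case
    proof (cases "t \<in> {0<..<v}")
      case True
      have "v powr (a + b - 2) = v powr (a - 1) * v powr (b - 1)"
        by (simp add: powr_add[symmetric])
      moreover have "v powr (a - 1) * (1/v * t) powr (a - 1) = t powr (a - 1)"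
        using True assms by (subst powr_mult[symmetric]) auto
      moreover have "v powr (b - 1) * (1 - 1/v * t) powr (b - 1) = (v - t) powr (b - 1)"
        using True assms by (subst powr_mult[symmetric]) (auto simp: algebra_simps)
      ultimately have "v powr (a + b - 2) * ((1/v * t) powr (a - 1) * (1 - 1/v * t) powr (b - 1)) = t powr (a - 1) * (v - t) powr (b - 1)"
        by (metis mult.assoc mult.left_commute)
      then show ?thesis using True assms
        by (simp add: mult.assoc[symmetric] ennreal_mult[symmetric])
    next
      case False
      then show ?thesis using assms by (auto split: split_indicator simp: field_simps)
    qed
  qed
  finally have "ennreal (v powr (a + b - 1)) * ennreal (Beta a b) = ?I" .
  then show ?thesis by (subst mult.commute[of "Beta a b"], subst ennreal_mult') auto
qed

lemma nn_integral_Ioi_shift: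
  fixes F :: "real \<Rightarrow> ennreal"
  assumes [measurable]: "F \<in> borel_measurable borel"
  shows "(\<integral>\<^sup>+s\<in>{0<..}. F (t + s) \<partial>lborel) = (\<integral>\<^sup>+s\<in>{t<..}. F s \<partial>lborel)"
  by (subst nn_integral_real_affine[where c=1 and t=t and f="\<lambda>s. F s * indicator {t<..} s"])
    (auto intro!: nn_integral_cong split: split_indicator)

section \<open>The stable subordinator\<close>

locale stable_subordinator =
  fixes \<sigma> :: real and \<eta> :: "real \<Rightarrow> real \<Rightarrow> real"
  assumes \<sigma>: "0 < \<sigma>" "\<sigma> < 1" and \<eta>: "stable_subordinator_density \<sigma> \<eta>"
begin

text \<open>
  The densities \<open>\<eta> t\<close> are given separately for each \<open>t\<close>, whereas the time integrals below require
  measurability in both variables. Therefore the semigroup is built from the rescaled density of time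
  one, which is jointly measurable and equals \<open>\<eta> t\<close> almost everywhere (\<open>density_\<eta>_eq_sub\<close>).
\<close>

definition sub_dens :: "real \<Rightarrow> real \<Rightarrow> real" where
  "sub_dens t s = t powr (- 1 / \<sigma>) * \<eta> 1 (t powr (- 1 / \<sigma>) * s)"

lemma borel_measurable_sub[measurable (raw)]:
  assumes [measurable]: "f \<in> borel_measurable M" "g \<in> borel_measurable M"
  shows "(\<lambda>x. sub_dens (f x) (g x)) \<in> borel_measurable M"
proof -
  have [measurable]: "\<eta> 1 \<in> borel_measurable borel"
    using \<eta> by (simp add: stable_subordinator_density_def)
  show ?thesis unfolding sub_dens_def by measurable
qed

lemma sub_nonneg[simp]: "0 \<le> sub_dens t s"
  using \<eta> by (simp add: sub_dens_def stable_subordinator_density_def)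

lemma sub_eq_0: "s \<le> 0 \<Longrightarrow> sub_dens t s = 0"
  using \<eta> by (auto simp add: sub_dens_def stable_subordinator_density_def mult_nonneg_nonpos)

lemma \<eta>_Laplace:
  assumes "t > 0" "u \<ge> 0"
  shows "(\<integral>\<^sup>+s. ennreal (exp (- u * s)) * ennreal (\<eta> t s) \<partial>lborel) = ennreal (exp (- t * u powr \<sigma>))"
proof -
  have "has_bochner_integral lborel (\<lambda>s. exp (- u * s) * \<eta> t s) (exp (- t * u powr \<sigma>))" "\<And>s. 0 \<le> \<eta> t s"
    using assms \<eta> by (auto simp: stable_subordinator_density_def)
  then show ?thesis
    by (subst ennreal_mult[symmetric]) (auto simp: has_bochner_integral_iff nn_integral_eq_integral)
qed

lemma sub_Laplace:
  assumes t: "t > 0" and u: "u \<ge> 0"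
  shows "(\<integral>\<^sup>+s. ennreal (exp (- u * s)) * ennreal (sub_dens t s) \<partial>lborel) = ennreal (exp (- t * u powr \<sigma>))"
proof -
  define c where "c = t powr (- 1 / \<sigma>)"
  have c: "c > 0" using t by (simp add: c_def)
  have [measurable]: "\<eta> 1 \<in> borel_measurable borel"
    using \<eta> by (simp add: stable_subordinator_density_def)
  have "ennreal (exp (- 1 * (u / c) powr \<sigma>)) = (\<integral>\<^sup>+s. ennreal (exp (- (u / c) * s)) * ennreal (\<eta> 1 s) \<partial>lborel)"
    using u c by (intro \<eta>_Laplace[symmetric]) auto
  also have "\<dots> = ennreal \<bar>c\<bar> * (\<integral>\<^sup>+s. ennreal (exp (- (u / c) * (0 + c * s))) * ennreal (\<eta> 1 (0 + c * s)) \<partial>lborel)"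
    by (rule nn_integral_real_affine) (use c in auto)
  also have "\<dots> = (\<integral>\<^sup>+s. ennreal c * (ennreal (exp (- u * s)) * ennreal (\<eta> 1 (c * s))) \<partial>lborel)"
    using c by (subst nn_integral_cmult[symmetric]) auto
  also have "\<dots> = (\<integral>\<^sup>+s. ennreal (exp (- u * s)) * ennreal (sub_dens t s) \<partial>lborel)"
  proof (rule nn_integral_cong)
    fix s
    have "ennreal (sub_dens t s) = ennreal c * ennreal (\<eta> 1 (c * s))"
      using c \<eta> by (auto simp: sub_dens_def c_def stable_subordinator_density_def ennreal_mult)
    then show "ennreal c * (ennreal (exp (- u * s)) * ennreal (\<eta> 1 (c * s))) = ennreal (exp (- u * s)) * ennreal (sub_dens t s)"
      by (simp add: mult_ac)
  qed
  also have "(u / c) powr \<sigma> = t * u powr \<sigma>"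
    using u c t \<sigma> by (simp add: c_def powr_divide powr_mult powr_powr powr_minus field_simps)
  finally show ?thesis by simp
qed

lemma sub_total: "t > 0 \<Longrightarrow> (\<integral>\<^sup>+s. ennreal (sub_dens t s) \<partial>lborel) = 1"
  using sub_Laplace[of t 0] \<sigma> by simp

text \<open>
  Both sides have the Laplace transform \<open>exp (- t * u powr \<sigma>)\<close>.
\<close>

lemma density_\<eta>_eq_sub:
  assumes t: "t > 0"
  shows "density lborel (\<lambda>s. ennreal (\<eta> t s)) = density lborel (\<lambda>s. ennreal (sub_dens t s))"
proof -
  have [measurable]: "\<eta> t \<in> borel_measurable borel" and 0: "\<And>s. s \<le> 0 \<Longrightarrow> \<eta> t s = 0"
    using \<eta> t by (auto simp add: stable_subordinator_density_def)
  have "AE x in density lborel (\<lambda>s. ennreal (\<eta> t s)). 0 \<le> x"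
    using 0 by (subst AE_density) (auto intro!: AE_I2 simp: not_le[symmetric] less_imp_le intro: ccontr)
  moreover have "AE x in density lborel (\<lambda>s. ennreal (sub_dens t s)). 0 \<le> x"
    using sub_eq_0 by (subst AE_density) (auto intro!: AE_I2 simp: not_le[symmetric] less_imp_le intro: ccontr)
  ultimately show ?thesis
  proof (intro measure_eq_of_nn_Laplace_eq)
    show "emeasure (density lborel (\<lambda>s. ennreal (\<eta> t s))) (space (density lborel (\<lambda>s. ennreal (\<eta> t s)))) < \<infinity>"
      using \<eta>_Laplace[OF t, of 0] by (simp add: emeasure_density)
  next
    fix k :: nat
    show "(\<integral>\<^sup>+ x. ennreal (exp (- real k * x)) \<partial>density lborel (\<lambda>x. ennreal (\<eta> t x))) =
        (\<integral>\<^sup>+ x. ennreal (exp (- real k * x)) \<partial>density lborel (\<lambda>x. ennreal (sub_dens t x)))"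
      using \<eta>_Laplace[OF t, of k] sub_Laplace[OF t, of k] by (simp add: nn_integral_density mult.commute)
  qed auto
qed

text \<open>
  The convolution semigroup property, because the Laplace transforms multiply.
\<close>

lemma sub_convolution:
  fixes F :: "real \<Rightarrow> ennreal"
  assumes t: "t > 0" "s > 0" and [measurable]: "F \<in> borel_measurable borel"
  shows "(\<integral>\<^sup>+u. ennreal (sub_dens t u) * (\<integral>\<^sup>+v. ennreal (sub_dens s v) * F (u + v) \<partial>lborel) \<partial>lborel)
       = (\<integral>\<^sup>+w. ennreal (sub_dens (t + s) w) * F w \<partial>lborel)"
proof -
  define D where "D t = density lborel (\<lambda>u. ennreal (sub_dens t u))" for t
  have [measurable_cong, simp]: "sets (D t) = sets borel" for t by (simp add: D_def)
  have fin: "finite_measure (D t)" if "t > 0" for t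
    using sub_total[OF that] by (auto intro!: finite_measureI simp: D_def emeasure_density)
  have pos: "AE x in D t. 0 \<le> x" for t
    unfolding D_def
    using sub_eq_0 by (subst AE_density) (auto intro!: AE_I2 simp: not_le[symmetric] less_imp_le intro: ccontr)
  have nn: "(\<integral>\<^sup>+x. G x \<partial>D t) = (\<integral>\<^sup>+x. ennreal (sub_dens t x) * G x \<partial>lborel)"
    if [measurable]: "G \<in> borel_measurable borel" for G t
    by (simp add: D_def nn_integral_density)
  have conv: "(\<integral>\<^sup>+x. G x \<partial>(D t \<star> D s)) = (\<integral>\<^sup>+u. ennreal (sub_dens t u) * (\<integral>\<^sup>+v. ennreal (sub_dens s v) * G (u + v) \<partial>lborel) \<partial>lborel)"
    if [measurable]: "G \<in> borel_measurable borel" for G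
    using fin t by (subst nn_integral_convolution) (auto simp: nn)
  have "D t \<star> D s = D (t + s)"
  proof (rule measure_eq_of_nn_Laplace_eq)
    have "finite_measure (D t \<star> D s)" using fin t by (intro convolution_finite) auto
    then show "emeasure (D t \<star> D s) (space (D t \<star> D s)) < \<infinity>"
      using finite_measure.emeasure_finite[of "D t \<star> D s" "space (D t \<star> D s)"] by (simp only: less_top infinity_ennreal_def)
    have "(\<integral>\<^sup>+x. indicator {..<0} x \<partial>(D t \<star> D s)) = (\<integral>\<^sup>+u. ennreal (sub_dens t u) * (\<integral>\<^sup>+v. ennreal (sub_dens s v) * indicator {..<0} (u + v) \<partial>lborel) \<partial>lborel)"
      by (rule conv) simp
    also have "\<dots> = (\<integral>\<^sup>+u. ennreal (sub_dens t u) * 0 \<partial>lborel)"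
    proof (rule nn_integral_cong, goal_cases)
      case (1 u)
      show ?case
      proof (cases "u \<le> 0")
        case False
        have "(\<integral>\<^sup>+v. ennreal (sub_dens s v) * indicator {..<0} (u + v) \<partial>lborel) = (\<integral>\<^sup>+v. 0 \<partial>(lborel::real measure))"
          using False by (intro nn_integral_cong) (auto simp: sub_eq_0 split: split_indicator)
        then show ?thesis by simp
      qed (simp add: sub_eq_0)
    qed
    finally have "emeasure (D t \<star> D s) {..<0} = 0" by simp
    then show "AE x in D t \<star> D s. 0 \<le> x"
      by (intro AE_I[of _ _ "{..<0}"]) auto
    fix k :: nat
    have *: "(\<integral>\<^sup>+v. ennreal (sub_dens s v) * ennreal (exp (- real k * (u + v))) \<partial>lborel)
        = ennreal (exp (- real k * u)) * ennreal (exp (- s * real k powr \<sigma>))" for u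
    proof -
      have "(\<integral>\<^sup>+v. ennreal (sub_dens s v) * ennreal (exp (- real k * (u + v))) \<partial>lborel)
        = (\<integral>\<^sup>+v. ennreal (exp (- real k * u)) * (ennreal (exp (- real k * v)) * ennreal (sub_dens s v)) \<partial>lborel)"
        by (intro nn_integral_cong) (simp add: ennreal_mult[symmetric] algebra_simps exp_add[symmetric] exp_diff exp_minus divide_inverse)
      also have "\<dots> = ennreal (exp (- real k * u)) * ennreal (exp (- s * real k powr \<sigma>))"
        using t by (subst nn_integral_cmult) (simp_all add: sub_Laplace[simplified])
      finally show ?thesis .
    qed
    have "(\<integral>\<^sup>+x. ennreal (exp (- real k * x)) \<partial>(D t \<star> D s)) =
       (\<integral>\<^sup>+u. (ennreal (exp (- real k * u)) * ennreal (sub_dens t u)) * ennreal (exp (- s * real k powr \<sigma>)) \<partial>lborel)"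
      by (subst conv, simp, subst *) (simp add: mult_ac)
    also have "\<dots> = ennreal (exp (- t * real k powr \<sigma>)) * ennreal (exp (- s * real k powr \<sigma>))"
      using t by (subst nn_integral_multc) (simp_all add: sub_Laplace[simplified])
    also have "\<dots> = ennreal (exp (- (t + s) * real k powr \<sigma>))"
      by (simp add: ennreal_mult[symmetric] exp_add[symmetric] algebra_simps exp_diff exp_minus divide_inverse)
    also have "\<dots> = (\<integral>\<^sup>+x. ennreal (exp (- real k * x)) \<partial>D (t + s))"
      using sub_Laplace[of "t + s" "real k"] t by (simp add: nn mult.commute)
    finally show "(\<integral>\<^sup>+x. ennreal (exp (- real k * x)) \<partial>(D t \<star> D s)) = (\<integral>\<^sup>+x. ennreal (exp (- real k * x)) \<partial>D (t + s))" .
  qed (use pos in auto)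
  then show ?thesis
    using conv[of F] nn[of F "t + s"] by simp
qed

text \<open>
  Write \<open>v powr (- \<sigma>)\<close> as a Gamma integral over \<open>exp (- x * v)\<close>; the inner integral over \<open>v\<close> is then
  the Laplace transform of the density.
\<close>

lemma sub_negative_moment:
  "(\<integral>\<^sup>+v\<in>{0<..}. ennreal (sub_dens 1 v * v powr (- \<sigma>)) \<partial>lborel) = ennreal (1 / (\<sigma> * Gamma \<sigma>))"
proof -
  let ?F = "\<lambda>v x. ennreal (x powr (\<sigma> - 1)) * indicator {0<..} x * (ennreal (exp (- x * v)) * ennreal (sub_dens 1 v))"
  let ?L = "\<integral>\<^sup>+v\<in>{0<..}. ennreal (sub_dens 1 v * v powr (- \<sigma>)) \<partial>lborel"
  have "ennreal (Gamma \<sigma>) * ?L = (\<integral>\<^sup>+v. ennreal (Gamma \<sigma>) * (ennreal (sub_dens 1 v * v powr (- \<sigma>)) * indicator {0<..} v) \<partial>lborel)"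
    by (rule nn_integral_cmult[symmetric]) simp
  also have "\<dots> = (\<integral>\<^sup>+v. (\<integral>\<^sup>+x. ?F v x \<partial>lborel) \<partial>lborel)"
  proof (rule nn_integral_cong, goal_cases)
    case (1 v)
    show ?case
    proof (cases "v > 0")
      case True
      have "(\<integral>\<^sup>+x. ?F v x \<partial>lborel)
         = (\<integral>\<^sup>+x. ennreal (sub_dens 1 v) * (ennreal (x powr (\<sigma> - 1) * exp (- v * x)) * indicator {0<..} x) \<partial>lborel)"
        by (intro nn_integral_cong) (auto simp: ennreal_mult mult_ac)
      also have "\<dots> = ennreal (sub_dens 1 v) * ennreal (Gamma \<sigma> * v powr (- \<sigma>))"
        using nn_integral_Gamma[OF \<sigma>(1) True] by (subst nn_integral_cmult) auto
      finally show ?thesis using True \<sigma> by (simp add: ennreal_mult[symmetric] mult_ac)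
    qed (simp add: sub_eq_0)
  qed
  also have "\<dots> = (\<integral>\<^sup>+x. (\<integral>\<^sup>+v. ?F v x \<partial>lborel) \<partial>lborel)"
    by (rule lborel_pair.Fubini') simp
  also have "\<dots> = (\<integral>\<^sup>+x. ennreal (x powr (\<sigma> - 1) * exp (- (x powr \<sigma>))) * indicator {0<..} x \<partial>lborel)"
    using sub_Laplace[of 1] by (intro nn_integral_cong)
      (auto simp: nn_integral_cmult ennreal_mult split: split_indicator)
  also have "\<dots> = (\<integral>\<^sup>+x. ennreal (1 / \<sigma>) * ((ennreal (\<bar>\<sigma>\<bar> * 1 * x powr (\<sigma> - 1)) * ennreal (exp (- (1 * x powr \<sigma>)))) * indicator {0<..} x) \<partial>lborel)"
    using \<sigma> by (intro nn_integral_cong)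
      (auto simp: ennreal_mult[symmetric] mult.assoc[symmetric] split: split_indicator)
  also have "\<dots> = ennreal (1 / \<sigma>) * (\<integral>\<^sup>+x\<in>{0<..}. ennreal (\<bar>\<sigma>\<bar> * 1 * x powr (\<sigma> - 1)) * ennreal (exp (- (1 * x powr \<sigma>))) \<partial>lborel)"
    by (rule nn_integral_cmult) simp
  also have "\<dots> = ennreal (1 / \<sigma>) * (\<integral>\<^sup>+x\<in>{0<..}. ennreal (exp (- x)) \<partial>lborel)"
    using \<sigma> by (subst nn_integral_Ioi_powr[symmetric]) auto
  also have "(\<integral>\<^sup>+x\<in>{0<..}. ennreal (exp (- x)) \<partial>lborel) = 1"
  proof -
    have "(\<integral>\<^sup>+x\<in>{0<..}. ennreal (exp (- x)) \<partial>lborel) = (\<integral>\<^sup>+x\<in>{0<..}. ennreal (x powr (1 - 1) * exp (- 1 * x)) \<partial>lborel)"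
      by (intro nn_integral_cong) (auto split: split_indicator)
    then show ?thesis using nn_integral_Gamma[of 1 1] by simp
  qed
  finally have "ennreal (1 / Gamma \<sigma>) * (ennreal (Gamma \<sigma>) * ?L) = ennreal (1 / Gamma \<sigma>) * ennreal (1 / \<sigma>)"
    by simp
  moreover have "ennreal (1 / Gamma \<sigma>) * ennreal (Gamma \<sigma>) = 1"
    using Gamma_real_pos[OF \<sigma>(1)] by (simp add: ennreal_mult[symmetric])
  ultimately show ?thesis
    using Gamma_real_pos[OF \<sigma>(1)] \<sigma> by (simp add: mult.assoc[symmetric] ennreal_mult[symmetric] mult.commute)
qed

text \<open>
  By scaling, integration over time is a substitution that leads to the moment of order \<open>- \<sigma>\<close>.
\<close>

lemma sub_potential_density:
  assumes u: "u > 0"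
  shows "(\<integral>\<^sup>+s\<in>{0<..}. ennreal (sub_dens s u) \<partial>lborel) = ennreal (u powr (\<sigma> - 1) / Gamma \<sigma>)"
proof -
  define b where "b = u powr \<sigma>"
  have b: "b > 0" using u by (simp add: b_def)
  have "(\<integral>\<^sup>+s\<in>{0<..}. ennreal (sub_dens s u) \<partial>lborel) =
    (\<integral>\<^sup>+v\<in>{0<..}. ennreal (\<bar>- \<sigma>\<bar> * b * v powr (- \<sigma> - 1)) * ennreal (sub_dens (b * v powr (- \<sigma>)) u) \<partial>lborel)"
    using \<sigma> b by (intro nn_integral_Ioi_powr) auto
  also have "\<dots> = (\<integral>\<^sup>+v. ennreal (\<sigma> * u powr (\<sigma> - 1)) * (ennreal (sub_dens 1 v * v powr (- \<sigma>)) * indicator {0<..} v) \<partial>lborel)"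
  proof (rule nn_integral_cong, goal_cases)
    case (1 v)
    show ?case
    proof (cases "v > 0")
      case True
      have "(b * v powr (- \<sigma>)) powr (- 1 / \<sigma>) = v / u"
      proof -
        have "b * v powr (- \<sigma>) = (u / v) powr \<sigma>"
          using True u by (simp add: b_def powr_divide powr_minus field_simps)
        then show ?thesis using True u \<sigma> by (simp add: powr_powr powr_minus)
      qed
      then have 1: "sub_dens (b * v powr (- \<sigma>)) u = v / u * sub_dens 1 v"
        using u by (simp add: sub_dens_def)
      have "(\<bar>- \<sigma>\<bar> * b * v powr (- \<sigma> - 1)) * (v / u * sub_dens 1 v) = (\<sigma> * u powr (\<sigma> - 1)) * (sub_dens 1 v * v powr (- \<sigma>))"
        using True u \<sigma> by (simp add: b_def powr_diff field_simps)
      then show ?thesis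
        using True u \<sigma> b by (simp add: 1 ennreal_mult[symmetric])
    qed simp
  qed
  also have "\<dots> = ennreal (\<sigma> * u powr (\<sigma> - 1)) * ennreal (1 / (\<sigma> * Gamma \<sigma>))"
    by (subst nn_integral_cmult) (simp_all add: sub_negative_moment)
  also have "\<dots> = ennreal (u powr (\<sigma> - 1) / Gamma \<sigma>)"
    using Gamma_real_pos[OF \<sigma>(1)] \<sigma> by (simp add: ennreal_mult[symmetric])
  finally show ?thesis .
qed

end

section \<open>Gaussian kernels and powers\<close>

lemma nn_integral_lborel_affine:
  fixes f :: "'a::euclidean_space \<Rightarrow> ennreal"
  assumes [measurable]: "f \<in> borel_measurable borel" and c: "c \<noteq> 0"
  shows "(\<integral>\<^sup>+x. f x \<partial>lborel) = ennreal (\<bar>c\<bar> ^ DIM('a)) * (\<integral>\<^sup>+x. f (t + c *\<^sub>R x) \<partial>lborel)"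
  by (subst lborel_affine[OF c, of t]) (simp add: nn_integral_density nn_integral_distr nn_integral_cmult)

lemma borel_measurable_gauss_kernel[measurable (raw)]:
  fixes g :: "'b \<Rightarrow> 'a::euclidean_space"
  assumes [measurable]: "f \<in> borel_measurable M" "g \<in> borel_measurable M"
  shows "(\<lambda>x. gauss_kernel (f x) (g x)) \<in> borel_measurable M"
  unfolding gauss_kernel_def by measurable

abbreviation gauss :: "real \<Rightarrow> 'a::euclidean_space \<Rightarrow> ennreal" where
  "gauss s x \<equiv> ennreal (gauss_kernel s x)"

lemma gauss_kernel_nonneg[simp]: "0 \<le> gauss_kernel s x"
  by (simp add: gauss_kernel_def)

lemma gauss_kernel_uminus[simp]: "gauss_kernel s (- x) = gauss_kernel s x"
  by (simp add: gauss_kernel_def)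

text \<open>
  The factorisation reduces total mass and convolution of Gaussian kernels to dimension one.
\<close>

lemma gauss_kernel_eq_prod:
  fixes x :: "'a::euclidean_space"
  assumes s: "s > 0"
  shows "gauss_kernel s x = (\<Prod>b\<in>Basis. normal_density 0 (sqrt (2 * s)) (x \<bullet> b))"
proof -
  have n: "(norm x)\<^sup>2 = (\<Sum>b\<in>Basis. (x \<bullet> b)\<^sup>2)"
    unfolding power2_norm_eq_inner by (subst euclidean_inner) (simp add: power2_eq_square)
  have "(4 * pi * s) powr (- real DIM('a) / 2) = ((4 * pi * s) powr (- 1 / 2)) powr real DIM('a)"
    by (simp add: powr_powr)
  also have "\<dots> = ((4 * pi * s) powr (- 1 / 2)) ^ DIM('a)"
    using s by (simp add: powr_realpow)
  also have "(4 * pi * s) powr (- 1 / 2) = 1 / sqrt (4 * pi * s)"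
    using s by (simp add: powr_minus_divide powr_half_sqrt)
  finally have p: "(4 * pi * s) powr (- real DIM('a) / 2) = (1 / sqrt (4 * pi * s)) ^ DIM('a)" .
  have "(\<Prod>b\<in>(Basis::'a set). normal_density 0 (sqrt (2 * s)) (x \<bullet> b))
      = (\<Prod>b\<in>(Basis::'a set). (1 / sqrt (4 * pi * s)) * exp (- (x \<bullet> b)\<^sup>2 / (4 * s)))"
    using s by (intro prod.cong) (auto simp: normal_density_def mult_ac)
  also have "\<dots> = (1 / sqrt (4 * pi * s)) ^ DIM('a) * exp (\<Sum>b\<in>(Basis::'a set). - (x \<bullet> b)\<^sup>2 / (4 * s))"
    by (simp only: prod.distrib prod_constant exp_sum[OF finite_Basis])
  also have "(\<Sum>b\<in>(Basis::'a set). - (x \<bullet> b)\<^sup>2 / (4 * s)) = - (norm x)\<^sup>2 / (4 * s)"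
    by (simp add: n sum_divide_distrib sum_negf)
  finally show ?thesis unfolding gauss_kernel_def p by (rule sym)
qed

lemma nn_integral_gauss_kernel:
  assumes "s > 0"
  shows "(\<integral>\<^sup>+x. gauss s (x :: 'a::euclidean_space) \<partial>lborel) = 1"
proof -
  have "(\<integral>\<^sup>+x. gauss s (x :: 'a) \<partial>lborel)
     = (\<integral>\<^sup>+x. (\<Prod>b\<in>(Basis::'a set). ennreal (normal_density 0 (sqrt (2 * s)) (x \<bullet> b))) \<partial>lborel)"
    using assms by (simp add: gauss_kernel_eq_prod prod_ennreal)
  also have "\<dots> = (\<Prod>b\<in>(Basis::'a set). \<integral>\<^sup>+x. ennreal (normal_density 0 (sqrt (2 * s)) x) \<partial>lborel)"
    by (rule nn_integral_lborel_prod) auto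
  also have "\<dots> = 1"
    using assms by (subst nn_integral_eq_integral) auto
  finally show ?thesis .
qed

lemma gauss_kernel_convolution:
  fixes v :: "'a::euclidean_space"
  assumes s: "s > 0" "r > 0"
  shows "(\<integral>\<^sup>+w. gauss s (v - w) * gauss r w \<partial>lborel) = gauss (s + r) v"
proof -
  have "(\<integral>\<^sup>+w. gauss s (v - w) * gauss r w \<partial>lborel)
     = (\<integral>\<^sup>+w. (\<Prod>b\<in>(Basis::'a set). ennreal (normal_density 0 (sqrt (2 * s)) (v \<bullet> b - w \<bullet> b) * normal_density 0 (sqrt (2 * r)) (w \<bullet> b))) \<partial>lborel)"
    using s by (simp add: gauss_kernel_eq_prod prod_ennreal prod.distrib ennreal_mult prod_nonneg inner_diff_left)
  also have "\<dots> = (\<Prod>b\<in>(Basis::'a set). \<integral>\<^sup>+w. ennreal (normal_density 0 (sqrt (2 * s)) (v \<bullet> b - w) * normal_density 0 (sqrt (2 * r)) w) \<partial>lborel)"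
    by (rule nn_integral_lborel_prod[where f="\<lambda>b w. ennreal (normal_density 0 (sqrt (2 * s)) (v \<bullet> b - w) * normal_density 0 (sqrt (2 * r)) w)"]) auto
  also have "\<dots> = (\<Prod>b\<in>(Basis::'a set). ennreal (normal_density 0 (sqrt ((sqrt (2 * s))\<^sup>2 + (sqrt (2 * r))\<^sup>2)) (v \<bullet> b)))"
    using s by (intro prod.cong refl conv_normal_density_zero_mean[THEN fun_cong]) auto
  also have "\<dots> = gauss (s + r) v"
    using s by (simp add: gauss_kernel_eq_prod prod_ennreal distrib_left)
  finally show ?thesis .
qed

lemma gauss_kernel_scale:
  fixes x :: "'a::euclidean_space"
  assumes "v > 0" "x \<noteq> 0" "norm e = 1"
  shows "gauss_kernel ((norm x)\<^sup>2 * v) x = norm x powr (- real DIM('a)) * gauss_kernel v (e::'a)"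
proof -
  have "(4 * pi * ((norm x)\<^sup>2 * v)) powr (- real DIM('a) / 2) = ((norm x)\<^sup>2) powr (- real DIM('a) / 2) * (4 * pi * v) powr (- real DIM('a) / 2)"
    using assms by (subst powr_mult[symmetric]) (auto simp: mult_ac)
  also have "((norm x)\<^sup>2) powr (- real DIM('a) / 2) = norm x powr (- real DIM('a))"
    using assms by (subst powr_realpow[symmetric, of "norm x" 2]) (auto simp: powr_powr simp del: powr_numeral powr_realpow)
  finally show ?thesis
    using assms by (simp add: gauss_kernel_def)
qed

text \<open>
  The normalisation of the representation of a power as a mixture of Gaussian kernels with weight
  \<open>r powr ((d - \<gamma>) / 2 - 1)\<close>.
\<close>

definition riesz_const :: "'a::euclidean_space itself \<Rightarrow> real \<Rightarrow> real" where
  "riesz_const _ \<gamma> = Gamma (\<gamma> / 2) * 4 powr (\<gamma> / 2) * (4 * pi) powr (- real DIM('a) / 2)"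

definition npow :: "real \<Rightarrow> 'a::euclidean_space \<Rightarrow> ennreal" where
  "npow \<gamma> x = ennreal (norm x powr (- \<gamma>))"

lemma borel_measurable_npow[measurable]: "npow \<gamma> \<in> borel_measurable borel"
  unfolding npow_def by measurable

lemma npow_less_top[simp]: "npow \<gamma> x < \<top>" "npow \<gamma> x \<noteq> \<top>"
  by (simp_all add: npow_def)

lemma npow_mult: "npow a x * npow b x = npow (a + b) x"
  by (simp add: npow_def ennreal_mult[symmetric] powr_add[symmetric] add.commute)

lemma riesz_const_pos: "\<gamma> > 0 \<Longrightarrow> riesz_const TYPE('a::euclidean_space) \<gamma> > 0"
  by (simp add: riesz_const_def Gamma_real_pos)

text \<open>
  The substitution \<open>r = |x|\<^sup>2 / (4 w)\<close> turns the integral into a Gamma integral.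
\<close>

lemma npow_eq_Gaussian_mixture:
  fixes x :: "'a::euclidean_space"
  assumes g: "\<gamma> > 0" and x: "x \<noteq> 0"
  shows "(\<integral>\<^sup>+r\<in>{0<..}. ennreal (r powr ((real DIM('a) - \<gamma>) / 2 - 1)) * gauss r x \<partial>lborel)
       = ennreal (riesz_const TYPE('a) \<gamma>) * npow \<gamma> x"
proof -
  define b where "b = (norm x)\<^sup>2 / 4"
  define D where "D = real DIM('a)"
  let ?e = "(D - \<gamma>) / 2 - 1" and ?C = "(4 * pi) powr (- D / 2) * b powr (- \<gamma> / 2)"
  have b: "b > 0" using x by (simp add: b_def)
  have "(\<integral>\<^sup>+r\<in>{0<..}. ennreal (r powr ?e) * gauss r x \<partial>lborel)
    = (\<integral>\<^sup>+r\<in>{0<..}. ennreal (\<bar>-1\<bar> * b * r powr (-1 - 1)) * (ennreal ((b * r powr -1) powr ?e) * gauss (b * r powr -1) x) \<partial>lborel)"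
    using b by (intro nn_integral_Ioi_powr) auto
  also have "\<dots> = (\<integral>\<^sup>+r. ennreal ?C * (ennreal (r powr (\<gamma> / 2 - 1) * exp (- 1 * r)) * indicator {0<..} r) \<partial>lborel)"
  proof (rule nn_integral_cong, goal_cases)
    case (1 r)
    show ?case
    proof (cases "r > 0")
      case True
      have 1: "gauss_kernel (b * r powr -1) x = (4 * pi) powr (- D / 2) * b powr (- D / 2) * r powr (D / 2) * exp (- r)"
      proof -
        have "(4 * pi * (b * r powr -1)) powr (- D / 2) = (4 * pi) powr (- D / 2) * b powr (- D / 2) * r powr (D / 2)"
          using True b unfolding mult.assoc[symmetric] by (simp add: powr_mult powr_powr powr_divide powr_minus_divide)
        moreover have "- (norm x)\<^sup>2 / (4 * (b * r powr -1)) = - r"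
          using True x by (simp add: b_def powr_minus field_simps)
        ultimately show ?thesis by (simp add: gauss_kernel_def D_def)
      qed
      have 2: "(b * r powr -1) powr ?e = b powr ?e * r powr (- ?e)"
        using True b by (simp only: powr_mult powr_powr mult_minus1)
      have "b * b powr ?e * b powr (- D / 2) = b powr (1 + ?e + (- D / 2))"
        using b by (simp only: powr_add powr_one)
      also have "1 + ?e + (- D / 2) = - \<gamma> / 2" by (simp add: field_simps)
      finally have 3: "b * b powr ?e * b powr (- D / 2) = b powr (- \<gamma> / 2)" .
      have "r powr (-1 - 1) * r powr (- ?e) * r powr (D / 2) = r powr ((-1 - 1) + (- ?e) + (D / 2))"
        by (simp only: powr_add)
      also have "(-1 - 1) + (- ?e) + (D / 2) = \<gamma> / 2 - 1" by (simp add: field_simps)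
      finally have 4: "r powr (-1 - 1) * r powr (- ?e) * r powr (D / 2) = r powr (\<gamma> / 2 - 1)" .
      have "b * r powr (-1 - 1) * ((b powr ?e * r powr (- ?e)) * ((4 * pi) powr (- D / 2) * b powr (- D / 2) * r powr (D / 2) * exp (- r)))
         = (4 * pi) powr (- D / 2) * (b * b powr ?e * b powr (- D / 2)) * ((r powr (-1 - 1) * r powr (- ?e) * r powr (D / 2)) * exp (- r))"
        by (simp only: mult_ac)
      also have "\<dots> = ?C * (r powr (\<gamma> / 2 - 1) * exp (- r))"
        by (simp only: 3 4)
      finally have 5: "\<bar>-1\<bar> * b * r powr (-1 - 1) * ((b powr ?e * r powr (- ?e)) * ((4 * pi) powr (- D / 2) * b powr (- D / 2) * r powr (D / 2) * exp (- r)))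
         = ?C * (r powr (\<gamma> / 2 - 1) * exp (- 1 * r))"
        by simp
      have 6: "ennreal A * (ennreal B * ennreal C) = ennreal D' * ennreal E"
        if "A * (B * C) = D' * E" "0 \<le> A" "0 \<le> B" "0 \<le> C" "0 \<le> D'" "0 \<le> E" for A B C D' E
        using that by (simp add: ennreal_mult[symmetric])
      have "indicator {0<..} r = (1 :: ennreal)" using True by simp
      then show ?thesis
        unfolding 1 2 by (simp only: mult_1_right) (rule 6[OF 5], use b in auto)
    qed simp
  qed
  also have "\<dots> = ennreal ?C * ennreal (Gamma (\<gamma> / 2))"
    using nn_integral_Gamma[of "\<gamma> / 2" 1] g by (subst nn_integral_cmult) auto
  also have "b powr (- \<gamma> / 2) = norm x powr (- \<gamma>) * 4 powr (\<gamma> / 2)"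
  proof -
    have "((norm x)\<^sup>2) powr (- \<gamma> / 2) = norm x powr (- \<gamma>)"
      using x by (subst powr_realpow[symmetric, of "norm x" 2]) (auto simp: powr_powr simp del: powr_numeral powr_realpow)
    then show ?thesis using x by (simp add: b_def powr_divide powr_minus_divide)
  qed
  also have "ennreal ((4 * pi) powr (- D / 2) * (norm x powr (- \<gamma>) * 4 powr (\<gamma> / 2))) * ennreal (Gamma (\<gamma> / 2)) = ennreal (riesz_const TYPE('a) \<gamma>) * npow \<gamma> x"
    using Gamma_real_pos[of "\<gamma> / 2"] g
    by (simp add: riesz_const_def npow_def ennreal_mult[symmetric] D_def mult_ac)
  finally show ?thesis by (simp add: D_def)
qed

text \<open>
  The heat semigroup \<open>exp (u \<Delta>)\<close> applied to \<open>npow \<gamma>\<close>, up to the factor \<open>riesz_const\<close>, as a mixture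
  of Gaussian kernels.
\<close>

definition gmix :: "real \<Rightarrow> real \<Rightarrow> 'a::euclidean_space \<Rightarrow> ennreal" where
  "gmix \<gamma> u x = (\<integral>\<^sup>+r\<in>{0<..}. ennreal (r powr ((real DIM('a) - \<gamma>) / 2 - 1)) * gauss (u + r) x \<partial>lborel)"

lemma borel_measurable_gmix[measurable (raw)]:
  fixes g :: "'b \<Rightarrow> 'a::euclidean_space"
  assumes [measurable]: "f \<in> borel_measurable M" "g \<in> borel_measurable M"
  shows "(\<lambda>x. gmix \<gamma> (f x) (g x)) \<in> borel_measurable M"
  unfolding gmix_def by measurable

lemma gmix_0:
  fixes x :: "'a::euclidean_space"
  shows "0 < \<gamma> \<Longrightarrow> x \<noteq> 0 \<Longrightarrow> gmix \<gamma> 0 x = ennreal (riesz_const TYPE('a) \<gamma>) * npow \<gamma> x"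
  unfolding gmix_def by (simp add: npow_eq_Gaussian_mixture)

lemma gmix_scale:
  fixes x e :: "'a::euclidean_space"
  assumes u: "u > 0" and x: "x \<noteq> 0" and e: "norm e = 1"
  shows "gmix \<gamma> u x = npow \<gamma> x * gmix \<gamma> (u / (norm x)\<^sup>2) e"
proof -
  define a where "a = (real DIM('a) - \<gamma>) / 2 - 1"
  define \<rho> where "\<rho> = norm x"
  have \<rho>: "\<rho> > 0" using x by (simp add: \<rho>_def)
  have "gmix \<gamma> u x = ennreal \<bar>\<rho>\<^sup>2\<bar> * (\<integral>\<^sup>+r. ennreal ((0 + \<rho>\<^sup>2 * r) powr a) * gauss (u + (0 + \<rho>\<^sup>2 * r)) x * indicator {0<..} (0 + \<rho>\<^sup>2 * r) \<partial>lborel)"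
    unfolding gmix_def a_def using \<rho> by (intro nn_integral_real_affine) auto
  also have "\<dots> = (\<integral>\<^sup>+r. ennreal \<bar>\<rho>\<^sup>2\<bar> * (ennreal ((0 + \<rho>\<^sup>2 * r) powr a) * gauss (u + (0 + \<rho>\<^sup>2 * r)) x * indicator {0<..} (0 + \<rho>\<^sup>2 * r)) \<partial>lborel)"
    by (rule nn_integral_cmult[symmetric]) simp
  also have "\<dots> = (\<integral>\<^sup>+r. npow \<gamma> x * (ennreal (r powr a) * gauss (u / \<rho>\<^sup>2 + r) e * indicator {0<..} r) \<partial>lborel)"
  proof (rule nn_integral_cong, goal_cases)
    case (1 r)
    show ?case
    proof (cases "r > 0")
      case r: True
      have 1: "gauss_kernel (u + \<rho>\<^sup>2 * r) x = \<rho> powr (- real DIM('a)) * gauss_kernel (u / \<rho>\<^sup>2 + r) e"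
        using gauss_kernel_scale[of "u / \<rho>\<^sup>2 + r" x e] add_pos_pos[of "u / \<rho>\<^sup>2" r] u r \<rho> x e
        by (simp add: \<rho>_def[symmetric] distrib_left)
      have 2: "(\<rho>\<^sup>2 * r) powr a = \<rho> powr (2 * a) * r powr a"
        using \<rho> r by (subst powr_mult) (auto simp: powr_realpow[symmetric] powr_powr simp del: powr_numeral powr_realpow)
      have "\<rho>\<^sup>2 * \<rho> powr (2 * a) * \<rho> powr (- real DIM('a)) = \<rho> powr (2 + 2 * a + (- real DIM('a)))"
        using \<rho> by (simp only: powr_add powr_numeral)
      also have "2 + 2 * a + (- real DIM('a)) = - \<gamma>" by (simp add: a_def field_simps)
      finally have 3: "\<rho>\<^sup>2 * \<rho> powr (2 * a) * \<rho> powr (- real DIM('a)) = \<rho> powr (- \<gamma>)" .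
      have "\<rho>\<^sup>2 * ((\<rho> powr (2 * a) * r powr a) * (\<rho> powr (- real DIM('a)) * gauss_kernel (u / \<rho>\<^sup>2 + r) e))
        = (\<rho>\<^sup>2 * \<rho> powr (2 * a) * \<rho> powr (- real DIM('a))) * (r powr a * gauss_kernel (u / \<rho>\<^sup>2 + r) e)"
        by (simp only: mult_ac)
      then show ?thesis
        using r \<rho> by (simp add: 1 2 3 ennreal_mult[symmetric] npow_def \<rho>_def[symmetric])
    qed (use \<rho> in \<open>auto simp: zero_less_mult_iff\<close>)
  qed
  also have "\<dots> = npow \<gamma> x * gmix \<gamma> (u / \<rho>\<^sup>2) e"
    unfolding gmix_def a_def by (rule nn_integral_cmult) simp
  finally show ?thesis by (simp add: \<rho>_def)
qed

lemma gmix_liminf: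
  assumes "U \<longlonglongrightarrow> 0"
  shows "gmix \<gamma> 0 e \<le> liminf (\<lambda>n. gmix \<gamma> (U n) e)"
proof -
  let ?f = "\<lambda>u r. ennreal (r powr ((real DIM('a) - \<gamma>) / 2 - 1)) * gauss (u + r) e * indicator {0<..} r"
  have "gmix \<gamma> 0 e = (\<integral>\<^sup>+r. liminf (\<lambda>n. ?f (U n) r) \<partial>lborel)"
    unfolding gmix_def
  proof (rule nn_integral_cong, goal_cases)
    case (1 r)
    show ?case
    proof (cases "r > 0")
      case True
      have "(\<lambda>n. U n + r) \<longlonglongrightarrow> 0 + r" using assms by (intro tendsto_intros)
      then have "(\<lambda>n. r powr ((real DIM('a) - \<gamma>) / 2 - 1) * gauss_kernel (U n + r) e) \<longlonglongrightarrow> r powr ((real DIM('a) - \<gamma>) / 2 - 1) * gauss_kernel (0 + r) e"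
        unfolding gauss_kernel_def using True assms by (intro tendsto_intros) auto
      from lim_imp_Liminf[OF sequentially_bot tendsto_ennrealI[OF this]] show ?thesis
        using True by (simp add: ennreal_mult)
    qed (simp add: Liminf_const)
  qed
  also have "\<dots> \<le> liminf (\<lambda>n. gmix \<gamma> (U n) e)"
    unfolding gmix_def by (rule nn_integral_liminf) simp
  finally show ?thesis .
qed

section \<open>The stable semigroup\<close>

context stable_subordinator
begin

abbreviation sdens :: "real \<Rightarrow> real \<Rightarrow> ennreal" where
  "sdens t u \<equiv> ennreal (sub_dens t u)"

definition pker :: "real \<Rightarrow> 'a::euclidean_space \<Rightarrow> ennreal" where
  "pker t x = (\<integral>\<^sup>+u. sdens t u * gauss u x \<partial>lborel)"

lemma borel_measurable_pker[measurable (raw)]: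
  fixes g :: "'b \<Rightarrow> 'a::euclidean_space"
  assumes [measurable]: "f \<in> borel_measurable M" "g \<in> borel_measurable M"
  shows "(\<lambda>x. pker (f x) (g x)) \<in> borel_measurable M"
  unfolding pker_def by measurable

lemma pker_uminus[simp]: "pker t (- x) = pker t x"
  by (simp add: pker_def)

lemma pker_minus_commute: "pker t (x - y) = pker t (y - x)"
  by (metis minus_diff_eq pker_uminus)

lemma stable_kernel_eq_pker:
  fixes x y :: "'a::euclidean_space"
  assumes t: "t > 0"
  shows "stable_kernel \<eta> t x y = pker t (y - x)"
proof -
  define F where "F u = gauss u (y - x)" for u
  have [measurable]: "F \<in> borel_measurable borel" by (simp add: F_def[abs_def])
  have [measurable]: "\<eta> t \<in> borel_measurable borel" and 0: "\<And>s. s \<le> 0 \<Longrightarrow> \<eta> t s = 0" "\<And>s. 0 \<le> \<eta> t s"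
    using \<eta> t by (auto simp add: stable_subordinator_density_def)
  have "stable_kernel \<eta> t x y = (\<integral>\<^sup>+u. ennreal (\<eta> t u) * F u \<partial>lborel)"
    unfolding stable_kernel_def stable_density_def F_def
    by (intro nn_integral_cong) (auto simp: ennreal_mult 0 mult.commute split: split_indicator)
  also have "\<dots> = (\<integral>\<^sup>+u. F u \<partial>density lborel (\<lambda>s. ennreal (\<eta> t s)))"
    by (simp add: nn_integral_density)
  also have "\<dots> = (\<integral>\<^sup>+u. F u \<partial>density lborel (\<lambda>s. sdens t s))"
    by (simp add: density_\<eta>_eq_sub[OF t])
  also have "\<dots> = pker t (y - x)"
    by (simp add: nn_integral_density pker_def F_def)
  finally show ?thesis .
qed

lemma pker_total:
  assumes "t > 0"
  shows "(\<integral>\<^sup>+x. pker t (x :: 'a::euclidean_space) \<partial>lborel) = 1"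
proof -
  have "(\<integral>\<^sup>+x. pker t (x :: 'a) \<partial>lborel) = (\<integral>\<^sup>+u. (\<integral>\<^sup>+x. sdens t u * gauss u (x::'a) \<partial>lborel) \<partial>lborel)"
    unfolding pker_def by (rule lborel_pair.Fubini') simp
  also have "\<dots> = (\<integral>\<^sup>+u. sdens t u \<partial>lborel)"
  proof (rule nn_integral_cong, goal_cases)
    case (1 u)
    show ?case
      by (cases "u > 0") (simp_all add: sub_eq_0 nn_integral_cmult nn_integral_gauss_kernel)
  qed
  finally show ?thesis using sub_total[OF assms] by simp
qed

text \<open>
  The Chapman-Kolmogorov equation, from the convolution identities for the Gaussian kernels and
  for the subordinator.
\<close>

lemma pker_convolution:
  fixes v :: "'a::euclidean_space"
  assumes t: "t > 0" "s > 0"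
  shows "(\<integral>\<^sup>+w. pker t (v - w) * pker s w \<partial>lborel) = pker (t + s) v"
proof -
  let ?F = "\<lambda>u r w. sdens t u * gauss u (v - w) * (sdens s r * gauss r w)"
  have "(\<integral>\<^sup>+w. pker t (v - w) * pker s w \<partial>lborel)
    = (\<integral>\<^sup>+w. (\<integral>\<^sup>+u. (\<integral>\<^sup>+r. ?F u r w \<partial>lborel) \<partial>lborel) \<partial>lborel)"
    unfolding pker_def by (simp add: nn_integral_cmult nn_integral_multc)
  also have "\<dots> = (\<integral>\<^sup>+u. (\<integral>\<^sup>+w. (\<integral>\<^sup>+r. ?F u r w \<partial>lborel) \<partial>lborel) \<partial>lborel)"
    by (rule lborel_pair.Fubini') simp
  also have "\<dots> = (\<integral>\<^sup>+u. (\<integral>\<^sup>+r. (\<integral>\<^sup>+w. ?F u r w \<partial>lborel) \<partial>lborel) \<partial>lborel)"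
    by (intro nn_integral_cong lborel_pair.Fubini') simp
  also have "\<dots> = (\<integral>\<^sup>+u. sdens t u * (\<integral>\<^sup>+r. sdens s r * gauss (u + r) v \<partial>lborel) \<partial>lborel)"
  proof (rule nn_integral_cong)
    fix u :: real
    have "(\<integral>\<^sup>+w. ?F u r w \<partial>lborel)
       = sdens t u * (sdens s r * gauss (u + r) v)" for r
    proof (cases "u > 0 \<and> r > 0")
      case True
      have "(\<integral>\<^sup>+w. ?F u r w \<partial>lborel)
        = (\<integral>\<^sup>+w. sdens t u * sdens s r * (gauss u (v - w) * gauss r w) \<partial>lborel)"
        by (simp add: mult_ac)
      also have "\<dots> = sdens t u * sdens s r * gauss (u + r) v"
        using True by (subst nn_integral_cmult) (auto simp: gauss_kernel_convolution)
      finally show ?thesis by (simp add: mult.assoc)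
    qed (auto simp: sub_eq_0 not_less)
    then show "(\<integral>\<^sup>+r. (\<integral>\<^sup>+w. ?F u r w \<partial>lborel) \<partial>lborel)
      = sdens t u * (\<integral>\<^sup>+r. sdens s r * gauss (u + r) v \<partial>lborel)"
      by (simp add: nn_integral_cmult)
  qed
  also have "\<dots> = pker (t + s) v"
    unfolding pker_def using t by (intro sub_convolution) auto
  finally show ?thesis .
qed

definition P :: "real \<Rightarrow> ('a::euclidean_space \<Rightarrow> ennreal) \<Rightarrow> 'a \<Rightarrow> ennreal" where
  "P t f x = (\<integral>\<^sup>+y. pker t (y - x) * f y \<partial>lborel)"

lemma borel_measurable_P[measurable (raw)]:
  fixes g :: "'b \<Rightarrow> 'a::euclidean_space"
  assumes [measurable]: "h \<in> borel_measurable M" "g \<in> borel_measurable M"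
    "(\<lambda>z. f (fst z) (snd z)) \<in> borel_measurable (M \<Otimes>\<^sub>M borel)"
  shows "(\<lambda>x. P (h x) (f x) (g x)) \<in> borel_measurable M"
proof -
  have [measurable]: "(\<lambda>z. f (fst z) (snd z)) \<in> borel_measurable (M \<Otimes>\<^sub>M lborel)"
    using assms(3) by simp
  have "(\<lambda>x. \<integral>\<^sup>+y. pker (h x) (y - g x) * f x y \<partial>lborel) \<in> borel_measurable M"
    by (rule lborel.borel_measurable_nn_integral) (simp add: split_beta')
  then show ?thesis by (simp add: P_def)
qed

lemma P_mono: "(AE y in lborel. f y \<le> g y) \<Longrightarrow> P t f x \<le> P t g x"
  unfolding P_def by (intro nn_integral_mono_AE) (auto elim!: eventually_mono intro: mult_left_mono)

lemma P_cong: "(AE y in lborel. f y = g y) \<Longrightarrow> P t f x = P t g x"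
  unfolding P_def by (intro nn_integral_cong_AE) (auto elim!: eventually_mono)

lemma P_add:
  assumes [measurable]: "f \<in> borel_measurable borel" "g \<in> borel_measurable borel"
  shows "P t (\<lambda>y. f y + g y) x = P t f x + P t g x"
  unfolding P_def by (subst nn_integral_add[symmetric]) (auto simp: distrib_left)

lemma P_cmult:
  assumes [measurable]: "f \<in> borel_measurable borel"
  shows "P t (\<lambda>y. c * f y) x = c * P t f x"
  unfolding P_def by (subst nn_integral_cmult[symmetric]) (auto simp: mult_ac)

lemma P_const:
  assumes "t > 0"
  shows "P t (\<lambda>_. c) (x :: 'a::euclidean_space) = c"
proof -
  have "P t (\<lambda>_. c) x = (\<integral>\<^sup>+y. pker t (y - x) \<partial>lborel) * c"
    unfolding P_def by (rule nn_integral_multc) simp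
  also have "(\<integral>\<^sup>+y. pker t (y - x) \<partial>lborel) = (\<integral>\<^sup>+y. pker t (y::'a) \<partial>lborel)"
    using nn_integral_lborel_affine[where c=1 and t="- x" and f="pker t", symmetric] by simp
  finally show ?thesis using pker_total[OF assms, where 'a='a] by simp
qed

lemma P_P:
  fixes x :: "'a::euclidean_space"
  assumes t: "t > 0" "s > 0" and [measurable]: "f \<in> borel_measurable borel"
  shows "P t (P s f) x = P (t + s) f x"
proof -
  let ?F = "\<lambda>y z. pker t (y - x) * (pker s (z - y) * f z)"
  have "P t (P s f) x = (\<integral>\<^sup>+y. (\<integral>\<^sup>+z. ?F y z \<partial>lborel) \<partial>lborel)"
    unfolding P_def by (simp add: nn_integral_cmult)
  also have "\<dots> = (\<integral>\<^sup>+z. (\<integral>\<^sup>+y. ?F y z \<partial>lborel) \<partial>lborel)"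
    by (rule lborel_pair.Fubini') simp
  also have "\<dots> = (\<integral>\<^sup>+z. pker (t + s) (z - x) * f z \<partial>lborel)"
  proof (rule nn_integral_cong)
    fix z
    have "(\<integral>\<^sup>+y. ?F y z \<partial>lborel) = (\<integral>\<^sup>+y. pker t (y - x) * pker s (z - y) \<partial>lborel) * f z"
      by (subst nn_integral_multc[symmetric]) (auto simp: mult_ac)
    also have "(\<integral>\<^sup>+y. pker t (y - x) * pker s (z - y) \<partial>lborel) = (\<integral>\<^sup>+w. pker t ((z - x) - w) * pker s w \<partial>lborel)"
      by (subst nn_integral_lborel_affine[where c="-1" and t="z"]) (auto simp: algebra_simps)
    also have "\<dots> = pker (t + s) (z - x)"
      using t by (rule pker_convolution)
    finally show "(\<integral>\<^sup>+y. ?F y z \<partial>lborel) = pker (t + s) (z - x) * f z" .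
  qed
  finally show ?thesis by (simp add: P_def)
qed

lemma P_symmetric:
  fixes f g :: "'a::euclidean_space \<Rightarrow> ennreal"
  assumes [measurable]: "f \<in> borel_measurable borel" "g \<in> borel_measurable borel"
  shows "(\<integral>\<^sup>+x. g x * P t f x \<partial>lborel) = (\<integral>\<^sup>+x. P t g x * f x \<partial>lborel)"
proof -
  have "(\<integral>\<^sup>+x. g x * P t f x \<partial>lborel) = (\<integral>\<^sup>+x. (\<integral>\<^sup>+y. g x * (pker t (y - x) * f y) \<partial>lborel) \<partial>lborel)"
    unfolding P_def by (simp add: nn_integral_cmult)
  also have "\<dots> = (\<integral>\<^sup>+y. (\<integral>\<^sup>+x. g x * (pker t (y - x) * f y) \<partial>lborel) \<partial>lborel)"
    by (rule lborel_pair.Fubini') simp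
  also have "\<dots> = (\<integral>\<^sup>+y. P t g y * f y \<partial>lborel)"
    unfolding P_def
    by (subst nn_integral_multc[symmetric]) (auto intro!: nn_integral_cong simp: mult_ac pker_minus_commute[of t _ "_ :: 'a"])
  finally show ?thesis .
qed

end

section \<open>The semigroup on powers\<close>

context stable_subordinator
begin

text \<open>
  Subordination: the stable semigroup is the heat semigroup run for the random time \<open>u\<close>.
\<close>

lemma P_npow_eq_mixture:
  fixes x :: "'a::euclidean_space"
  assumes g: "\<gamma> > 0"
  shows "ennreal (riesz_const TYPE('a) \<gamma>) * P t (npow \<gamma>) x = (\<integral>\<^sup>+u. sdens t u * gmix \<gamma> u x \<partial>lborel)"
proof -
  define w where "w r = ennreal (r powr ((real DIM('a) - \<gamma>) / 2 - 1)) * indicator {0<..} r" for r :: real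
  have [measurable]: "w \<in> borel_measurable borel" unfolding w_def by measurable
  have gm: "gmix \<gamma> u y = (\<integral>\<^sup>+r. w r * gauss (u + r) y \<partial>lborel)" for u and y :: 'a
    unfolding gmix_def w_def by (simp add: mult_ac)
  let ?p = "\<lambda>r y. pker t (x - y) * gauss r y" and ?q = "\<lambda>r u. sdens t u * gauss (u + r) x"
    and ?g = "\<lambda>r y u. sdens t u * (gauss u (x - y) * gauss r y)"
  have "ennreal (riesz_const TYPE('a) \<gamma>) * P t (npow \<gamma>) x = P t (\<lambda>y. ennreal (riesz_const TYPE('a) \<gamma>) * npow \<gamma> y) x"
    by (rule P_cmult[symmetric]) simp
  also have "\<dots> = P t (gmix \<gamma> 0) x"
    by (rule P_cong, use AE_lborel_singleton[of "0::'a"] in eventually_elim) (simp add: gmix_0[OF g])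
  also have "\<dots> = (\<integral>\<^sup>+y. (\<integral>\<^sup>+r. w r * (?p r y) \<partial>lborel) \<partial>lborel)"
    unfolding P_def gm by (simp add: nn_integral_cmult[symmetric] pker_minus_commute[of t x] mult.left_commute)
  also have "\<dots> = (\<integral>\<^sup>+r. (\<integral>\<^sup>+y. w r * (?p r y) \<partial>lborel) \<partial>lborel)"
    by (rule lborel_pair.Fubini') simp
  also have "\<dots> = (\<integral>\<^sup>+r. (\<integral>\<^sup>+u. sdens t u * (w r * gauss (u + r) x) \<partial>lborel) \<partial>lborel)"
  proof (rule nn_integral_cong, goal_cases)
    case (1 r)
    show ?case
    proof (cases "r > 0")
      case True
      have "(\<integral>\<^sup>+y. ?p r y \<partial>lborel)
        = (\<integral>\<^sup>+y. (\<integral>\<^sup>+u. ?g r y u \<partial>lborel) \<partial>lborel)"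
        unfolding pker_def by (simp add: nn_integral_multc mult.assoc[symmetric])
      also have "\<dots> = (\<integral>\<^sup>+u. (\<integral>\<^sup>+y. ?g r y u \<partial>lborel) \<partial>lborel)"
        by (rule lborel_pair.Fubini') simp
      also have "\<dots> = (\<integral>\<^sup>+u. ?q r u \<partial>lborel)"
      proof (rule nn_integral_cong, goal_cases)
        case (1 u)
        show ?case
          by (cases "u > 0") (simp_all add: sub_eq_0 nn_integral_cmult gauss_kernel_convolution True)
      qed
      finally have "(\<integral>\<^sup>+y. ?p r y \<partial>lborel) = \<dots>" .
      then have "(\<integral>\<^sup>+y. w r * (?p r y) \<partial>lborel)
        = w r * (\<integral>\<^sup>+u. ?q r u \<partial>lborel)"
        by (subst nn_integral_cmult) auto
      also have "\<dots> = (\<integral>\<^sup>+u. w r * (?q r u) \<partial>lborel)"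
        by (rule nn_integral_cmult[symmetric]) simp
      finally show ?thesis by (simp only: mult.left_commute)
    qed (simp add: w_def)
  qed
  also have "\<dots> = (\<integral>\<^sup>+u. (\<integral>\<^sup>+r. sdens t u * (w r * gauss (u + r) x) \<partial>lborel) \<partial>lborel)"
    by (rule lborel_pair.Fubini') simp
  also have "\<dots> = (\<integral>\<^sup>+u. sdens t u * gmix \<gamma> u x \<partial>lborel)"
    unfolding gm by (intro nn_integral_cong nn_integral_cmult) simp
  finally show ?thesis .
qed

text \<open>
  The Gamma factors of \<open>kappa\<close> are exactly those left over when Gaussian mixtures of the orders
  \<open>\<beta>\<close> and \<open>\<beta> + 2 * \<sigma>\<close> are compared.
\<close>

lemma riesz_kappa:
  fixes \<beta> :: real
  defines "d \<equiv> real DIM('a::euclidean_space)"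
  assumes "0 < \<beta>" "\<beta> + 2 * \<sigma> < d"
  shows "Beta \<sigma> ((d - \<beta> - 2 * \<sigma>) / 2) / Gamma \<sigma> * riesz_const TYPE('a) \<beta> * kappa DIM('a) (2 * \<sigma>) \<beta> = riesz_const TYPE('a) (\<beta> + 2 * \<sigma>)"
    and "kappa DIM('a) (2 * \<sigma>) \<beta> > 0"
proof -
  let ?a = "(d - \<beta> - 2 * \<sigma>) / 2"
  have g: "Gamma \<sigma> > 0" "Gamma (\<beta> / 2) > 0" "Gamma ?a > 0" "Gamma ((\<beta> + 2 * \<sigma>) / 2) > 0" "Gamma ((d - \<beta>) / 2) > 0"
    using assms \<sigma> by (auto intro!: Gamma_real_pos)
  have b: "Beta \<sigma> ?a = Gamma \<sigma> * Gamma ?a / Gamma ((d - \<beta>) / 2)"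
  proof -
    have "\<sigma> + (d - \<beta> - 2 * \<sigma>) / 2 = (d - \<beta>) / 2" by (simp add: field_simps)
    then show ?thesis by (simp only: Beta_def)
  qed
  have k: "kappa DIM('a) (2 * \<sigma>) \<beta> = 2 powr (2 * \<sigma>) * Gamma ((\<beta> + 2 * \<sigma>) / 2) * Gamma ((d - \<beta>) / 2) / Gamma (\<beta> / 2) / Gamma ?a"
    unfolding kappa_def d_def rGamma_inverse_Gamma by (simp only: divide_inverse mult_ac)
  show "kappa DIM('a) (2 * \<sigma>) \<beta> > 0" unfolding k using g by simp
  have p: "(4::real) powr ((\<beta> + 2 * \<sigma>) / 2) = 4 powr (\<beta> / 2) * 2 powr (2 * \<sigma>)"
  proof -
    have 1: "(4::real) powr \<sigma> = 2 powr (2 * \<sigma>)" using powr_powr[of 2 2 \<sigma>] by simp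
    have 2: "(\<beta> + 2 * \<sigma>) / 2 = \<beta> / 2 + \<sigma>" by simp
    show ?thesis unfolding 1[symmetric] 2 by (rule powr_add)
  qed
  show "Beta \<sigma> ?a / Gamma \<sigma> * riesz_const TYPE('a) \<beta> * kappa DIM('a) (2 * \<sigma>) \<beta> = riesz_const TYPE('a) (\<beta> + 2 * \<sigma>)"
  proof -
    have alg: "(A * B / C) / A * (E * e * f) * (h * D * C / E / B) = D * (e * h) * f"
      if "A > 0" "B > 0" "C > 0" "E > 0" for A B C D E e f h :: real
      using that by (simp add: field_simps)
    show ?thesis unfolding b k riesz_const_def p using g by (intro alg)
  qed
qed

text \<open>
  The weights \<open>u powr (\<sigma> - 1)\<close> of the delay and \<open>r powr (a - 1)\<close> of the mixture are combined by a
  convolution, which is a Beta integral and again a power.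
\<close>

lemma gmix_potential:
  fixes x :: "'a::euclidean_space"
  assumes a: "a > 0"
  shows "(\<integral>\<^sup>+u\<in>{0<..}. ennreal (u powr (\<sigma> - 1)) * gmix (real DIM('a) - 2 * a) u x \<partial>lborel)
    = ennreal (Beta \<sigma> a) * gmix (real DIM('a) - 2 * (\<sigma> + a)) 0 x"
proof -
  define f where "f u v = ennreal (u powr (\<sigma> - 1)) * indicator {0<..} u * (ennreal ((v - u) powr (a - 1)) * indicator {0<..} (v - u)) * gauss v x" for u v
  have [measurable]: "(\<lambda>z. f (snd z) (fst z)) \<in> borel_measurable (borel \<Otimes>\<^sub>M borel)"
    unfolding f_def by measurable
  have "(\<integral>\<^sup>+u\<in>{0<..}. ennreal (u powr (\<sigma> - 1)) * gmix (real DIM('a) - 2 * a) u x \<partial>lborel) = (\<integral>\<^sup>+u. (\<integral>\<^sup>+v. f u v \<partial>lborel) \<partial>lborel)"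
  proof (rule nn_integral_cong, goal_cases)
    case (1 u)
    have "gmix (real DIM('a) - 2 * a) u x = (\<integral>\<^sup>+v. ennreal ((v - u) powr (a - 1)) * gauss v x * indicator {0<..} (v - u) \<partial>lborel)"
      unfolding gmix_def by (subst nn_integral_real_affine[where c=1 and t="-u"]) auto
    then have "ennreal (u powr (\<sigma> - 1)) * gmix (real DIM('a) - 2 * a) u x * indicator {0<..} u
      = (\<integral>\<^sup>+v. ennreal (u powr (\<sigma> - 1)) * indicator {0<..} u * (ennreal ((v - u) powr (a - 1)) * gauss v x * indicator {0<..} (v - u)) \<partial>lborel)"
      by (subst nn_integral_cmult) (auto simp: mult_ac)
    then show ?case by (simp only: f_def mult_ac)
  qed
  also have "\<dots> = (\<integral>\<^sup>+v. (\<integral>\<^sup>+u. f u v \<partial>lborel) \<partial>lborel)"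
    by (rule lborel_pair.Fubini') (simp add: split_beta')
  also have "\<dots> = (\<integral>\<^sup>+v. ennreal (Beta \<sigma> a) * (ennreal (v powr (\<sigma> + a - 1)) * gauss (0 + v) x * indicator {0<..} v) \<partial>lborel)"
  proof (rule nn_integral_cong, goal_cases)
    case (1 v)
    show ?case
    proof (cases "v > 0")
      case True
      have "(\<integral>\<^sup>+u. f u v \<partial>lborel) = (\<integral>\<^sup>+u. ennreal (u powr (\<sigma> - 1) * (v - u) powr (a - 1)) * indicator {0<..<v} u * gauss v x \<partial>lborel)"
        unfolding f_def by (intro nn_integral_cong) (auto split: split_indicator simp: ennreal_mult)
      also have "\<dots> = ennreal (Beta \<sigma> a * v powr (\<sigma> + a - 1)) * gauss v x"
        using nn_integral_Beta[OF \<sigma>(1) a True] by (subst nn_integral_multc) auto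
      finally show ?thesis using True by (simp add: ennreal_mult'' mult.assoc)
    next
      case False
      then have "f u v = 0" for u by (auto simp: f_def split: split_indicator)
      then show ?thesis using False by simp
    qed
  qed
  also have "\<dots> = ennreal (Beta \<sigma> a) * gmix (real DIM('a) - 2 * (\<sigma> + a)) 0 x"
  proof -
    have "(real DIM('a) - (real DIM('a) - 2 * (\<sigma> + a))) / 2 - 1 = \<sigma> + a - 1" by simp
    then show ?thesis unfolding gmix_def by (subst nn_integral_cmult) (simp_all only:, simp)
  qed
  finally show ?thesis .
qed

text \<open>
  Integrating over all times replaces the law of the subordinator by its potential density, a power,
  to which \<open>gmix_potential\<close> applies.
\<close>

lemma potential_npow:
  fixes x :: "'a::euclidean_space"
  assumes b: "0 < \<beta>" "\<beta> + 2 * \<sigma> < real DIM('a)" and x: "x \<noteq> 0"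
  shows "ennreal (kappa DIM('a) (2 * \<sigma>) \<beta>) * (\<integral>\<^sup>+s\<in>{0<..}. P s (npow (\<beta> + 2 * \<sigma>)) x \<partial>lborel) = npow \<beta> x"
proof -
  define \<gamma> where "\<gamma> = \<beta> + 2 * \<sigma>"
  define a where "a = (real DIM('a) - \<beta> - 2 * \<sigma>) / 2"
  define k where "k = kappa DIM('a) (2 * \<sigma>) \<beta>"
  define R where "R = riesz_const TYPE('a)"
  have a: "a > 0" and g: "\<gamma> > 0" using b \<sigma> by (auto simp: a_def \<gamma>_def)
  have \<gamma>a: "\<gamma> = real DIM('a) - 2 * a" "\<beta> = real DIM('a) - 2 * (\<sigma> + a)" by (auto simp: a_def \<gamma>_def field_simps)
  have k: "k > 0" using riesz_kappa(2)[OF b] by (simp add: k_def)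
  have R: "R \<gamma> > 0" "R \<beta> > 0" using riesz_const_pos g b by (auto simp: R_def)
  have G: "Gamma \<sigma> > 0" using \<sigma> by (simp add: Gamma_real_pos)
  have Bn: "Beta \<sigma> a \<ge> 0" using \<sigma> a by (simp add: Beta_def Gamma_real_pos less_imp_le)
  let ?I = "\<integral>\<^sup>+s\<in>{0<..}. P s (npow \<gamma>) x \<partial>lborel"
  let ?c = "Beta \<sigma> a / Gamma \<sigma> * R \<beta>"
  have "ennreal (R \<gamma>) * ?I = (\<integral>\<^sup>+s. ennreal (R \<gamma>) * (P s (npow \<gamma>) x * indicator {0<..} s) \<partial>lborel)"
    by (rule nn_integral_cmult[symmetric]) simp
  also have "\<dots> = (\<integral>\<^sup>+s. (\<integral>\<^sup>+u. (sdens s u * indicator {0<..} s) * gmix \<gamma> u x \<partial>lborel) \<partial>lborel)"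
  proof (rule nn_integral_cong, goal_cases)
    case (1 s)
    show ?case
      using P_npow_eq_mixture[OF g, of s x] by (auto simp: R_def split: split_indicator)
  qed
  also have "\<dots> = (\<integral>\<^sup>+u. (\<integral>\<^sup>+s. (sdens s u * indicator {0<..} s) * gmix \<gamma> u x \<partial>lborel) \<partial>lborel)"
    by (rule lborel_pair.Fubini') simp
  also have "\<dots> = (\<integral>\<^sup>+u. ennreal (1 / Gamma \<sigma>) * (ennreal (u powr (\<sigma> - 1)) * gmix \<gamma> u x * indicator {0<..} u) \<partial>lborel)"
  proof (rule nn_integral_cong, goal_cases)
    case (1 u)
    have "(\<integral>\<^sup>+s. (sdens s u * indicator {0<..} s) \<partial>lborel) = ennreal (1 / Gamma \<sigma>) * ennreal (u powr (\<sigma> - 1)) * indicator {0<..} u"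
      using G by (cases "u > 0") (auto simp: sub_potential_density sub_eq_0 ennreal_mult[symmetric])
    then show ?case by (subst nn_integral_multc) (auto simp: mult_ac)
  qed
  also have "\<dots> = ennreal (1 / Gamma \<sigma>) * (ennreal (Beta \<sigma> a) * (ennreal (R \<beta>) * npow \<beta> x))"
    unfolding R_def gmix_0[OF b(1) x, symmetric]
    unfolding \<gamma>a gmix_potential[OF a, of x, symmetric] by (rule nn_integral_cmult) simp
  also have "\<dots> = ennreal ?c * npow \<beta> x"
  proof -
    have "ennreal ?c = ennreal (1 / Gamma \<sigma>) * (ennreal (Beta \<sigma> a) * ennreal (R \<beta>))"
      using G R Bn by (simp add: ennreal_mult[symmetric])
    then show ?thesis by (simp only: mult.assoc)
  qed
  finally have main: "ennreal (R \<gamma>) * ?I = ennreal ?c * npow \<beta> x" .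
  have "ennreal (R \<gamma>) * (ennreal k * ?I) = ennreal (?c * k) * npow \<beta> x"
  proof -
    have "ennreal (?c * k) = ennreal ?c * ennreal k"
      using k G R Bn by (intro ennreal_mult) auto
    then show ?thesis by (subst mult.left_commute, subst main) (simp only: mult_ac)
  qed
  also have "?c * k = R \<gamma>"
    using riesz_kappa(1)[OF b] by (simp add: R_def \<gamma>_def k_def a_def)
  finally show ?thesis
    using R by (simp add: k_def \<gamma>_def ennreal_mult_cancel_left)
qed

text \<open>
  By the semigroup property, applying \<open>P t\<close> to the potential removes the times before \<open>t\<close> from it.
\<close>

lemma npow_eq_P_plus:
  fixes x :: "'a::euclidean_space"
  assumes b: "0 < \<beta>" "\<beta> + 2 * \<sigma> < real DIM('a)" and x: "x \<noteq> 0" and t: "t > 0"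
  shows "npow \<beta> x = P t (npow \<beta>) x + ennreal (kappa DIM('a) (2 * \<sigma>) \<beta>) * (\<integral>\<^sup>+s\<in>{0<..<t}. P s (npow (\<beta> + 2 * \<sigma>)) x \<partial>lborel)"
    and "P t (npow \<beta>) x = ennreal (kappa DIM('a) (2 * \<sigma>) \<beta>) * (\<integral>\<^sup>+s\<in>{t<..}. P s (npow (\<beta> + 2 * \<sigma>)) x \<partial>lborel)"
proof -
  define k where "k = ennreal (kappa DIM('a) (2 * \<sigma>) \<beta>)"
  define F :: "'a \<Rightarrow> ennreal" where "F = npow (\<beta> + 2 * \<sigma>)"
  have [measurable]: "F \<in> borel_measurable borel" by (simp add: F_def)
  let ?J = "\<lambda>A y. \<integral>\<^sup>+s\<in>A. P s F y \<partial>lborel"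
  have "P t (npow \<beta>) x = P t (\<lambda>y. k * ?J {0<..} y) x"
    using AE_lborel_singleton[of "0::'a"] unfolding k_def F_def
    by (intro P_cong) (auto elim!: eventually_mono simp: potential_npow[OF b])
  also have "\<dots> = k * P t (\<lambda>y. ?J {0<..} y) x"
    by (rule P_cmult) simp
  also have "P t (\<lambda>y. ?J {0<..} y) x = (\<integral>\<^sup>+y. (\<integral>\<^sup>+s. pker t (y - x) * (P s F y * indicator {0<..} s) \<partial>lborel) \<partial>lborel)"
    unfolding P_def[of t] by (subst nn_integral_cmult) simp_all
  also have "\<dots> = (\<integral>\<^sup>+s. (\<integral>\<^sup>+y. pker t (y - x) * (P s F y * indicator {0<..} s) \<partial>lborel) \<partial>lborel)"
    by (rule lborel_pair.Fubini') simp
  also have "\<dots> = (\<integral>\<^sup>+s\<in>{0<..}. P (t + s) F x \<partial>lborel)"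
  proof (rule nn_integral_cong, goal_cases)
    case (1 s)
    show ?case
      using P_P[of t s F x] t by (auto split: split_indicator simp: P_def[of t])
  qed
  also have "\<dots> = ?J {t<..} x"
    by (rule nn_integral_Ioi_shift) simp
  finally show 2: "P t (npow \<beta>) x = k * ?J {t<..} x" .
  have "npow \<beta> x = k * ?J {0<..} x"
    using potential_npow[OF b x] by (simp add: k_def F_def)
  also have "?J {0<..} x = (\<integral>\<^sup>+s. P s F x * indicator {t<..} s + P s F x * indicator {0<..<t} s \<partial>lborel)"
    using AE_lborel_singleton[of t] t by (intro nn_integral_cong_AE) (auto elim!: eventually_mono split: split_indicator)
  also have "\<dots> = ?J {t<..} x + ?J {0<..<t} x"
    by (rule nn_integral_add) auto
  finally show "npow \<beta> x = P t (npow \<beta>) x + k * ?J {0<..<t} x"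
    by (simp add: 2 distrib_left)
qed

lemma P_npow_le:
  fixes x :: "'a::euclidean_space"
  assumes "0 < \<beta>" "\<beta> + 2 * \<sigma> < real DIM('a)" "x \<noteq> 0" "t > 0"
  shows "P t (npow \<beta>) x \<le> npow \<beta> x"
  using npow_eq_P_plus(1)[OF assms] by simp

lemma P_npow_antimono:
  fixes x :: "'a::euclidean_space"
  assumes "0 < \<beta>" "\<beta> + 2 * \<sigma> < real DIM('a)" "x \<noteq> 0" "0 < s" "s \<le> t"
  shows "P t (npow \<beta>) x \<le> P s (npow \<beta>) x"
proof -
  have "(\<integral>\<^sup>+r\<in>{t<..}. P r (npow (\<beta> + 2 * \<sigma>)) x \<partial>lborel) \<le> (\<integral>\<^sup>+r\<in>{s<..}. P r (npow (\<beta> + 2 * \<sigma>)) x \<partial>lborel)"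
    using assms by (intro nn_integral_mono) (auto split: split_indicator)
  then show ?thesis
    using assms by (simp add: npow_eq_P_plus(2) mult_left_mono)
qed

text \<open>
  By Gaussian scaling, \<open>P t (npow \<gamma>) x / npow \<gamma> x\<close> is a function of \<open>norm x\<close> in which the subordinator
  enters through \<open>u / (norm x)\<^sup>2\<close> only. Fatou's lemma along a sequence with \<open>norm x \<rightarrow> \<infinity>\<close> shows that
  the ratio cannot stay below \<open>1 - \<epsilon>\<close>.
\<close>

lemma P_npow_eventually_ge:
  assumes g: "0 < \<gamma>" and t: "t > 0" and e: "0 < \<epsilon>" "\<epsilon> < 1"
  shows "\<exists>M>0. \<forall>x::'a::euclidean_space. M \<le> norm x \<longrightarrow> ennreal (1 - \<epsilon>) * npow \<gamma> x \<le> P t (npow \<gamma>) x"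
proof (rule ccontr)
  assume contra: "\<not> ?thesis"
  have "\<forall>n::nat. \<exists>x::'a. real (Suc n) \<le> norm x \<and> P t (npow \<gamma>) x < ennreal (1 - \<epsilon>) * npow \<gamma> x"
  proof
    fix n :: nat
    have "0 < real (Suc n)" by simp
    with contra show "\<exists>x::'a. real (Suc n) \<le> norm x \<and> P t (npow \<gamma>) x < ennreal (1 - \<epsilon>) * npow \<gamma> x"
      unfolding not_le[symmetric] by blast
  qed
  from choice[OF this] obtain X :: "nat \<Rightarrow> 'a" where X: "\<And>n. real (Suc n) \<le> norm (X n)" "\<And>n. P t (npow \<gamma>) (X n) < ennreal (1 - \<epsilon>) * npow \<gamma> (X n)"
    by blast
  have X0: "X n \<noteq> 0" for n using X(1)[of n] by auto
  obtain e :: 'a where en: "norm e = 1" using vector_choose_size[of 1] by auto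
  then have e0: "e \<noteq> 0" by auto
  define R where "R = riesz_const TYPE('a) \<gamma>"
  have R: "R > 0" using riesz_const_pos[OF g] by (simp add: R_def)
  have Re: "ennreal R = gmix \<gamma> 0 e" using gmix_0[OF g e0] en by (simp add: R_def npow_def)
  define \<Phi> where "\<Phi> \<rho> = (\<integral>\<^sup>+u. sdens t u * gmix \<gamma> (u / \<rho>\<^sup>2) e \<partial>lborel)" for \<rho>
  have \<Phi>: "ennreal R * P t (npow \<gamma>) x = npow \<gamma> x * \<Phi> (norm x)" if x: "x \<noteq> 0" for x :: 'a
  proof -
    have "ennreal R * P t (npow \<gamma>) x = (\<integral>\<^sup>+u. npow \<gamma> x * (sdens t u * gmix \<gamma> (u / (norm x)\<^sup>2) e) \<partial>lborel)"
      unfolding R_def P_npow_eq_mixture[OF g]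
    proof (rule nn_integral_cong, goal_cases)
      case (1 u)
      show ?case by (cases "u > 0") (auto simp: sub_eq_0 gmix_scale[OF _ x en] mult.left_commute)
    qed
    then show ?thesis unfolding \<Phi>_def by (simp add: nn_integral_cmult)
  qed
  have small: "\<Phi> (norm (X n)) \<le> ennreal (R * (1 - \<epsilon>))" for n
  proof -
    have "npow \<gamma> (X n) * \<Phi> (norm (X n)) \<le> ennreal R * (ennreal (1 - \<epsilon>) * npow \<gamma> (X n))"
      using X(2)[of n] by (subst \<Phi>[OF X0, symmetric]) (auto intro!: mult_left_mono)
    also have "\<dots> = npow \<gamma> (X n) * ennreal (R * (1 - \<epsilon>))"
      using R \<open>\<epsilon> < 1\<close> by (simp add: ennreal_mult mult_ac)
    finally show ?thesis using X0[of n] by (simp add: ennreal_mult_le_mult_iff npow_def)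
  qed
  have lim: "(\<lambda>n. u / (norm (X n))\<^sup>2) \<longlonglongrightarrow> 0" for u :: real
  proof -
    have "filterlim (\<lambda>n. norm (X n)) at_top sequentially"
    proof (rule filterlim_at_top_mono[OF filterlim_real_sequentially always_eventually], rule allI)
      show "real n \<le> norm (X n)" for n using X(1)[of n] by simp
    qed
    then have "filterlim (\<lambda>n. (norm (X n))\<^sup>2) at_top sequentially"
      by (intro filterlim_pow_at_top) auto
    then show ?thesis
      by (intro tendsto_divide_0[OF tendsto_const]) (rule filterlim_at_top_imp_at_infinity)
  qed
  define \<mu> where "\<mu> = density lborel (\<lambda>u. sdens t u)"
  have \<mu>: "\<Phi> \<rho> = (\<integral>\<^sup>+u. gmix \<gamma> (u / \<rho>\<^sup>2) e \<partial>\<mu>)" for \<rho>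
    unfolding \<Phi>_def \<mu>_def by (subst nn_integral_density) auto
  have "ennreal R = (\<integral>\<^sup>+u. gmix \<gamma> 0 e \<partial>\<mu>)"
    using sub_total[OF t] by (simp add: \<mu>_def emeasure_density Re)
  also have "\<dots> \<le> (\<integral>\<^sup>+u. liminf (\<lambda>n. gmix \<gamma> (u / (norm (X n))\<^sup>2) e) \<partial>\<mu>)"
    by (intro nn_integral_mono gmix_liminf lim)
  also have "\<dots> \<le> liminf (\<lambda>n. \<Phi> (norm (X n)))"
    unfolding \<mu> by (rule nn_integral_liminf) (simp add: \<mu>_def)
  also have "\<dots> \<le> liminf (\<lambda>n. ennreal (R * (1 - \<epsilon>)))"
    by (rule Liminf_mono) (use small in auto)
  also have "\<dots> = ennreal (R * (1 - \<epsilon>))"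
    by (simp add: Liminf_const)
  finally have "R \<le> R * (1 - \<epsilon>)"
    using R \<open>\<epsilon> < 1\<close> by (subst (asm) ennreal_le_iff) auto
  then have "R * \<epsilon> \<le> 0" by (simp add: algebra_simps)
  then show False using mult_pos_pos[OF R \<open>0 < \<epsilon>\<close>] by simp
qed

end

section \<open>The perturbation series\<close>

context stable_subordinator
begin

text \<open>
  The terms of the perturbation series, extended by \<open>0\<close> to nonpositive times. Then the
  time integrals run over the whole line, which is invariant under translation and reflection.
\<close>

primrec pterm :: "('a::euclidean_space \<Rightarrow> ennreal) \<Rightarrow> nat \<Rightarrow> real \<Rightarrow> 'a \<Rightarrow> 'a \<Rightarrow> ennreal" where
  "pterm q 0 = (\<lambda>t x y. indicator {0<..} t * pker t (y - x))"
| "pterm q (Suc n) = (\<lambda>t x y. \<integral>\<^sup>+s. (\<integral>\<^sup>+z. indicator {0<..} s * pker s (z - x) * q z * pterm q n (t - s) z y \<partial>lborel) \<partial>lborel)"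

declare pterm.simps[simp del]

lemma pterm_Suc:
  "pterm q (Suc n) t x y = (\<integral>\<^sup>+s. (\<integral>\<^sup>+z. pterm q 0 s x z * q z * pterm q n (t - s) z y \<partial>lborel) \<partial>lborel)"
  unfolding pterm.simps ..

lemma pterm_nonpos: "t \<le> 0 \<Longrightarrow> pterm q n t x y = 0"
proof (induction n arbitrary: t x y)
  case (Suc n)
  have *: "pterm q 0 s x z * q z * pterm q n (t - s) z y = 0" for s z
    using Suc by (cases "s > 0") (simp_all add: pterm.simps(1))
  show ?case unfolding pterm_Suc * by simp
qed (simp add: pterm.simps(1))

lemma borel_measurable_pterm[measurable (raw)]:
  fixes g h :: "'b \<Rightarrow> 'a::euclidean_space"
  assumes [measurable]: "q \<in> borel_measurable borel"
    and "f \<in> borel_measurable M" "g \<in> borel_measurable M" "h \<in> borel_measurable M"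
  shows "(\<lambda>x. pterm q n (f x) (g x) (h x)) \<in> borel_measurable M"
proof -
  have "(\<lambda>v. pterm q n (fst v) (fst (snd v)) (snd (snd v))) \<in> borel_measurable (borel \<Otimes>\<^sub>M (borel \<Otimes>\<^sub>M borel))"
  proof (induction n)
    case 0
    show ?case unfolding pterm.simps(1) by measurable
  next
    case (Suc n)
    have [measurable]: "(\<lambda>x. pterm q n (f1 x) (f2 x) (f3 x)) \<in> borel_measurable N"
      if [measurable]: "f1 \<in> borel_measurable N" "f2 \<in> borel_measurable N" "f3 \<in> borel_measurable N" for f1 f2 f3 and N :: "'n measure"
    proof -
      have "(\<lambda>x. (f1 x, f2 x, f3 x)) \<in> N \<rightarrow>\<^sub>M (borel \<Otimes>\<^sub>M (borel \<Otimes>\<^sub>M borel))" by measurable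
      from measurable_compose[OF this Suc] show ?thesis by simp
    qed
    show ?case unfolding pterm_Suc pterm.simps(1) by measurable
  qed
  moreover have "(\<lambda>x. (f x, g x, h x)) \<in> M \<rightarrow>\<^sub>M (borel \<Otimes>\<^sub>M (borel \<Otimes>\<^sub>M borel))"
    using assms by measurable
  ultimately have "(\<lambda>x. (\<lambda>v. pterm q n (fst v) (fst (snd v)) (snd (snd v))) (f x, g x, h x)) \<in> borel_measurable M"
    by (rule measurable_compose[rotated])
  then show ?thesis by simp
qed

lemma perturbation_term_eq_pterm:
  "t > 0 \<Longrightarrow> perturbation_term (stable_kernel \<eta>) q n t x y = pterm (\<lambda>x. ennreal (q x)) n t x y"
proof (induction n arbitrary: t x y)
  case 0
  then show ?case by (simp add: stable_kernel_eq_pker pterm.simps(1))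
next
  case (Suc n)
  have "(\<integral>\<^sup>+z. stable_kernel \<eta> s x z * ennreal (q z) * perturbation_term (stable_kernel \<eta>) q n (t - s) z y \<partial>lborel) * indicator {0<..<t} s
    = (\<integral>\<^sup>+z. pterm (\<lambda>x. ennreal (q x)) 0 s x z * ennreal (q z) * pterm (\<lambda>x. ennreal (q x)) n (t - s) z y \<partial>lborel)" for s
  proof (cases "0 < s \<and> s < t")
    case True
    then show ?thesis
      using Suc.IH[of "t - s"] by (simp add: stable_kernel_eq_pker pterm.simps(1))
  next
    case False
    then have "pterm (\<lambda>x. ennreal (q x)) 0 s x z * ennreal (q z) * pterm (\<lambda>x. ennreal (q x)) n (t - s) z y = 0" for z
      by (cases "s \<le> 0") (simp_all add: pterm_nonpos)
    then show ?thesis using False by (simp only:) auto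
  qed
  then show ?case by (simp add: pterm_Suc)
qed

lemma nn_integral_real_shift:
  fixes F :: "real \<Rightarrow> ennreal"
  assumes [measurable]: "F \<in> borel_measurable borel"
  shows "(\<integral>\<^sup>+r. F r \<partial>lborel) = (\<integral>\<^sup>+r. F (r - s) \<partial>lborel)"
proof -
  have "(\<integral>\<^sup>+r. F r \<partial>lborel) = ennreal \<bar>1\<bar> * (\<integral>\<^sup>+r. F (- s + 1 * r) \<partial>lborel)"
    by (rule nn_integral_real_affine) auto
  then show ?thesis by simp
qed

text \<open>
  The recursion from the right, which amounts to associativity of the space-time convolution and
  is what symmetry of the terms is deduced from.
\<close>

lemma pterm_Suc_right:
  assumes [measurable]: "q \<in> borel_measurable borel"
  shows "pterm q (Suc n) t x y = (\<integral>\<^sup>+s. (\<integral>\<^sup>+z. pterm q n s x z * q z * pterm q 0 (t - s) z y \<partial>lborel) \<partial>lborel)"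
proof (induction n arbitrary: t x y)
  case 0
  show ?case by (simp add: pterm_Suc)
next
  case (Suc n)
  define f where "f s z r w = pterm q 0 s x z * q z * pterm q n (r - s) z w * (q w * pterm q 0 (t - r) w y)" for s z r w
  have "pterm q (Suc (Suc n)) t x y = (\<integral>\<^sup>+s. (\<integral>\<^sup>+z. pterm q 0 s x z * q z * (\<integral>\<^sup>+r. (\<integral>\<^sup>+w. pterm q n r z w * q w * pterm q 0 (t - s - r) w y \<partial>lborel) \<partial>lborel) \<partial>lborel) \<partial>lborel)"
    by (subst pterm_Suc) (simp only: Suc.IH)
  also have "\<dots> = (\<integral>\<^sup>+s. (\<integral>\<^sup>+z. pterm q 0 s x z * q z * (\<integral>\<^sup>+r. (\<integral>\<^sup>+w. pterm q n (r - s) z w * q w * pterm q 0 (t - r) w y \<partial>lborel) \<partial>lborel) \<partial>lborel) \<partial>lborel)"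
  proof (rule nn_integral_cong, rule nn_integral_cong, rule arg_cong2[where f="(*)", OF refl], goal_cases)
    case (1 s z)
    show ?case
      by (subst nn_integral_real_shift[where s=s]) simp_all
  qed
  also have "\<dots> = (\<integral>\<^sup>+s. (\<integral>\<^sup>+z. (\<integral>\<^sup>+r. (\<integral>\<^sup>+w. f s z r w \<partial>lborel) \<partial>lborel) \<partial>lborel) \<partial>lborel)"
    by (simp add: f_def nn_integral_cmult mult.assoc)
  also have "\<dots> = (\<integral>\<^sup>+s. (\<integral>\<^sup>+r. (\<integral>\<^sup>+z. (\<integral>\<^sup>+w. f s z r w \<partial>lborel) \<partial>lborel) \<partial>lborel) \<partial>lborel)"
    by (rule nn_integral_cong) (rule lborel_pair.Fubini', simp add: f_def)
  also have "\<dots> = (\<integral>\<^sup>+r. (\<integral>\<^sup>+s. (\<integral>\<^sup>+z. (\<integral>\<^sup>+w. f s z r w \<partial>lborel) \<partial>lborel) \<partial>lborel) \<partial>lborel)"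
    by (rule lborel_pair.Fubini') (simp add: f_def)
  also have "\<dots> = (\<integral>\<^sup>+r. (\<integral>\<^sup>+s. (\<integral>\<^sup>+w. (\<integral>\<^sup>+z. f s z r w \<partial>lborel) \<partial>lborel) \<partial>lborel) \<partial>lborel)"
    by (rule nn_integral_cong, rule nn_integral_cong) (rule lborel_pair.Fubini', simp add: f_def)
  also have "\<dots> = (\<integral>\<^sup>+r. (\<integral>\<^sup>+w. (\<integral>\<^sup>+s. (\<integral>\<^sup>+z. f s z r w \<partial>lborel) \<partial>lborel) \<partial>lborel) \<partial>lborel)"
    by (rule nn_integral_cong) (rule lborel_pair.Fubini', simp add: f_def)
  also have "\<dots> = (\<integral>\<^sup>+r. (\<integral>\<^sup>+w. pterm q (Suc n) r x w * q w * pterm q 0 (t - r) w y \<partial>lborel) \<partial>lborel)"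
  proof (rule nn_integral_cong, rule nn_integral_cong, goal_cases)
    case (1 r w)
    show ?case
      unfolding pterm_Suc f_def by (simp add: nn_integral_multc mult.assoc[of _ "q w"])
  qed
  finally show ?case .
qed

lemma pterm_symmetric:
  assumes [measurable]: "q \<in> borel_measurable borel"
  shows "pterm q n t x y = pterm q n t y x"
proof (induction n arbitrary: t x y)
  case 0
  show ?case by (simp add: pterm.simps(1) pker_minus_commute[of t y x])
next
  case (Suc n)
  have 0: "pterm q 0 t x y = pterm q 0 t y x" for t x y
    by (simp add: pterm.simps(1) pker_minus_commute[of t y x])
  have "pterm q (Suc n) t x y = (\<integral>\<^sup>+s. (\<integral>\<^sup>+z. pterm q n (t - s) y z * q z * pterm q 0 s z x \<partial>lborel) \<partial>lborel)"
    unfolding pterm_Suc by (subst Suc.IH, subst 0) (simp add: mult_ac)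
  also have "\<dots> = (\<integral>\<^sup>+s. (\<integral>\<^sup>+z. pterm q n s y z * q z * pterm q 0 (t - s) z x \<partial>lborel) \<partial>lborel)"
    by (subst nn_integral_real_affine[where c="-1" and t=t]) auto
  also have "\<dots> = pterm q (Suc n) t y x"
    by (rule pterm_Suc_right[symmetric]) simp
  finally show ?case .
qed

lemma nn_integral_pterm_Suc:
  fixes f q :: "'a::euclidean_space \<Rightarrow> ennreal"
  assumes [measurable]: "q \<in> borel_measurable borel" "f \<in> borel_measurable borel"
  shows "(\<integral>\<^sup>+y. pterm q (Suc i) t x y * f y \<partial>lborel)
    = (\<integral>\<^sup>+s. (\<integral>\<^sup>+z. pterm q 0 s x z * q z * (\<integral>\<^sup>+y. pterm q i (t - s) z y * f y \<partial>lborel) \<partial>lborel) \<partial>lborel)"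
proof -
  let ?F = "\<lambda>s z y. pterm q 0 s x z * q z * (pterm q i (t - s) z y * f y)"
  have "(\<integral>\<^sup>+y. pterm q (Suc i) t x y * f y \<partial>lborel)
    = (\<integral>\<^sup>+y. (\<integral>\<^sup>+s. (\<integral>\<^sup>+z. ?F s z y \<partial>lborel) \<partial>lborel) \<partial>lborel)"
    by (simp add: pterm_Suc nn_integral_multc mult.assoc[symmetric])
  also have "\<dots> = (\<integral>\<^sup>+s. (\<integral>\<^sup>+y. (\<integral>\<^sup>+z. ?F s z y \<partial>lborel) \<partial>lborel) \<partial>lborel)"
    by (rule lborel_pair.Fubini') simp
  also have "\<dots> = (\<integral>\<^sup>+s. (\<integral>\<^sup>+z. (\<integral>\<^sup>+y. ?F s z y \<partial>lborel) \<partial>lborel) \<partial>lborel)"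
    by (intro nn_integral_cong lborel_pair.Fubini') simp
  finally show ?thesis by (simp add: nn_integral_cmult)
qed

text \<open>
  One step of the recursion gives \<open>S\<^sub>n\<^sub>+\<^sub>1(t) = P\<^sub>t h + \<integral>\<^sub>0\<^sup>t P\<^sub>s (q S\<^sub>n(t - s)) ds\<close> for the partial sums
  applied to \<open>h = npow \<beta>\<close>. Inserting \<open>S\<^sub>n \<le> h\<close> bounds the right-hand side by the decomposition of \<open>h\<close> in
  \<open>npow_eq_P_plus\<close>.
\<close>

lemma sum_pterm_npow_le:
  fixes q :: "'a::euclidean_space \<Rightarrow> ennreal"
  assumes b: "0 < \<beta>" "\<beta> + 2 * \<sigma> < real DIM('a)"
    and [measurable]: "q \<in> borel_measurable borel"
    and q: "\<And>z. z \<noteq> 0 \<Longrightarrow> q z \<le> ennreal (kappa DIM('a) (2 * \<sigma>) \<beta>) * npow (2 * \<sigma>) z"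
    and x: "x \<noteq> 0"
  shows "(\<Sum>k\<le>n. \<integral>\<^sup>+y. pterm q k t x y * npow \<beta> y \<partial>lborel) \<le> npow \<beta> x"
  using x
proof (induction n arbitrary: t x)
  case 0
  show ?case
  proof (cases "t > 0")
    case True
    then show ?thesis using P_npow_le[OF b 0 True] by (simp add: pterm.simps(1) P_def)
  qed (simp add: pterm_nonpos)
next
  case (Suc n)
  let ?T = "\<lambda>k. \<integral>\<^sup>+y. pterm q k t x y * npow \<beta> y \<partial>lborel"
  define k where "k = ennreal (kappa DIM('a) (2 * \<sigma>) \<beta>)"
  define S where "S n t x = (\<Sum>k\<le>n. \<integral>\<^sup>+y. pterm q k t x y * npow \<beta> y \<partial>lborel)" for n t and x :: 'a
  have [measurable]: "(\<lambda>x. S n (f x) (g x)) \<in> borel_measurable M"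
    if [measurable]: "f \<in> borel_measurable M" "g \<in> borel_measurable M" for n f g and M :: "'n measure"
    unfolding S_def by measurable
  show ?case
  proof (cases "t > 0")
    case True
    have step: "?T (Suc i)
      = (\<integral>\<^sup>+s. (\<integral>\<^sup>+z. pterm q 0 s x z * q z * (\<integral>\<^sup>+y. pterm q i (t - s) z y * npow \<beta> y \<partial>lborel) \<partial>lborel) \<partial>lborel)" for i
      by (rule nn_integral_pterm_Suc) auto
    have "S (Suc n) t x = ?T 0 + (\<Sum>i\<le>n. ?T (Suc i))"
      unfolding S_def by (rule sum.atMost_Suc_shift)
    also have "?T 0 = P t (npow \<beta>) x"
      using True by (simp add: pterm.simps(1) P_def)
    also have "(\<Sum>i\<le>n. ?T (Suc i))
       = (\<integral>\<^sup>+s. (\<integral>\<^sup>+z. pterm q 0 s x z * q z * S n (t - s) z \<partial>lborel) \<partial>lborel)"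
      unfolding step S_def by (simp add: nn_integral_sum sum_distrib_left)
    also have "\<dots> \<le> (\<integral>\<^sup>+s. (\<integral>\<^sup>+z. k * ((pker s (z - x) * npow (\<beta> + 2 * \<sigma>) z) * indicator {0<..<t} s) \<partial>lborel) \<partial>lborel)"
    proof (rule nn_integral_mono, goal_cases)
      case (1 s)
      show ?case
      proof (rule nn_integral_mono_AE, use AE_lborel_singleton[of "0::'a"] in eventually_elim)
        case (elim z)
        show ?case
        proof (cases "0 < s \<and> s < t")
          case True
          have "q z * S n (t - s) z \<le> (k * npow (2 * \<sigma>) z) * npow \<beta> z"
            unfolding S_def k_def by (intro mult_mono q Suc.IH elim) auto
          also have "\<dots> = k * npow (\<beta> + 2 * \<sigma>) z"
            by (simp add: mult.assoc npow_mult add.commute)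
          finally have "pker s (z - x) * (q z * S n (t - s) z) \<le> pker s (z - x) * (k * npow (\<beta> + 2 * \<sigma>) z)"
            by (rule mult_left_mono) simp
          then show ?thesis using True by (simp add: pterm.simps(1) mult_ac)
        next
          case False
          then show ?thesis by (cases "s \<le> 0") (auto simp: pterm_nonpos S_def)
        qed
      qed
    qed
    also have "\<dots> = k * (\<integral>\<^sup>+s\<in>{0<..<t}. P s (npow (\<beta> + 2 * \<sigma>)) x \<partial>lborel)"
      unfolding P_def by (simp add: nn_integral_cmult nn_integral_multc)
    finally have "S (Suc n) t x \<le> P t (npow \<beta>) x + k * (\<integral>\<^sup>+s\<in>{0<..<t}. P s (npow (\<beta> + 2 * \<sigma>)) x \<partial>lborel)"
      by (simp add: add_left_mono)
    also have "\<dots> = npow \<beta> x"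
      unfolding k_def by (rule npow_eq_P_plus(1)[OF b Suc.prems True, symmetric])
    finally show ?thesis by (simp only: S_def)
  qed (simp add: pterm_nonpos)
qed

lemma feynman_kac_kernel_eq:
  fixes x y :: "'a::euclidean_space"
  assumes "t > 0"
  shows "feynman_kac_kernel \<eta> \<alpha> \<delta> t x y = (\<Sum>n. pterm (\<lambda>x. ennreal (hardy_potential \<alpha> \<delta> x)) n t x y)"
  using assms by (simp add: feynman_kac_kernel_def schroedinger_perturbation_def perturbation_term_eq_pterm)

lemma borel_measurable_hardy[measurable]: "hardy_potential \<alpha> \<delta> \<in> borel_measurable borel"
  unfolding hardy_potential_def by measurable

lemma feynman_kac_npow_le:
  fixes x :: "'a::euclidean_space"
  assumes b: "0 < \<beta>" "\<beta> + 2 * \<sigma> < real DIM('a)"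
    and k: "kappa DIM('a) (2 * \<sigma>) \<delta> \<le> kappa DIM('a) (2 * \<sigma>) \<beta>"
    and t: "t > 0" and x: "x \<noteq> 0"
  shows "(\<integral>\<^sup>+y. feynman_kac_kernel \<eta> (2 * \<sigma>) \<delta> t x y * npow \<beta> y \<partial>lborel) \<le> npow \<beta> x"
proof -
  define q :: "'a \<Rightarrow> ennreal" where "q z = ennreal (hardy_potential (2 * \<sigma>) \<delta> z)" for z
  have [measurable]: "q \<in> borel_measurable borel" unfolding q_def by measurable
  let ?T = "\<lambda>n. \<integral>\<^sup>+y. pterm q n t x y * npow \<beta> y \<partial>lborel"
  have q: "q z \<le> ennreal (kappa DIM('a) (2 * \<sigma>) \<beta>) * npow (2 * \<sigma>) z" for z
    using riesz_kappa(2)[OF b] k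
    by (auto simp: q_def hardy_potential_def npow_def ennreal_mult[symmetric] intro!: ennreal_leI mult_right_mono)
  have "(\<integral>\<^sup>+y. feynman_kac_kernel \<eta> (2 * \<sigma>) \<delta> t x y * npow \<beta> y \<partial>lborel) = (\<integral>\<^sup>+y. (\<Sum>n. pterm q n t x y * npow \<beta> y) \<partial>lborel)"
    using t by (simp add: feynman_kac_kernel_eq q_def[abs_def])
  also have "\<dots> = (\<Sum>n. ?T n)"
    by (rule nn_integral_suminf) simp
  also have "\<dots> \<le> npow \<beta> x"
  proof (rule suminf_le_const)
    fix n
    have "(\<Sum>k<n. ?T k) \<le> (\<Sum>k\<le>n. ?T k)"
      by (intro sum_mono2) auto
    also have "\<dots> \<le> npow \<beta> x"
      using q by (intro sum_pterm_npow_le b x) auto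
    finally show "(\<Sum>k<n. ?T k) \<le> npow \<beta> x" .
  qed simp
  finally show ?thesis .
qed

lemma feynman_kac_symmetric:
  fixes x y :: "'a::euclidean_space"
  assumes "t > 0"
  shows "feynman_kac_kernel \<eta> \<alpha> \<delta> t x y = feynman_kac_kernel \<eta> \<alpha> \<delta> t y x"
  using assms by (simp add: feynman_kac_kernel_eq pterm_symmetric[of _ _ t x y])

lemma borel_measurable_feynman_kac:
  fixes g h :: "'b \<Rightarrow> 'a::euclidean_space"
  assumes "t > 0" and [measurable]: "g \<in> borel_measurable M" "h \<in> borel_measurable M"
  shows "(\<lambda>x. feynman_kac_kernel \<eta> \<alpha> \<delta> t (g x) (h x)) \<in> borel_measurable M"
  unfolding feynman_kac_kernel_eq[OF assms(1)] by measurable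

end

section \<open>Contractions on Lp and Schur tests\<close>

text \<open>
  The graph of \<open>\<phi> powr p\<close> lies above its tangent at \<open>c\<close>. This linearisation stands in for the
  inequalities of Jensen and Hoelder.
\<close>

lemma tangent_powr:
  fixes p c \<phi> :: real
  assumes p: "1 < p" and c: "0 \<le> c" and \<phi>: "0 \<le> \<phi>"
  shows "p * c powr (p - 1) * \<phi> \<le> \<phi> powr p + (p - 1) * c powr p"
proof -
  have "\<phi> * c powr (p - 1) \<le> \<phi> powr p / p + (c powr (p - 1)) powr (p / (p - 1)) / (p / (p - 1))"
    using assms by (intro Youngs_inequality) (auto simp: field_simps)
  also have "(c powr (p - 1)) powr (p / (p - 1)) = c powr p"
    using p by (simp add: powr_powr)
  finally have "p * (\<phi> * c powr (p - 1)) \<le> p * (\<phi> powr p / p + c powr p / (p / (p - 1)))"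
    using p by (intro mult_left_mono) auto
  also have "p * (\<phi> powr p / p + c powr p / (p / (p - 1))) = \<phi> powr p + (p - 1) * c powr p"
    using p by (simp add: distrib_left)
  finally show ?thesis by (simp add: mult_ac)
qed

lemma Lp_space_nn_integral:
  fixes f :: "'a::euclidean_space \<Rightarrow> real"
  assumes "f \<in> Lp_space p"
  shows "(\<integral>\<^sup>+x. ennreal (\<bar>f x\<bar> powr p) \<partial>lborel) = ennreal (\<integral>x. \<bar>f x\<bar> powr p \<partial>lebesgue)"
proof -
  have "integrable lebesgue (\<lambda>x. \<bar>f x\<bar> powr p)" using assms by (simp add: Lp_space_def)
  then have "(\<integral>\<^sup>+x. ennreal (\<bar>f x\<bar> powr p) \<partial>lebesgue) = ennreal (\<integral>x. \<bar>f x\<bar> powr p \<partial>lebesgue)"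
    by (intro nn_integral_eq_integral) auto
  then show ?thesis by (simp add: nn_integral_completion)
qed

lemma Lp_spaceI:
  fixes f :: "'a::euclidean_space \<Rightarrow> real"
  assumes "f \<in> borel_measurable lebesgue" "(\<integral>\<^sup>+x. ennreal (\<bar>f x\<bar> powr p) \<partial>lborel) < \<infinity>"
  shows "f \<in> Lp_space p"
proof -
  have "integrable lebesgue (\<lambda>x. \<bar>f x\<bar> powr p)"
    using assms by (intro integrableI_nonneg) (auto simp: nn_integral_completion)
  then show ?thesis using assms by (simp add: Lp_space_def)
qed

text \<open>
  For almost every \<open>x\<close> the measure \<open>K x y * v y / v x dy\<close> has mass at most one, so Jensen's inequality
  for \<open>\<phi> = |f| / v\<close> bounds \<open>|K f (x)| powr p\<close> by \<open>v x powr (p - 1)\<close> times the integral of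
  \<open>K x y * v y * \<phi> y powr p\<close>. The second bound on \<open>K\<close> permits integration over \<open>x\<close>. Jensen's inequality
  is proved by integrating tangents; the tangent at \<open>1\<close> yields convergence, the one at the mean
  yields the estimate.
\<close>

lemma Lp_contraction_of_Schur:
  fixes K :: "'a::euclidean_space \<Rightarrow> 'a \<Rightarrow> ennreal" and v :: "'a \<Rightarrow> real"
  assumes p: "1 < p"
    and K: "\<And>f g. f \<in> borel_measurable (borel \<Otimes>\<^sub>M borel) \<Longrightarrow> g \<in> borel_measurable (borel \<Otimes>\<^sub>M borel) \<Longrightarrow> (\<lambda>x::'a \<times> 'a. K (f x) (g x)) \<in> borel_measurable (borel \<Otimes>\<^sub>M borel)"
    and v[measurable]: "v \<in> borel_measurable borel" and v0: "AE x in lborel. 0 < v x"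
    and A: "AE x in lborel. (\<integral>\<^sup>+y. K x y * ennreal (v y) \<partial>lborel) \<le> ennreal (v x)"
    and B: "AE y in lborel. (\<integral>\<^sup>+x. ennreal (v x powr (p - 1)) * K x y \<partial>lborel) \<le> ennreal (v y powr (p - 1))"
  shows "Lp_contraction p K"
  unfolding Lp_contraction_def
proof (intro ballI)
  fix f :: "'a \<Rightarrow> real" assume f: "f \<in> Lp_space p"
  let ?w = "\<lambda>x. ennreal (v x powr (p - 1))"
  let ?c = "\<lambda>y. \<integral>\<^sup>+x. ?w x * K x y \<partial>lborel"
  have K1[measurable]: "(\<lambda>x::'a \<times> 'a. K (fst x) (snd x)) \<in> borel_measurable (borel \<Otimes>\<^sub>M borel)"
    "(\<lambda>x::'a \<times> 'a. K (snd x) (fst x)) \<in> borel_measurable (borel \<Otimes>\<^sub>M borel)"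
    by (auto intro!: K)
  have [measurable]: "K x \<in> borel_measurable borel" for x
    using measurable_compose[OF _ K1(1), of "\<lambda>y. (x, y)"] by simp
  obtain f0 where [measurable]: "f0 \<in> borel_measurable lborel" and ff0: "AE x in lborel. f x = f0 x"
    using f completion_ex_borel_measurable_real[of f lborel] by (auto simp: Lp_space_def)
  have [measurable]: "f0 \<in> borel_measurable borel" using \<open>f0 \<in> borel_measurable lborel\<close> by simp
  define \<phi> where "\<phi> y = \<bar>f0 y\<bar> / v y" for y
  have [measurable]: "\<phi> \<in> borel_measurable borel" unfolding \<phi>_def by measurable
  define I where "I = (\<integral>x. \<bar>f x\<bar> powr p \<partial>lebesgue)"
  have I: "(\<integral>\<^sup>+x. ennreal (\<bar>f0 x\<bar> powr p) \<partial>lborel) = ennreal I"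
    unfolding I_def Lp_space_nn_integral[OF f, symmetric]
    by (intro nn_integral_cong_AE) (use ff0 in eventually_elim, simp)
  define J where "J x = (\<integral>\<^sup>+y. K x y * ennreal (v y * \<phi> y powr p) \<partial>lborel)" for x
  define N where "N x = (\<integral>\<^sup>+y. K x y * ennreal \<bar>f0 y\<bar> \<partial>lborel)" for x
  have [measurable]: "J \<in> borel_measurable borel" "N \<in> borel_measurable borel"
    unfolding J_def[abs_def] N_def[abs_def] by measurable
  have vphi: "v y powr (p - 1) * (v y * \<phi> y powr p) = \<bar>f0 y\<bar> powr p" if "v y > 0" for y
  proof -
    have "v y powr (p - 1) * (v y * \<phi> y powr p) = v y powr p * \<phi> y powr p"
      using that by (simp add: powr_diff)
    also have "\<dots> = (v y * \<phi> y) powr p" by (simp add: powr_mult)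
    finally show ?thesis using that by (simp add: \<phi>_def)
  qed
  have intJ: "(\<integral>\<^sup>+x. ?w x * J x \<partial>lborel) \<le> ennreal I"
  proof -
    have "(\<integral>\<^sup>+x. ?w x * J x \<partial>lborel)
       = (\<integral>\<^sup>+x. (\<integral>\<^sup>+y. ?w x * (K x y * ennreal (v y * \<phi> y powr p)) \<partial>lborel) \<partial>lborel)"
      unfolding J_def by (simp add: nn_integral_cmult)
    also have "\<dots> = (\<integral>\<^sup>+y. (\<integral>\<^sup>+x. ?w x * (K x y * ennreal (v y * \<phi> y powr p)) \<partial>lborel) \<partial>lborel)"
      by (rule lborel_pair.Fubini') (simp add: split_beta')
    also have "\<dots> = (\<integral>\<^sup>+y. ?c y * ennreal (v y * \<phi> y powr p) \<partial>lborel)"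
    proof (rule nn_integral_cong)
      fix y
      have [measurable]: "(\<lambda>x. K x y) \<in> borel_measurable borel"
        using measurable_compose[OF _ K1(1), of "\<lambda>x. (x, y)"] by simp
      show "(\<integral>\<^sup>+x. ?w x * (K x y * ennreal (v y * \<phi> y powr p)) \<partial>lborel)
        = ?c y * ennreal (v y * \<phi> y powr p)"
        by (subst nn_integral_multc[symmetric]) (auto simp: mult.assoc)
    qed
    also have "\<dots> \<le> (\<integral>\<^sup>+y. ennreal (\<bar>f0 y\<bar> powr p) \<partial>lborel)"
    proof (rule nn_integral_mono_AE, use B v0 in eventually_elim)
      case (elim y)
      have "?c y * ennreal (v y * \<phi> y powr p)
        \<le> ?w y * ennreal (v y * \<phi> y powr p)"
        using elim by (intro mult_right_mono) auto
      also have "\<dots> = ennreal (\<bar>f0 y\<bar> powr p)"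
        using elim vphi[of y] by (subst ennreal_mult[symmetric]) auto
      finally show ?case .
    qed
    finally show ?thesis by (simp add: I)
  qed
  have fin: "AE x in lborel. ?w x * J x \<noteq> \<infinity>"
    using intJ by (intro nn_integral_PInf_AE) (auto simp: top_unique)
  have key: "AE x in lborel. \<exists>n\<ge>0. N x = ennreal n \<and> ennreal (n powr p) \<le> ?w x * J x"
    using fin v0 A
  proof eventually_elim
    case (elim x)
    have "J x \<noteq> \<top>" using elim by (auto simp: ennreal_mult_eq_top_iff)
    then obtain j where j: "J x = ennreal j" "j \<ge> 0" by (cases "J x") auto
    have C: "ennreal (p * c powr (p - 1)) * N x \<le> J x + ennreal ((p - 1) * c powr p) * ennreal (v x)" if c: "c \<ge> 0" for c
    proof -
      have "ennreal (p * c powr (p - 1)) * N x = (\<integral>\<^sup>+y. ennreal (p * c powr (p - 1)) * (K x y * ennreal \<bar>f0 y\<bar>) \<partial>lborel)"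
        unfolding N_def by (rule nn_integral_cmult[symmetric]) simp
      also have "\<dots> \<le> (\<integral>\<^sup>+y. K x y * ennreal (v y * \<phi> y powr p) + ennreal ((p - 1) * c powr p) * (K x y * ennreal (v y)) \<partial>lborel)"
      proof (rule nn_integral_mono_AE, use v0 in eventually_elim)
        case (elim y)
        have "v y * (p * c powr (p - 1) * \<phi> y) \<le> v y * (\<phi> y powr p + (p - 1) * c powr p)"
          using elim p c by (intro mult_left_mono tangent_powr) (auto simp: \<phi>_def)
        then have "p * c powr (p - 1) * \<bar>f0 y\<bar> \<le> v y * \<phi> y powr p + (p - 1) * c powr p * v y"
          using elim by (simp add: \<phi>_def algebra_simps)
        then have "ennreal (p * c powr (p - 1) * \<bar>f0 y\<bar>) \<le> ennreal (v y * \<phi> y powr p + (p - 1) * c powr p * v y)"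
          by (rule ennreal_leI)
        then have "ennreal (p * c powr (p - 1)) * ennreal \<bar>f0 y\<bar> \<le> ennreal (v y * \<phi> y powr p) + ennreal ((p - 1) * c powr p) * ennreal (v y)"
          using elim p c by (simp add: ennreal_mult[symmetric] ennreal_plus[symmetric] del: ennreal_plus)
        then have "K x y * (ennreal (p * c powr (p - 1)) * ennreal \<bar>f0 y\<bar>) \<le> K x y * (ennreal (v y * \<phi> y powr p) + ennreal ((p - 1) * c powr p) * ennreal (v y))"
          by (rule mult_left_mono) simp
        then show ?case by (simp add: distrib_left mult_ac)
      qed
      also have "\<dots> = J x + ennreal ((p - 1) * c powr p) * (\<integral>\<^sup>+y. K x y * ennreal (v y) \<partial>lborel)"
        unfolding J_def by (subst nn_integral_add) (auto simp: nn_integral_cmult)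
      also have "\<dots> \<le> J x + ennreal ((p - 1) * c powr p) * ennreal (v x)"
        using elim by (intro add_left_mono mult_left_mono) auto
      finally show ?thesis .
    qed
    \<comment> \<open>the tangent at \<open>1\<close> shows that \<open>N x\<close> is finite\<close>
    have "ennreal p * N x \<le> ennreal j + ennreal (p - 1) * ennreal (v x)"
      using C[of 1] by (simp add: j)
    also have "\<dots> < \<top>" by (simp add: ennreal_mult_less_top)
    finally have "N x < \<top>" using p by (auto simp: ennreal_mult_less_top)
    then obtain n where n: "N x = ennreal n" "n \<ge> 0" by (cases "N x") auto
    have "n powr p \<le> v x powr (p - 1) * j"
    proof (cases "n = 0")
      case True
      then show ?thesis using p j elim by simp
    next
      case False
      then have n0: "n > 0" using n by simp
      \<comment> \<open>the mean of \<open>\<phi>\<close>, up to the total mass\<close>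
      define c where "c = n / v x"
      have c: "c > 0" using n0 elim by (simp add: c_def)
      have "ennreal (p * c powr (p - 1) * n) \<le> ennreal (j + (p - 1) * c powr p * v x)"
        using C[of c] c p j n elim
        by (simp add: ennreal_mult[symmetric] ennreal_plus[symmetric] del: ennreal_plus)
      then have 1: "p * c powr (p - 1) * n \<le> j + (p - 1) * c powr p * v x"
        using p c j elim by (subst (asm) ennreal_le_iff) auto
      have 2: "c powr p * v x = c powr (p - 1) * n"
      proof -
        have "c powr p = c powr (p - 1) * c" using c by (simp add: powr_diff)
        then show ?thesis using elim by (simp add: c_def)
      qed
      have "c powr (p - 1) * n \<le> j"
        using 1 2 by (simp add: algebra_simps)
      then have "v x powr (p - 1) * (c powr (p - 1) * n) \<le> v x powr (p - 1) * j"
        by (rule mult_left_mono) simp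
      moreover have "v x powr (p - 1) * (c powr (p - 1) * n) = n powr p"
      proof -
        have "v x powr (p - 1) * c powr (p - 1) = n powr (p - 1)"
          using elim by (simp add: powr_mult[symmetric] c_def)
        then have "v x powr (p - 1) * (c powr (p - 1) * n) = n powr (p - 1) * n" by (simp add: mult.assoc[symmetric])
        then show ?thesis using n0 by (simp add: powr_diff)
      qed
      ultimately show ?thesis by simp
    qed
    then have "ennreal (n powr p) \<le> ?w x * J x"
      using j by (simp add: ennreal_mult[symmetric])
    then show ?case using n by auto
  qed
  have conv: "AE x in lebesgue. kernel_integral_converges K f x"
  proof (rule AE_completion, use key in eventually_elim)
    case (elim x)
    have "(\<integral>\<^sup>+y. K x y * ennreal \<bar>f y\<bar> \<partial>lborel) = N x"
      unfolding N_def by (intro nn_integral_cong_AE) (use ff0 in eventually_elim, simp)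
    then show ?case using elim by (auto simp: kernel_integral_converges_def nn_integral_completion)
  qed
  define g where "g x = (\<integral>y. enn2real (K x y) * f0 y \<partial>lborel)" for x
  have g: "kernel_operator K f = g"
  proof
    fix x
    have "(\<integral>y. enn2real (K x y) * f y \<partial>lebesgue) = (\<integral>y. enn2real (K x y) * f0 y \<partial>lebesgue)"
    proof (rule integral_cong_AE)
      show "AE y in lebesgue. enn2real (K x y) * f y = enn2real (K x y) * f0 y"
        by (rule AE_completion, use ff0 in eventually_elim, simp)
      have 1: "K x \<in> borel_measurable lebesgue" "f0 \<in> borel_measurable lebesgue"
        by (intro measurable_completion; simp)+
      have 2: "f \<in> borel_measurable lebesgue" using f by (simp add: Lp_space_def)
      show "(\<lambda>y. enn2real (K x y) * f y) \<in> borel_measurable lebesgue"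
           "(\<lambda>y. enn2real (K x y) * f0 y) \<in> borel_measurable lebesgue"
        using 1 2 by measurable
    qed
    also have "\<dots> = g x"
      unfolding g_def by (rule integral_completion) simp
    finally show "kernel_operator K f x = g x" by (simp add: kernel_operator_def)
  qed
  have [measurable]: "g \<in> borel_measurable borel"
    unfolding g_def[abs_def] by (rule lborel.borel_measurable_lebesgue_integral) (simp add: split_beta')
  have bound: "(\<integral>\<^sup>+x. ennreal (\<bar>g x\<bar> powr p) \<partial>lborel) \<le> ennreal I"
  proof (rule order_trans[OF nn_integral_mono_AE intJ], use key in eventually_elim)
    case (elim x)
    then obtain n where n: "n \<ge> 0" "N x = ennreal n" "ennreal (n powr p) \<le> ?w x * J x" by auto
    have "\<bar>g x\<bar> \<le> n"
    proof (cases "integrable lborel (\<lambda>y. enn2real (K x y) * f0 y)")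
      case True
      have "ennreal \<bar>g x\<bar> \<le> (\<integral>\<^sup>+y. ennreal (norm (enn2real (K x y) * f0 y)) \<partial>lborel)"
        unfolding g_def using integral_norm_bound_ennreal[OF True] by simp
      also have "\<dots> \<le> N x"
        unfolding N_def
      proof (rule nn_integral_mono)
        fix y
        have "ennreal (norm (enn2real (K x y) * f0 y)) = ennreal (enn2real (K x y)) * ennreal \<bar>f0 y\<bar>"
          by (simp add: abs_mult ennreal_mult)
        also have "\<dots> \<le> K x y * ennreal \<bar>f0 y\<bar>"
          by (intro mult_right_mono) (auto simp: ennreal_enn2real_if)
        finally show "ennreal (norm (enn2real (K x y) * f0 y)) \<le> K x y * ennreal \<bar>f0 y\<bar>" .
      qed
      finally show ?thesis using n by simp
    next
      case False
      then show ?thesis using n by (simp add: g_def not_integrable_integral_eq)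
    qed
    then have "ennreal (\<bar>g x\<bar> powr p) \<le> ennreal (n powr p)"
      using p by (intro ennreal_leI powr_mono2) auto
    with n show ?case by (meson order_trans)
  qed
  have gL: "g \<in> Lp_space p"
    using bound by (intro Lp_spaceI measurable_completion) (auto simp: le_less_trans)
  have "ennreal (\<integral>x. \<bar>g x\<bar> powr p \<partial>lebesgue) \<le> ennreal I"
    using bound Lp_space_nn_integral[OF gL] by simp
  then have "(\<integral>x. \<bar>g x\<bar> powr p \<partial>lebesgue) \<le> I"
    by (subst (asm) ennreal_le_iff) (auto simp: I_def intro!: integral_nonneg_AE)
  then have "Lp_norm p g \<le> Lp_norm p f"
    unfolding Lp_norm_def I_def using p by (intro powr_mono2) (auto intro!: integral_nonneg_AE)
  then show "(AE x in lebesgue. kernel_integral_converges K f x) \<and> kernel_operator K f \<in> Lp_space p \<and> Lp_norm p (kernel_operator K f) \<le> Lp_norm p f"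
    using conv gL by (simp add: g)
qed

text \<open>
  Hoelder's inequality for \<open>f powr (p - 1)\<close> and the image of \<open>f\<close>.
\<close>

lemma Lp_contraction_test:
  fixes K :: "'a::euclidean_space \<Rightarrow> 'a \<Rightarrow> ennreal" and f :: "'a \<Rightarrow> real"
  assumes p: "1 < p" and contr: "Lp_contraction p K"
    and K[measurable]: "\<And>x. K x \<in> borel_measurable borel"
    and f[measurable]: "f \<in> borel_measurable borel" and f0: "\<And>x. 0 \<le> f x"
    and fin: "(\<integral>\<^sup>+x. ennreal (f x powr p) \<partial>lborel) < \<infinity>"
  shows "(\<integral>\<^sup>+x. ennreal (f x powr (p - 1)) * (\<integral>\<^sup>+y. K x y * ennreal (f y) \<partial>lborel) \<partial>lborel) \<le> (\<integral>\<^sup>+x. ennreal (f x powr p) \<partial>lborel)"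
proof -
  let ?I = "\<integral>\<^sup>+x. ennreal (f x powr p) \<partial>lborel" and ?N = "\<lambda>x. \<integral>\<^sup>+y. K x y * ennreal (f y) \<partial>lborel"
  have fL: "f \<in> Lp_space p"
    using fin f0 by (intro Lp_spaceI measurable_completion) (auto simp: abs_of_nonneg)
  define g where "g = kernel_operator K f"
  have conv: "AE x in lebesgue. kernel_integral_converges K f x" and gL: "g \<in> Lp_space p" and le: "Lp_norm p g \<le> Lp_norm p f"
    using contr fL by (auto simp: Lp_contraction_def g_def)
  have nn: "(\<integral>x. \<bar>h x\<bar> powr p \<partial>lebesgue) \<ge> 0" for h :: "'a \<Rightarrow> real"
    by (auto intro!: integral_nonneg_AE)
  have "(\<integral>x. \<bar>g x\<bar> powr p \<partial>lebesgue) \<le> (\<integral>x. \<bar>f x\<bar> powr p \<partial>lebesgue)"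
  proof -
    have "Lp_norm p g powr p \<le> Lp_norm p f powr p"
      using le p by (intro powr_mono2) (auto simp: Lp_norm_def)
    then show ?thesis using p nn by (simp add: Lp_norm_def powr_powr)
  qed
  then have gf: "(\<integral>\<^sup>+x. ennreal (\<bar>g x\<bar> powr p) \<partial>lborel) \<le> ?I"
    using Lp_space_nn_integral[OF gL] Lp_space_nn_integral[OF fL] nn f0 by (simp add: abs_of_nonneg ennreal_leI)
  obtain g0 where g0[measurable]: "g0 \<in> borel_measurable lborel" and gg0: "AE x in lborel. \<bar>g x\<bar> powr p = g0 x"
    using completion_ex_borel_measurable_real[of "\<lambda>x. \<bar>g x\<bar> powr p" lborel] gL by (auto simp: Lp_space_def)
  have conv': "AE x in lborel. kernel_integral_converges K f x"
    using conv by (simp add: AE_completion_iff)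
  have pt: "AE x in lborel. ennreal (f x powr (p - 1)) * ?N x
      \<le> ennreal (1 / p) * ennreal (g0 x) + ennreal ((p - 1) / p) * ennreal (f x powr p)"
    using conv' gg0
  proof eventually_elim
    case (elim x)
    have fin: "?N x < \<infinity>"
      using elim f0 by (simp add: kernel_integral_converges_def nn_integral_completion abs_of_nonneg)
    have "AE y in lborel. K x y * ennreal (f y) \<noteq> \<infinity>"
      using fin by (intro nn_integral_PInf_AE) auto
    then have "AE y in lborel. K x y * ennreal (f y) = ennreal (enn2real (K x y) * f y)"
    proof eventually_elim
      case (elim y)
      show ?case
      proof (cases "K x y = \<top>")
        case True
        with elim have "f y = 0" using f0[of y] by (auto simp: ennreal_mult_eq_top_iff ennreal_eq_0_iff)
        then show ?thesis by simp
      next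
        case False
        then show ?thesis using f0[of y] by (simp add: ennreal_mult ennreal_enn2real_if)
      qed
    qed
    then have 1: "?N x = (\<integral>\<^sup>+y. ennreal (enn2real (K x y) * f y) \<partial>lborel)"
      by (rule nn_integral_cong_AE)
    have "g x = (\<integral>y. enn2real (K x y) * f y \<partial>lborel)"
      unfolding g_def kernel_operator_def by (rule integral_completion) simp
    also have "\<dots> = enn2real (\<integral>\<^sup>+y. ennreal (enn2real (K x y) * f y) \<partial>lborel)"
      using f0 by (intro integral_eq_nn_integral) auto
    finally have 2: "?N x = ennreal (g x)" "g x \<ge> 0"
      using fin unfolding 1[symmetric] by (auto simp: ennreal_enn2real_if)
    have "p * f x powr (p - 1) * g x \<le> g x powr p + (p - 1) * f x powr p"
      using p f0 2 by (intro tangent_powr) auto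
    then have "f x powr (p - 1) * g x \<le> 1 / p * g0 x + (p - 1) / p * f x powr p"
      using p 2 elim by (simp add: field_simps)
    then have "ennreal (f x powr (p - 1) * g x) \<le> ennreal (1 / p * g0 x + (p - 1) / p * f x powr p)"
      by (rule ennreal_leI)
    moreover have "g0 x \<ge> 0" using elim by (metis powr_ge_zero)
    ultimately show ?case
      using p 2 by (simp add: ennreal_mult[symmetric] ennreal_plus[symmetric] del: ennreal_plus)
  qed
  have "(\<integral>\<^sup>+x. ennreal (f x powr (p - 1)) * ?N x \<partial>lborel)
     \<le> (\<integral>\<^sup>+x. ennreal (1 / p) * ennreal (g0 x) + ennreal ((p - 1) / p) * ennreal (f x powr p) \<partial>lborel)"
    by (rule nn_integral_mono_AE) (rule pt)
  also have "\<dots> = ennreal (1 / p) * (\<integral>\<^sup>+x. ennreal (g0 x) \<partial>lborel) + ennreal ((p - 1) / p) * ?I"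
    by (subst nn_integral_add) (auto simp: nn_integral_cmult)
  also have "(\<integral>\<^sup>+x. ennreal (g0 x) \<partial>lborel) = (\<integral>\<^sup>+x. ennreal (\<bar>g x\<bar> powr p) \<partial>lborel)"
    by (intro nn_integral_cong_AE) (use gg0 in eventually_elim, simp)
  also have "ennreal (1 / p) * (\<integral>\<^sup>+x. ennreal (\<bar>g x\<bar> powr p) \<partial>lborel) + ennreal ((p - 1) / p) * ?I
     \<le> ennreal (1 / p) * ?I + ennreal ((p - 1) / p) * ?I"
    using gf by (intro add_right_mono mult_left_mono) auto
  also have "\<dots> = ?I"
  proof -
    have "ennreal (1 / p) + ennreal ((p - 1) / p) = 1"
      using p by (simp add: ennreal_plus[symmetric] add_divide_distrib[symmetric] del: ennreal_plus)
    then show ?thesis by (simp add: distrib_right[symmetric])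
  qed
  finally show ?thesis .
qed

section \<open>Sufficiency\<close>

context stable_subordinator
begin

text \<open>
  In the second Schur condition \<open>v powr (p - 1)\<close> is the power with the dual exponent \<open>\<beta>'\<close>, which has
  the same constant \<open>kappa\<close>.
\<close>

theorem contraction_if_kappa_le:
  fixes \<delta> p t \<beta> :: real
  assumes p: "1 < p" and b: "0 < \<beta>" "\<beta> * p + 2 * \<sigma> = real DIM('a::euclidean_space)" and t: "t > 0"
    and k: "kappa DIM('a) (2 * \<sigma>) \<delta> \<le> kappa DIM('a) (2 * \<sigma>) \<beta>"
  shows "Lp_contraction p (feynman_kac_kernel \<eta> (2 * \<sigma>) \<delta> t :: 'a \<Rightarrow> 'a \<Rightarrow> ennreal)"
proof -
  define K where "K = (feynman_kac_kernel \<eta> (2 * \<sigma>) \<delta> t :: 'a \<Rightarrow> 'a \<Rightarrow> ennreal)"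
  define \<beta>' where "\<beta>' = \<beta> * (p - 1)"
  have b': "0 < \<beta>'" "\<beta> + \<beta>' + 2 * \<sigma> = real DIM('a)"
    using p b by (auto simp: \<beta>'_def algebra_simps)
  then have b1: "\<beta> + 2 * \<sigma> < real DIM('a)" "\<beta>' + 2 * \<sigma> < real DIM('a)" using b by auto
  have kk: "kappa DIM('a) (2 * \<sigma>) \<beta>' = kappa DIM('a) (2 * \<sigma>) \<beta>"
  proof -
    have "\<beta>' = real DIM('a) - \<beta> - 2 * \<sigma>" using b' by simp
    then show ?thesis by (simp add: kappa_def mult_ac)
  qed
  have le: "(\<integral>\<^sup>+y. K x y * npow \<beta> y \<partial>lborel) \<le> npow \<beta> x" "(\<integral>\<^sup>+y. K x y * npow \<beta>' y \<partial>lborel) \<le> npow \<beta>' x" if "x \<noteq> 0" for x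
    unfolding K_def using that b b' b1 k kk t by (auto intro!: feynman_kac_npow_le)
  have "Lp_contraction p K"
  proof (rule Lp_contraction_of_Schur[OF p, where v="\<lambda>x. norm x powr (- \<beta>)"])
    show "(\<lambda>x::'a \<times> 'a. K (f x) (g x)) \<in> borel_measurable (borel \<Otimes>\<^sub>M borel)"
      if "f \<in> borel_measurable (borel \<Otimes>\<^sub>M borel)" "g \<in> borel_measurable (borel \<Otimes>\<^sub>M borel)" for f g :: "'a \<times> 'a \<Rightarrow> 'a"
      unfolding K_def using t that by (intro borel_measurable_feynman_kac) auto
    show "AE x::'a in lborel. 0 < norm x powr (- \<beta>)"
      using AE_lborel_singleton[of "0::'a"] by eventually_elim simp
    show "AE x in lborel. (\<integral>\<^sup>+y. K x y * ennreal (norm y powr (- \<beta>)) \<partial>lborel) \<le> ennreal (norm x powr (- \<beta>))"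
      using AE_lborel_singleton[of "0::'a"] by eventually_elim (use le(1) in \<open>simp add: npow_def\<close>)
    show "AE y in lborel. (\<integral>\<^sup>+x. ennreal ((norm x powr (- \<beta>)) powr (p - 1)) * K x y \<partial>lborel) \<le> ennreal ((norm y powr (- \<beta>)) powr (p - 1))"
      using AE_lborel_singleton[of "0::'a"]
    proof eventually_elim
      case (elim y)
      have sym: "K x y = K y x" for x unfolding K_def by (rule feynman_kac_symmetric[OF t])
      have pw: "ennreal ((norm x powr (- \<beta>)) powr (p - 1)) = npow \<beta>' x" for x :: 'a
        by (simp add: npow_def powr_powr \<beta>'_def)
      show ?case using le(2)[OF elim] unfolding pw sym[of _] by (simp add: mult.commute)
    qed
  qed simp
  then show ?thesis by (simp add: K_def)
qed

end

section \<open>Integrals of powers and occupation integrals\<close>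

text \<open>
  Represent the power as a Gaussian mixture. A Gaussian kernel puts mass at most \<open>1\<close> on the ball, which
  handles small times; for \<open>r \<ge> 1\<close> its mass there is at most a multiple of its value at a unit
  vector \<open>e\<close>, and these values integrate to \<open>npow \<gamma> e\<close>.
\<close>

lemma nn_integral_npow_ball_finite:
  assumes g: "0 < \<gamma>" "\<gamma> < real DIM('a::euclidean_space)"
  shows "(\<integral>\<^sup>+x. npow \<gamma> (x::'a) * indicator {x. norm x < R} x \<partial>lborel) < \<infinity>"
proof -
  define d where "d = real DIM('a)"
  define a where "a = (d - \<gamma>) / 2 - 1"
  define C where "C = riesz_const TYPE('a) \<gamma>"
  have C: "C > 0" using riesz_const_pos[OF g(1)] by (simp add: C_def)
  define B where "B = {x::'a. norm x < R}"
  have [measurable]: "B \<in> sets borel" unfolding B_def by measurable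
  have Bb: "B = ball 0 R" by (auto simp: B_def)
  have vB: "emeasure lborel B < \<infinity>" unfolding Bb using emeasure_lborel_ball_finite[of "0::'a" R] by (simp add: less_top[symmetric])
  obtain e :: 'a where en: "norm e = 1" using vector_choose_size[of 1] by auto
  have e0: "e \<noteq> 0" using en by auto
  let ?F = "\<lambda>r x. ennreal (r powr a) * gauss r x * indicator {0<..} r * indicator B x"
    and ?m = "\<lambda>r. \<integral>\<^sup>+x. gauss r x * indicator B x \<partial>lborel"
    and ?S = "\<lambda>r. ennreal (r powr a * (1 - r) powr (1 - 1)) * indicator {0<..<1} r"
    and ?L = "\<lambda>r. ennreal (r powr a) * gauss r e * indicator {0<..} r"
  have inner: "?m r \<le> indicator {0<..<1} r + emeasure lborel B * (ennreal (exp (1 / 4)) * gauss r e)"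
    if r: "r > 0" for r
  proof (cases "r < 1")
    case True
    have "?m r \<le> (\<integral>\<^sup>+x. gauss r (x::'a) \<partial>lborel)"
      by (intro nn_integral_mono) (auto split: split_indicator)
    also have "\<dots> = 1" by (rule nn_integral_gauss_kernel[OF r])
    finally show ?thesis using True r by (auto intro: order_trans)
  next
    case False
    have "gauss_kernel r x \<le> exp (1 / 4) * gauss_kernel r e" for x :: 'a
    proof -
      have "exp (- (norm x)\<^sup>2 / (4 * r)) \<le> 1" using r by simp
      also have "1 \<le> exp (1 / 4 - 1 / (4 * r))" using False by (simp add: field_simps)
      also have "\<dots> = exp (1 / 4) * exp (- (norm e)\<^sup>2 / (4 * r))" using en by (simp add: exp_add[symmetric])
      finally have "(4 * pi * r) powr (- real DIM('a) / 2) * exp (- (norm x)\<^sup>2 / (4 * r)) \<le> (4 * pi * r) powr (- real DIM('a) / 2) * (exp (1 / 4) * exp (- (norm e)\<^sup>2 / (4 * r)))"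
        by (intro mult_left_mono) auto
      then show ?thesis by (simp add: gauss_kernel_def mult_ac)
    qed
    then have "?m r \<le> (\<integral>\<^sup>+x. ennreal (exp (1 / 4) * gauss_kernel r e) * indicator B x \<partial>lborel)"
      by (intro nn_integral_mono mult_right_mono ennreal_leI) auto
    also have "\<dots> = emeasure lborel B * (ennreal (exp (1 / 4)) * gauss r e)"
      by (subst nn_integral_cmult) (auto simp: ennreal_mult mult.commute)
    finally show ?thesis by (simp add: add_increasing)
  qed
  have "ennreal C * (\<integral>\<^sup>+x. npow \<gamma> x * indicator B x \<partial>lborel) = (\<integral>\<^sup>+x. ennreal C * (npow \<gamma> x * indicator B x) \<partial>lborel)"
    by (rule nn_integral_cmult[symmetric]) simp
  also have "\<dots> = (\<integral>\<^sup>+x. (\<integral>\<^sup>+r. ?F r x \<partial>lborel) \<partial>lborel)"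
  proof (rule nn_integral_cong_AE, use AE_lborel_singleton[of "0::'a"] in eventually_elim)
    case (elim x)
    have "(\<integral>\<^sup>+r. ?F r x \<partial>lborel)
      = (\<integral>\<^sup>+r. ennreal (r powr a) * gauss r x * indicator {0<..} r \<partial>lborel) * indicator B x"
      by (rule nn_integral_multc) simp
    also have "\<dots> = ennreal C * npow \<gamma> x * indicator B x"
      using npow_eq_Gaussian_mixture[OF g(1) elim] by (simp only: C_def a_def d_def)
    finally show ?case by (simp only: mult.assoc)
  qed
  also have "\<dots> = (\<integral>\<^sup>+r. (\<integral>\<^sup>+x. ?F r x \<partial>lborel) \<partial>lborel)"
    by (rule lborel_pair.Fubini') simp
  also have "\<dots> \<le> (\<integral>\<^sup>+r. ?S r + emeasure lborel B * (ennreal (exp (1 / 4)) * ?L r) \<partial>lborel)"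
  proof (rule nn_integral_mono, goal_cases)
    case (1 r)
    show ?case
    proof (cases "r > 0")
      case True
      have "(\<integral>\<^sup>+x. ?F r x \<partial>lborel)
        = ennreal (r powr a) * ?m r"
        using True by (subst nn_integral_cmult[symmetric]) (auto simp: mult.assoc)
      also have "\<dots> \<le> ennreal (r powr a) * (indicator {0<..<1} r + emeasure lborel B * (ennreal (exp (1 / 4)) * gauss r e))"
        using inner[OF True] by (rule mult_left_mono) simp
      also have "\<dots> = ?S r + emeasure lborel B * (ennreal (exp (1 / 4)) * ?L r)"
        using True by (auto simp: distrib_left mult_ac split: split_indicator)
      finally show ?thesis .
    qed simp
  qed
  also have "\<dots> = (\<integral>\<^sup>+r\<in>{0<..<1}. ennreal (r powr a * (1 - r) powr (1 - 1)) \<partial>lborel) + emeasure lborel B * (ennreal (exp (1 / 4)) * (\<integral>\<^sup>+r\<in>{0<..}. ennreal (r powr a) * gauss r e \<partial>lborel))"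
    by (subst nn_integral_add) (auto simp: nn_integral_cmult)
  also have "(\<integral>\<^sup>+r\<in>{0<..<1}. ennreal (r powr a * (1 - r) powr (1 - 1)) \<partial>lborel) = ennreal (Beta (a + 1) 1 * 1 powr (a + 1 + 1 - 1))"
  proof -
    have "0 < a + 1" using g by (simp add: a_def d_def)
    from nn_integral_Beta[OF this, of 1 1] show ?thesis by simp
  qed
  also have "(\<integral>\<^sup>+r\<in>{0<..}. ennreal (r powr a) * gauss r e \<partial>lborel) = ennreal C * npow \<gamma> e"
    unfolding a_def d_def C_def by (rule npow_eq_Gaussian_mixture[OF g(1) e0])
  also have "ennreal (Beta (a + 1) 1 * 1 powr (a + 1 + 1 - 1)) + emeasure lborel B * (ennreal (exp (1 / 4)) * (ennreal C * npow \<gamma> e)) < \<infinity>"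
    using vB by (simp add: ennreal_mult_less_top npow_def)
  finally have "ennreal C * (\<integral>\<^sup>+x. npow \<gamma> x * indicator B x \<partial>lborel) < \<infinity>" .
  then show ?thesis using C by (auto simp: ennreal_mult_less_top B_def)
qed

lemma npow_scaleR:
  "c > 0 \<Longrightarrow> npow \<gamma> (c *\<^sub>R x) = ennreal (c powr (- \<gamma>)) * npow \<gamma> x"
  by (simp add: npow_def powr_mult ennreal_mult)

text \<open>
  Scaling by \<open>2\<close> shows that the integral does not depend on \<open>M\<close>. Were it finite, the shell between
  \<open>M\<close> and \<open>2 * M\<close> would contribute nothing.
\<close>

lemma nn_integral_npow_outside_infinite:
  assumes M: "M > 0"
  shows "(\<integral>\<^sup>+x. npow (real DIM('a)) (x::'a::euclidean_space) * indicator {x. M \<le> norm x} x \<partial>lborel) = \<infinity>"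
proof (rule ccontr)
  define d where "d = real DIM('a)"
  define I where "I M = (\<integral>\<^sup>+x. npow d (x::'a) * indicator {x. M \<le> norm x} x \<partial>lborel)" for M
  define S where "S = (\<integral>\<^sup>+x. npow d (x::'a) * indicator {x. M \<le> norm x \<and> norm x < 2 * M} x \<partial>lborel)"
  assume "\<not> ?thesis"
  then have fin: "I M \<noteq> \<infinity>" by (simp add: I_def d_def)
  have "I (2 * M) = ennreal (\<bar>2\<bar> ^ DIM('a)) * (\<integral>\<^sup>+x. npow d (0 + 2 *\<^sub>R x::'a) * indicator {x. 2 * M \<le> norm x} (0 + 2 *\<^sub>R x) \<partial>lborel)"
    unfolding I_def by (rule nn_integral_lborel_affine) auto
  also have "\<dots> = ennreal (\<bar>2\<bar> ^ DIM('a)) * (ennreal (2 powr (- d)) * I M)"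
    unfolding I_def by (subst nn_integral_cmult[symmetric])
      (auto intro!: arg_cong2[where f="(*)"] nn_integral_cong simp: npow_scaleR mult.assoc split: split_indicator)
  also have "\<dots> = I M"
    by (simp add: mult.assoc[symmetric] ennreal_mult[symmetric] d_def powr_minus powr_realpow)
  finally have I2: "I (2 * M) = I M" .
  have "I M = (\<integral>\<^sup>+x. npow d (x::'a) * indicator {x. 2 * M \<le> norm x} x + npow d (x::'a) * indicator {x. M \<le> norm x \<and> norm x < 2 * M} x \<partial>lborel)"
    unfolding I_def using M by (intro nn_integral_cong) (auto split: split_indicator)
  also have "\<dots> = I (2 * M) + S"
    unfolding I_def S_def by (rule nn_integral_add) auto
  finally have "I M + S = I M + 0" by (simp add: I2)
  then have S0: "S = 0" using fin by (simp only: ennreal_add_left_cancel) auto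
  obtain e :: 'a where en: "norm e = 1" using vector_choose_size[of 1] by auto
  define c where "c = (3 * M / 2) *\<^sub>R e"
  have nc: "norm c = 3 * M / 2" using en M by (simp add: c_def)
  have "ennreal ((2 * M) powr (- d)) * emeasure lborel (ball c (M / 2)) = (\<integral>\<^sup>+x. ennreal ((2 * M) powr (- d)) * indicator (ball c (M / 2)) x \<partial>lborel)"
    by (rule nn_integral_cmult_indicator[symmetric]) simp
  also have "\<dots> \<le> S"
    unfolding S_def
  proof (rule nn_integral_mono, goal_cases)
    case (1 x)
    show ?case
    proof (cases "x \<in> ball c (M / 2)")
      case True
      then have "dist c x < M / 2" by simp
      then have x: "M < norm x" "norm x < 2 * M"
        using norm_triangle_ineq2[of c x] norm_triangle_ineq2[of x c] nc by (auto simp: dist_norm norm_minus_commute)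
      then have "(2 * M) powr (- d) \<le> norm x powr (- d)"
        using M by (intro powr_mono2') (auto simp: d_def)
      then show ?thesis using x True by (auto simp: npow_def intro: ennreal_leI)
    qed simp
  qed
  finally have "emeasure lborel (ball c (M / 2)) = 0"
    using M S0 by simp
  moreover have "0 < unit_ball_vol (real DIM('a)) * (M / 2) ^ DIM('a)"
    using M by (intro mult_pos_pos unit_ball_vol_pos zero_less_power) auto
  ultimately show False using M by (simp add: emeasure_ball ennreal_eq_0_iff)
qed

context stable_subordinator
begin

text \<open>
  The expected time integral of \<open>f\<close> along the stable process up to time \<open>t\<close>.
\<close>

definition occ :: "real \<Rightarrow> ('a::euclidean_space \<Rightarrow> ennreal) \<Rightarrow> 'a \<Rightarrow> ennreal" where
  "occ t f x = (\<integral>\<^sup>+s\<in>{0<..<t}. P s f x \<partial>lborel)"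

lemma borel_measurable_occ[measurable]:
  assumes [measurable]: "f \<in> borel_measurable borel"
  shows "occ t f \<in> borel_measurable borel"
  unfolding occ_def[abs_def] by measurable

lemma occ_mono: "(AE y in lborel. f y \<le> g y) \<Longrightarrow> occ t f x \<le> occ t g x"
  unfolding occ_def by (intro nn_integral_mono mult_right_mono P_mono) auto

lemma occ_symmetric:
  fixes f g :: "'a::euclidean_space \<Rightarrow> ennreal"
  assumes [measurable]: "f \<in> borel_measurable borel" "g \<in> borel_measurable borel"
  shows "(\<integral>\<^sup>+x. g x * occ t f x \<partial>lborel) = (\<integral>\<^sup>+x. f x * occ t g x \<partial>lborel)"
proof -
  have *: "(\<integral>\<^sup>+x. g x * occ t f x \<partial>lborel) = (\<integral>\<^sup>+s. (\<integral>\<^sup>+x. g x * P s f x \<partial>lborel) * indicator {0<..<t} s \<partial>lborel)"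
    if [measurable]: "f \<in> borel_measurable borel" "g \<in> borel_measurable borel" for f g :: "'a \<Rightarrow> ennreal"
  proof -
    have "(\<integral>\<^sup>+x. g x * occ t f x \<partial>lborel) = (\<integral>\<^sup>+x. (\<integral>\<^sup>+s. g x * (P s f x * indicator {0<..<t} s) \<partial>lborel) \<partial>lborel)"
      unfolding occ_def by (simp add: nn_integral_cmult)
    also have "\<dots> = (\<integral>\<^sup>+s. (\<integral>\<^sup>+x. g x * (P s f x * indicator {0<..<t} s) \<partial>lborel) \<partial>lborel)"
      by (rule lborel_pair.Fubini') simp
    finally show ?thesis by (simp add: mult.assoc[symmetric] nn_integral_multc)
  qed
  have "(\<integral>\<^sup>+x. g x * P s f x \<partial>lborel) = (\<integral>\<^sup>+x. f x * P s g x \<partial>lborel)" for s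
    unfolding P_symmetric[OF assms] by (rule nn_integral_cong) (rule mult.commute)
  then show ?thesis by (simp only: *[OF assms] *[OF assms(2,1)])
qed

lemma nn_integral_occ:
  fixes f :: "'a::euclidean_space \<Rightarrow> ennreal"
  assumes t: "t > 0" and [measurable]: "f \<in> borel_measurable borel"
  shows "(\<integral>\<^sup>+x. occ t f x \<partial>lborel) = ennreal t * (\<integral>\<^sup>+x. f x \<partial>lborel)"
proof -
  have 1: "occ t (\<lambda>_. 1) x = ennreal t" for x :: 'a
  proof -
    have "occ t (\<lambda>_. 1) x = (\<integral>\<^sup>+s. indicator {0<..<t} s \<partial>lborel)"
      unfolding occ_def by (intro nn_integral_cong) (auto simp: P_const split: split_indicator)
    then show ?thesis using t by simp
  qed
  have "(\<integral>\<^sup>+x. 1 * occ t f x \<partial>lborel) = (\<integral>\<^sup>+x. f x * occ t (\<lambda>_. 1) x \<partial>lborel)"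
    by (rule occ_symmetric) auto
  also have "\<dots> = (\<integral>\<^sup>+x. f x \<partial>lborel) * ennreal t"
    unfolding 1 by (rule nn_integral_multc) simp
  finally show ?thesis by (simp add: mult.commute)
qed

lemma occ_npow_le:
  fixes x :: "'a::euclidean_space"
  assumes b: "0 < \<beta>" "\<beta> + 2 * \<sigma> < real DIM('a)" and x: "x \<noteq> 0" and t: "t > 0"
  shows "occ t (npow \<beta>) x \<le> ennreal t * npow \<beta> x"
proof -
  have "occ t (npow \<beta>) x \<le> (\<integral>\<^sup>+s. npow \<beta> x * indicator {0<..<t} s \<partial>lborel)"
    unfolding occ_def by (intro nn_integral_mono) (auto simp: P_npow_le[OF b x] split: split_indicator)
  also have "\<dots> = npow \<beta> x * ennreal t"
    using t by (subst nn_integral_cmult_indicator) auto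
  finally show ?thesis by (simp add: mult.commute)
qed

lemma occ_npow_ge:
  fixes x :: "'a::euclidean_space"
  assumes b: "0 < \<beta>" "\<beta> + 2 * \<sigma> < real DIM('a)" and x: "x \<noteq> 0" and t: "t > 0"
  shows "ennreal t * P t (npow \<beta>) x \<le> occ t (npow \<beta>) x"
proof -
  have "ennreal t * P t (npow \<beta>) x = (\<integral>\<^sup>+s. P t (npow \<beta>) x * indicator {0<..<t} s \<partial>lborel)"
    using t by (subst nn_integral_cmult_indicator) (auto simp: mult.commute)
  also have "\<dots> \<le> occ t (npow \<beta>) x"
    unfolding occ_def by (intro nn_integral_mono) (auto simp: P_npow_antimono[OF b x] split: split_indicator)
  finally show ?thesis .
qed

text \<open>
  The bound \<open>occ t (npow \<beta>') \<le> t * npow \<beta>'\<close> is not sufficient, since it leads to the integral of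
  \<open>npow d\<close> near the origin. A slightly larger exponent \<open>\<gamma> > 2 * \<sigma>\<close> is used instead: \<open>npow \<beta>' \<le> 1 + npow \<gamma>\<close>, and
  the potential of \<open>npow \<gamma>\<close> is a multiple of \<open>npow (\<gamma> - 2 * \<sigma>)\<close>, where \<open>\<gamma> - 2 * \<sigma> < \<beta>'\<close>.
\<close>

lemma occ_npow_near_zero:
  assumes b: "0 < \<beta>" "0 < \<beta>'" "\<beta> + \<beta>' + 2 * \<sigma> = real DIM('a::euclidean_space)" and t: "t > 0"
  shows "(\<integral>\<^sup>+x. npow (\<beta> + 2 * \<sigma>) (x::'a) * occ t (npow \<beta>') x * indicator {x. norm x < M} x \<partial>lborel) < \<infinity>"
proof -
  let ?B = "indicator {x. norm x < M} :: 'a \<Rightarrow> ennreal"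
  define d where "d = real DIM('a)"
  \<comment> \<open>\<open>\<gamma> > 2 * \<sigma>\<close> and \<open>\<gamma> < d\<close> for the potential, \<open>\<gamma> > \<beta>'\<close> near the origin,
    \<open>\<gamma> < 2 * \<sigma> + \<beta>'\<close> for the final integrability\<close>
  have "max (2 * \<sigma>) \<beta>' < min d (2 * \<sigma> + \<beta>')" using b \<sigma> by (auto simp: d_def)
  then obtain \<gamma> where g: "max (2 * \<sigma>) \<beta>' < \<gamma>" "\<gamma> < min d (2 * \<sigma> + \<beta>')" using dense by blast
  define \<rho> where "\<rho> = \<gamma> - 2 * \<sigma>"
  have \<rho>: "0 < \<rho>" "\<rho> + 2 * \<sigma> < real DIM('a)" "\<gamma> = \<rho> + 2 * \<sigma>" using g by (auto simp: \<rho>_def d_def)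
  define k where "k = kappa DIM('a) (2 * \<sigma>) \<rho>"
  have k: "k > 0" using riesz_kappa(2)[OF \<rho>(1,2)] by (simp add: k_def)
  have le: "npow \<beta>' y \<le> 1 + npow \<gamma> y" if "y \<noteq> 0" for y :: 'a
  proof -
    have "norm y powr (- \<beta>') \<le> 1 + norm y powr (- \<gamma>)"
    proof (cases "norm y \<ge> 1")
      case True
      then have "norm y powr (- \<beta>') \<le> 1" using b that powr_mono[of "- \<beta>'" 0 "norm y"] by simp
      then show ?thesis by (simp add: add_increasing2)
    next
      case False
      then have "norm y powr (- \<beta>') \<le> norm y powr (- \<gamma>)" using that g by (intro powr_mono') auto
      then show ?thesis by simp
    qed
    from ennreal_leI[OF this] show ?thesis by (simp add: npow_def)
  qed
  have occ: "occ t (npow \<beta>') x \<le> ennreal t + ennreal (1 / k) * npow \<rho> x" if x: "x \<noteq> 0" for x :: 'a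
  proof -
    have "occ t (npow \<beta>') x \<le> occ t (\<lambda>y. 1 + npow \<gamma> y) x"
      by (rule occ_mono, use AE_lborel_singleton[of "0::'a"] in eventually_elim) (rule le)
    also have "\<dots> = (\<integral>\<^sup>+s. indicator {0<..<t} s + P s (npow \<gamma>) x * indicator {0<..<t} s \<partial>lborel)"
      unfolding occ_def by (intro nn_integral_cong) (auto simp: P_add P_const split: split_indicator)
    also have "\<dots> = ennreal t + (\<integral>\<^sup>+s\<in>{0<..<t}. P s (npow \<gamma>) x \<partial>lborel)"
      using t by (subst nn_integral_add) auto
    also have "\<dots> \<le> ennreal t + (\<integral>\<^sup>+s\<in>{0<..}. P s (npow \<gamma>) x \<partial>lborel)"
      by (intro add_left_mono nn_integral_mono) (auto split: split_indicator)
    also have "(\<integral>\<^sup>+s\<in>{0<..}. P s (npow \<gamma>) x \<partial>lborel) = ennreal (1 / k) * npow \<rho> x"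
    proof -
      have "ennreal (1 / k) * (ennreal k * (\<integral>\<^sup>+s\<in>{0<..}. P s (npow \<gamma>) x \<partial>lborel)) = ennreal (1 / k) * npow \<rho> x"
        using potential_npow[OF \<rho>(1,2) x] by (simp add: k_def \<rho>(3))
      then show ?thesis using k by (simp add: mult.assoc[symmetric] ennreal_mult[symmetric])
    qed
    finally show ?thesis .
  qed
  have "(\<integral>\<^sup>+x. npow (\<beta> + 2 * \<sigma>) (x::'a) * occ t (npow \<beta>') x * ?B x \<partial>lborel)
    \<le> (\<integral>\<^sup>+x. ennreal t * (npow (\<beta> + 2 * \<sigma>) (x::'a) * ?B x) + ennreal (1 / k) * (npow (\<beta> + 2 * \<sigma> + \<rho>) x * ?B x) \<partial>lborel)"
  proof (rule nn_integral_mono_AE, use AE_lborel_singleton[of "0::'a"] in eventually_elim)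
    case (elim x)
    have "npow (\<beta> + 2 * \<sigma>) x * occ t (npow \<beta>') x * ?B x \<le> npow (\<beta> + 2 * \<sigma>) x * (ennreal t + ennreal (1 / k) * npow \<rho> x) * ?B x"
      by (intro mult_right_mono mult_left_mono occ elim) auto
    also have "\<dots> = ennreal t * (npow (\<beta> + 2 * \<sigma>) (x::'a) * ?B x) + ennreal (1 / k) * (npow (\<beta> + 2 * \<sigma> + \<rho>) x * ?B x)"
      by (simp add: npow_mult[symmetric] distrib_left distrib_right mult_ac)
    finally show ?case .
  qed
  also have "\<dots> = ennreal t * (\<integral>\<^sup>+x. npow (\<beta> + 2 * \<sigma>) (x::'a) * ?B x \<partial>lborel) + ennreal (1 / k) * (\<integral>\<^sup>+x. npow (\<beta> + 2 * \<sigma> + \<rho>) (x::'a) * ?B x \<partial>lborel)"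
    by (subst nn_integral_add) (auto simp: nn_integral_cmult)
  moreover have "(\<integral>\<^sup>+x. npow (\<beta> + 2 * \<sigma>) (x::'a) * ?B x \<partial>lborel) < \<infinity>"
    by (rule nn_integral_npow_ball_finite) (use b \<sigma> in auto)
  moreover have "(\<integral>\<^sup>+x. npow (\<beta> + 2 * \<sigma> + \<rho>) (x::'a) * ?B x \<partial>lborel) < \<infinity>"
    by (rule nn_integral_npow_ball_finite) (use b \<sigma> \<rho> g in \<open>auto simp: d_def\<close>)
  ultimately show ?thesis
    by (auto simp: ennreal_mult_less_top intro: le_less_trans)
qed

end

section \<open>Necessity\<close>

lemma ennreal_le_plusI: "a \<le> b + c \<Longrightarrow> 0 \<le> b \<Longrightarrow> 0 \<le> c \<Longrightarrow> ennreal a \<le> ennreal b + ennreal c"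
  using ennreal_leI[of a "b + c"] by simp

text \<open>
  Being the maximum of a shifted power and \<open>0\<close>, this truncation satisfies the one-sided estimate for
  \<open>P t\<close> that the power satisfies. It is integrable to the power \<open>p\<close> because it vanishes for
  \<open>norm x \<ge> R\<close>.
\<close>

definition trunc :: "real \<Rightarrow> real \<Rightarrow> 'a::euclidean_space \<Rightarrow> real" where
  "trunc \<beta> R x = max 0 (norm x powr (- \<beta>) - R powr (- \<beta>))"

lemma borel_measurable_trunc[measurable]: "trunc \<beta> R \<in> borel_measurable borel"
  unfolding trunc_def[abs_def] by measurable

lemma trunc_nonneg[simp]: "0 \<le> trunc \<beta> R x"
  by (simp add: trunc_def)

lemma trunc_le: "trunc \<beta> R x \<le> norm x powr (- \<beta>)"
  by (simp add: trunc_def)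

lemma trunc_eq_0: "0 < \<beta> \<Longrightarrow> 0 < R \<Longrightarrow> R \<le> norm x \<Longrightarrow> trunc \<beta> R x = 0"
  using powr_mono2'[of "- \<beta>" R "norm x"] by (simp add: trunc_def)

lemma trunc_powr_le_npow:
  assumes "0 < \<beta>" "0 < R" "0 < q"
  shows "ennreal (trunc \<beta> R x powr q) \<le> npow (\<beta> * q) x * indicator {x. norm x < R} x"
proof (cases "norm x < R")
  case True
  have "trunc \<beta> R x powr q \<le> (norm x powr (- \<beta>)) powr q"
    using assms by (intro powr_mono2 trunc_le) auto
  then show ?thesis using True by (simp add: npow_def powr_powr ennreal_leI)
next
  case False
  then show ?thesis using trunc_eq_0[of \<beta> R x] assms by simp
qed

lemma ennreal_absorb_le:
  fixes m B :: ennreal and K k :: real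
  assumes "0 < k" "k < K" and fin: "m < \<infinity>" "B < \<infinity>" and le: "ennreal K * m \<le> ennreal k * (m + B)"
  shows "m \<le> ennreal (k / (K - k)) * B"
proof -
  obtain x where x: "m = ennreal x" "0 \<le> x" using fin by (cases m) auto
  obtain y where y: "B = ennreal y" "0 \<le> y" using fin by (cases B) auto
  have "ennreal (K * x) \<le> ennreal (k * (x + y))"
    using le assms(1,2) x y by (simp add: ennreal_mult)
  then have "K * x \<le> k * (x + y)"
    using assms(1,2) x y by (subst (asm) ennreal_le_iff) auto
  then have "x \<le> k / (K - k) * y"
    using assms(1,2) by (simp add: field_simps)
  then show ?thesis
    using assms(1,2) x y by (simp add: ennreal_mult[symmetric] ennreal_leI)
qed

context stable_subordinator
begin

text \<open>
  Test the contraction on the truncated power and keep the terms of order zero and one, \<open>X\<close> and \<open>Y\<close>, so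
  that \<open>X + Y \<le> A\<close>. The decomposition of the power in \<open>npow_eq_P_plus\<close> passes to the truncation as an
  inequality and bounds \<open>A\<close> by \<open>X\<close> plus an occupation integral; cancel \<open>X\<close>.
\<close>

lemma contraction_imp_occupation_bound:
  fixes \<delta> p t R \<beta> :: real
  defines "f \<equiv> \<lambda>x::'a::euclidean_space. ennreal (trunc \<beta> R x)"
    and "g \<equiv> \<lambda>x::'a. ennreal (trunc \<beta> R x powr (p - 1))"
    and "q \<equiv> \<lambda>x::'a. ennreal (hardy_potential (2 * \<sigma>) \<delta> x)"
  assumes p: "1 < p" and b: "0 < \<beta>" "\<beta> * p + 2 * \<sigma> = real DIM('a)" and R: "R > 0" and t: "t > 0"
    and contr: "Lp_contraction p (feynman_kac_kernel \<eta> (2 * \<sigma>) \<delta> t :: 'a \<Rightarrow> 'a \<Rightarrow> ennreal)"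
  shows "(\<integral>\<^sup>+z. q z * (\<integral>\<^sup>+s\<in>{0<..<t}. P s g z * P (t - s) f z \<partial>lborel) \<partial>lborel)
     \<le> ennreal (kappa DIM('a) (2 * \<sigma>) \<beta>) * (\<integral>\<^sup>+z. npow (\<beta> + 2 * \<sigma>) z * occ t g z \<partial>lborel)"
proof -
  let ?F = "\<lambda>s z x. g x * pterm q 0 s x z * (q z * (indicator {0<..} (t - s) * P (t - s) f z))"
    and ?p = "\<lambda>x. \<integral>\<^sup>+y. pterm q (Suc 0) t x y * f y \<partial>lborel"
    and ?K = "\<lambda>x. \<integral>\<^sup>+y. feynman_kac_kernel \<eta> (2 * \<sigma>) \<delta> t x y * f y \<partial>lborel"
  define k where "k = ennreal (kappa DIM('a) (2 * \<sigma>) \<beta>)"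
  define F :: "'a \<Rightarrow> ennreal" where "F = npow (\<beta> + 2 * \<sigma>)"
  have [measurable]: "f \<in> borel_measurable borel" "g \<in> borel_measurable borel" "q \<in> borel_measurable borel" "F \<in> borel_measurable borel"
    unfolding f_def g_def q_def F_def by measurable
  let ?Z = "\<integral>\<^sup>+x. g x * occ t F x \<partial>lborel"
  have bp: "\<beta> < \<beta> * p" using p b by simp
  then have b1: "\<beta> + 2 * \<sigma> < real DIM('a)" using b by linarith
  have gf: "g x * f x = ennreal (trunc \<beta> R x powr p)" for x
    using p powr_mult_base[of "trunc \<beta> R x" "p - 1"]
    by (simp add: g_def f_def ennreal_mult[symmetric] mult.commute)
  define A where "A = (\<integral>\<^sup>+x. g x * f x \<partial>lborel)"
  have fin: "A < \<infinity>"
  proof -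
    have "A \<le> (\<integral>\<^sup>+x. npow (\<beta> * p) (x::'a) * indicator {x. norm x < R} x \<partial>lborel)"
      unfolding A_def gf using b R p by (intro nn_integral_mono trunc_powr_le_npow) auto
    also have "\<dots> < \<infinity>"
      by (rule nn_integral_npow_ball_finite) (use b p \<sigma> in auto)
    finally show ?thesis .
  qed
  define X where "X = (\<integral>\<^sup>+x. g x * P t f x \<partial>lborel)"
  define Y where "Y = (\<integral>\<^sup>+x. g x * ?p x \<partial>lborel)"
  have "X + Y \<le> A"
  proof -
    have "X + Y = (\<integral>\<^sup>+x. g x * P t f x + g x * ?p x \<partial>lborel)"
      unfolding X_def Y_def by (rule nn_integral_add[symmetric]) auto
    also have "\<dots> \<le> (\<integral>\<^sup>+x. g x * ?K x \<partial>lborel)"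
    proof (rule nn_integral_mono)
      fix x :: 'a
      have "P t f x + ?p x = (\<integral>\<^sup>+y. (pterm q 0 t x y + pterm q (Suc 0) t x y) * f y \<partial>lborel)"
        using t by (subst distrib_right, subst nn_integral_add) (auto simp: P_def pterm.simps(1))
      also have "\<dots> \<le> ?K x"
      proof (intro nn_integral_mono mult_right_mono)
        fix y :: 'a
        have "(\<Sum>n<2. pterm q n t x y) \<le> (\<Sum>n. pterm q n t x y)"
          by (rule sum_le_suminf) auto
        then show "pterm q 0 t x y + pterm q (Suc 0) t x y \<le> feynman_kac_kernel \<eta> (2 * \<sigma>) \<delta> t x y"
          using t by (simp add: feynman_kac_kernel_eq q_def numeral_2_eq_2)
      qed simp
      finally show "g x * P t f x + g x * ?p x \<le> g x * ?K x"
        unfolding distrib_left[symmetric] by (rule mult_left_mono) simp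
    qed
    also have "\<dots> \<le> A"
      unfolding A_def gf unfolding g_def f_def
    proof (rule Lp_contraction_test[OF p contr])
      show "(\<integral>\<^sup>+x. ennreal (trunc \<beta> R (x::'a) powr p) \<partial>lborel) < \<infinity>"
        using fin by (simp add: A_def gf)
    qed (auto intro!: borel_measurable_feynman_kac t)
    finally show ?thesis .
  qed
  have Y: "Y = (\<integral>\<^sup>+z. q z * (\<integral>\<^sup>+s\<in>{0<..<t}. P s g z * P (t - s) f z \<partial>lborel) \<partial>lborel)"
  proof -
    have eq: "(\<integral>\<^sup>+y. pterm q 0 s z y * f y \<partial>lborel) = indicator {0<..} s * P s f z" for s z
      by (simp add: pterm.simps(1) P_def mult.assoc nn_integral_cmult)
    have "Y = (\<integral>\<^sup>+x. (\<integral>\<^sup>+s. (\<integral>\<^sup>+z. ?F s z x \<partial>lborel) \<partial>lborel) \<partial>lborel)"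
      unfolding Y_def by (simp add: nn_integral_pterm_Suc eq nn_integral_cmult mult.assoc)
    also have "\<dots> = (\<integral>\<^sup>+s. (\<integral>\<^sup>+x. (\<integral>\<^sup>+z. ?F s z x \<partial>lborel) \<partial>lborel) \<partial>lborel)"
      by (rule lborel_pair.Fubini') simp
    also have "\<dots> = (\<integral>\<^sup>+s. (\<integral>\<^sup>+z. (\<integral>\<^sup>+x. ?F s z x \<partial>lborel) \<partial>lborel) \<partial>lborel)"
      by (intro nn_integral_cong lborel_pair.Fubini') simp
    also have "\<dots> = (\<integral>\<^sup>+s. (\<integral>\<^sup>+z. q z * (P s g z * P (t - s) f z * indicator {0<..<t} s) \<partial>lborel) \<partial>lborel)"
    proof (intro nn_integral_cong)
      fix s :: real and z :: 'a
      have "(\<integral>\<^sup>+x. ?F s z x \<partial>lborel)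
        = (\<integral>\<^sup>+x. g x * pterm q 0 s x z \<partial>lborel) * (q z * (indicator {0<..} (t - s) * P (t - s) f z))"
        by (rule nn_integral_multc) simp
      also have "(\<integral>\<^sup>+x. g x * pterm q 0 s x z \<partial>lborel) = indicator {0<..} s * P s g z"
      proof -
        have "(\<integral>\<^sup>+x. g x * pterm q 0 s x z \<partial>lborel) = (\<integral>\<^sup>+x. indicator {0<..} s * (pker s (x - z) * g x) \<partial>lborel)"
          by (intro nn_integral_cong) (simp add: pterm.simps(1) pker_minus_commute[of s z] mult_ac)
        also have "\<dots> = indicator {0<..} s * P s g z"
          unfolding P_def by (rule nn_integral_cmult) simp
        finally show ?thesis .
      qed
      finally show "(\<integral>\<^sup>+x. ?F s z x \<partial>lborel)
         = q z * (P s g z * P (t - s) f z * indicator {0<..<t} s)"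
        by (auto split: split_indicator simp: mult_ac)
    qed
    also have "\<dots> = (\<integral>\<^sup>+z. (\<integral>\<^sup>+s. q z * (P s g z * P (t - s) f z * indicator {0<..<t} s) \<partial>lborel) \<partial>lborel)"
      by (rule lborel_pair.Fubini') simp
    finally show ?thesis by (simp add: nn_integral_cmult)
  qed
  have "A \<le> X + k * ?Z"
  proof -
    have "g x * f x \<le> g x * P t f x + k * (g x * occ t F x)" if x: "x \<noteq> 0" for x
    proof (cases "norm x < R")
      case True
      define c where "c = ennreal (R powr (- \<beta>))"
      have h: "npow \<beta> y \<le> f y + c" for y
        unfolding npow_def f_def c_def by (rule ennreal_le_plusI) (auto simp: trunc_def)
      have "R powr (- \<beta>) \<le> norm x powr (- \<beta>)" using True x b by (intro powr_mono2') auto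
      then have "norm x powr (- \<beta>) = R powr (- \<beta>) + trunc \<beta> R x" by (simp add: trunc_def)
      then have "c + f x = npow \<beta> x"
        unfolding npow_def f_def c_def by (simp only: ennreal_plus trunc_nonneg powr_ge_zero)
      also have "\<dots> = P t (npow \<beta>) x + k * occ t F x"
        unfolding k_def F_def occ_def by (rule npow_eq_P_plus(1)[OF b(1) b1 x t])
      also have "\<dots> \<le> P t (\<lambda>y. f y + c) x + k * occ t F x"
        using h by (intro add_right_mono P_mono) auto
      also have "P t (\<lambda>y. f y + c) x = P t f x + c"
        using t by (simp add: P_add P_const)
      also have "P t f x + c + k * occ t F x = c + (P t f x + k * occ t F x)" by (simp add: add_ac)
      finally have "f x \<le> P t f x + k * occ t F x"
        by (simp add: ennreal_add_left_cancel_le c_def)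
      then have "g x * f x \<le> g x * (P t f x + k * occ t F x)" by (rule mult_left_mono) simp
      then show ?thesis by (simp add: distrib_left mult.left_commute)
    next
      case False
      then show ?thesis using trunc_eq_0[OF b(1) R, of x] by (simp add: f_def)
    qed
    then have "A \<le> (\<integral>\<^sup>+x. g x * P t f x + k * (g x * occ t F x) \<partial>lborel)"
      unfolding A_def by (intro nn_integral_mono_AE, use AE_lborel_singleton[of "0::'a"] in eventually_elim) auto
    also have "\<dots> = X + k * ?Z"
      unfolding X_def by (subst nn_integral_add) (auto simp: nn_integral_cmult)
    finally show ?thesis .
  qed
  \<comment> \<open>\<open>X\<close> is finite, so it can be cancelled\<close>
  with \<open>X + Y \<le> A\<close> have "X + Y \<le> X + k * ?Z" by (rule order_trans)
  moreover have "X \<noteq> \<infinity>" using \<open>X + Y \<le> A\<close> fin by (auto simp: top_unique)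
  ultimately have "Y \<le> k * ?Z"
    by (simp add: ennreal_add_left_cancel_le)
  also have "?Z = (\<integral>\<^sup>+x. F x * occ t g x \<partial>lborel)"
    by (rule occ_symmetric) auto
  finally show ?thesis by (simp only: Y k_def F_def)
qed

text \<open>
  The truncation is at least the power minus \<open>R powr (- \<beta>)\<close>, which for \<open>norm z \<le> \<epsilon> powr (1 / \<beta>) * R\<close> is at
  most the fraction \<open>\<epsilon>\<close> of the power at \<open>z\<close>.
\<close>

lemma P_trunc_ge:
  fixes z :: "'a::euclidean_space"
  assumes b: "0 < \<beta>" "\<beta> + 2 * \<sigma> < real DIM('a)" and s: "0 < s" "s < t" and R: "0 < R" and z: "z \<noteq> 0"
    and e: "0 < \<epsilon>" "\<epsilon> < 1 / 2"
    and M: "ennreal (1 - \<epsilon>) * npow \<beta> z \<le> P t (npow \<beta>) z"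
    and zR: "norm z \<le> \<epsilon> powr (1 / \<beta>) * R"
  shows "ennreal (1 - 2 * \<epsilon>) * npow \<beta> z \<le> P s (\<lambda>x. ennreal (trunc \<beta> R x)) z"
proof -
  define c where "c = ennreal (\<epsilon> * norm z powr (- \<beta>))"
  have "(\<epsilon> powr (1 / \<beta>) * R) powr (- \<beta>) \<le> norm z powr (- \<beta>)"
    using zR z b by (intro powr_mono2') auto
  moreover have "(\<epsilon> powr (1 / \<beta>) * R) powr (- \<beta>) = R powr (- \<beta>) / \<epsilon>"
  proof -
    have "1 / \<beta> * (- \<beta>) = -1" using b by simp
    then show ?thesis unfolding powr_mult powr_powr using e by simp
  qed
  ultimately have "R powr (- \<beta>) \<le> \<epsilon> * norm z powr (- \<beta>)"
    using e by (simp add: pos_divide_le_eq mult.commute)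
  then have h: "npow \<beta> y \<le> ennreal (trunc \<beta> R y) + c" for y :: 'a
    unfolding npow_def c_def using e by (intro ennreal_le_plusI) (auto simp: trunc_def)
  have "c + ennreal (1 - 2 * \<epsilon>) * npow \<beta> z = ennreal (1 - \<epsilon>) * npow \<beta> z"
  proof -
    have "ennreal (1 - \<epsilon>) = ennreal (\<epsilon> + (1 - 2 * \<epsilon>))" by simp
    also have "\<dots> = ennreal \<epsilon> + ennreal (1 - 2 * \<epsilon>)" using e by (intro ennreal_plus) auto
    finally have "ennreal (1 - \<epsilon>) = ennreal \<epsilon> + ennreal (1 - 2 * \<epsilon>)" .
    moreover have "c = ennreal \<epsilon> * npow \<beta> z" using e by (simp add: c_def npow_def ennreal_mult)
    ultimately show ?thesis by (simp only: distrib_right)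
  qed
  also have "\<dots> \<le> P t (npow \<beta>) z" by (rule M)
  also have "\<dots> \<le> P s (npow \<beta>) z" using s by (intro P_npow_antimono[OF b z]) auto
  also have "\<dots> \<le> P s (\<lambda>y. ennreal (trunc \<beta> R y) + c) z" using h by (intro P_mono) auto
  also have "\<dots> = c + P s (\<lambda>y. ennreal (trunc \<beta> R y)) z"
    using s by (simp add: P_add P_const add.commute)
  finally show ?thesis by (simp add: ennreal_add_left_cancel_le c_def)
qed

text \<open>
  Replace the power by its value on the boundary of the ball and use that the semigroup preserves
  integrals. What remains scales as \<open>R\<close> to the power \<open>d - \<beta> - 2 * \<sigma> - \<beta> * (p - 1) = 0\<close>, hence the bound is
  independent of \<open>R\<close>.
\<close>

lemma occupation_far_bound:
  assumes p: "1 < p" and b: "0 < \<beta>" "\<beta> * p + 2 * \<sigma> = real DIM('a::euclidean_space)" and R: "R > 0" and t: "t > 0" and c: "0 < c"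
  shows "(\<integral>\<^sup>+z. npow (\<beta> + 2 * \<sigma>) z * occ t (\<lambda>x::'a. ennreal (trunc \<beta> R x powr (p - 1))) z * indicator {z. c * R < norm z} z \<partial>lborel)
    \<le> ennreal (c powr (- (\<beta> + 2 * \<sigma>)) * t) * (\<integral>\<^sup>+x. npow (\<beta> * (p - 1)) (x::'a) * indicator {x. norm x < 1} x \<partial>lborel)"
proof -
  define g where "g = (\<lambda>x::'a. ennreal (trunc \<beta> R x powr (p - 1)))"
  define e where "e = \<beta> + 2 * \<sigma>"
  define J where "J = (\<integral>\<^sup>+x. npow (\<beta> * (p - 1)) (x::'a) * indicator {x. norm x < 1} x \<partial>lborel)"
  have [measurable]: "g \<in> borel_measurable borel" unfolding g_def by measurable
  have e: "e > 0" using b \<sigma> by (simp add: e_def)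
  have "(\<integral>\<^sup>+z. npow e z * occ t g z * indicator {z. c * R < norm z} z \<partial>lborel) \<le> (\<integral>\<^sup>+z. ennreal ((c * R) powr (- e)) * occ t g z \<partial>lborel)"
  proof (rule nn_integral_mono)
    fix z :: 'a
    have "norm z powr (- e) \<le> (c * R) powr (- e)" if "c * R < norm z"
      using that R c e by (intro powr_mono2') auto
    then show "npow e z * occ t g z * indicator {z. c * R < norm z} z \<le> ennreal ((c * R) powr (- e)) * occ t g z"
      by (auto simp: npow_def split: split_indicator intro!: mult_right_mono ennreal_leI)
  qed
  also have "\<dots> = ennreal ((c * R) powr (- e)) * (ennreal t * (\<integral>\<^sup>+x. g x \<partial>lborel))"
    using t by (simp add: nn_integral_cmult nn_integral_occ)
  also have "(\<integral>\<^sup>+x. g x \<partial>lborel) \<le> (\<integral>\<^sup>+x. npow (\<beta> * (p - 1)) (x::'a) * indicator {x. norm x < R} x \<partial>lborel)"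
    unfolding g_def using b R p by (intro nn_integral_mono trunc_powr_le_npow) auto
  also have "\<dots> = ennreal (\<bar>R\<bar> ^ DIM('a)) * (\<integral>\<^sup>+x. npow (\<beta> * (p - 1)) (0 + R *\<^sub>R x::'a) * indicator {x. norm x < R} (0 + R *\<^sub>R x) \<partial>lborel)"
    using R by (intro nn_integral_lborel_affine) auto
  also have "\<dots> = ennreal (\<bar>R\<bar> ^ DIM('a)) * (\<integral>\<^sup>+x. ennreal (R powr (- (\<beta> * (p - 1)))) * (npow (\<beta> * (p - 1)) (x::'a) * indicator {x. norm x < 1} x) \<partial>lborel)"
  proof -
    have "npow (\<beta> * (p - 1)) (0 + R *\<^sub>R x) * indicator {x. norm x < R} (0 + R *\<^sub>R x) = ennreal (R powr (- (\<beta> * (p - 1)))) * (npow (\<beta> * (p - 1)) x * indicator {x. norm x < 1} x)" for x :: 'a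
      using R by (auto simp: npow_scaleR mult.assoc split: split_indicator)
    then show ?thesis by simp
  qed
  also have "\<dots> = ennreal (\<bar>R\<bar> ^ DIM('a)) * (ennreal (R powr (- (\<beta> * (p - 1)))) * J)"
    unfolding J_def by (subst nn_integral_cmult) auto
  also have "ennreal ((c * R) powr (- e)) * (ennreal t * (ennreal (\<bar>R\<bar> ^ DIM('a)) * (ennreal (R powr (- (\<beta> * (p - 1)))) * J)))
     = ennreal ((c * R) powr (- e) * t * (\<bar>R\<bar> ^ DIM('a) * R powr (- (\<beta> * (p - 1))))) * J"
    using t by (simp add: ennreal_mult mult.assoc)
  also have "\<bar>R\<bar> ^ DIM('a) * R powr (- (\<beta> * (p - 1))) = R powr e"
  proof -
    have "\<bar>R\<bar> ^ DIM('a) * R powr (- (\<beta> * (p - 1))) = R powr (real DIM('a) + (- (\<beta> * (p - 1))))"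
      using R by (simp only: powr_add) (simp add: powr_realpow)
    also have "real DIM('a) + (- (\<beta> * (p - 1))) = e"
      using b by (simp add: e_def algebra_simps)
    finally show ?thesis .
  qed
  also have "(c * R) powr (- e) * t * R powr e = c powr (- e) * t"
    using R by (simp add: powr_mult powr_minus field_simps)
  finally show ?thesis by (simp add: g_def e_def J_def mult_left_mono)
qed

text \<open>
  Far away \<open>occ t (npow \<beta>')\<close> is at least \<open>t / 2 * npow \<beta>'\<close>, so the integrand dominates a multiple of
  \<open>npow d\<close>.
\<close>

lemma nn_integral_npow_occ_infinite:
  assumes b: "0 < \<beta>" "0 < \<beta>'" "\<beta> + \<beta>' + 2 * \<sigma> = real DIM('a::euclidean_space)" and t: "t > 0"
  shows "(\<integral>\<^sup>+x. npow (\<beta> + 2 * \<sigma>) (x::'a) * occ t (npow \<beta>') x \<partial>lborel) = \<infinity>"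
proof -
  obtain M where M: "M > 0" "\<And>x::'a. M \<le> norm x \<Longrightarrow> ennreal (1 - 1 / 2) * npow \<beta>' x \<le> P t (npow \<beta>') x"
    using P_npow_eventually_ge[OF b(2) t, of "1 / 2", where 'a='a] by auto
  have "(\<infinity>::ennreal) = ennreal (t / 2) * (\<integral>\<^sup>+x. npow (real DIM('a)) (x::'a) * indicator {x. M \<le> norm x} x \<partial>lborel)"
    using t by (simp add: nn_integral_npow_outside_infinite[OF M(1)] ennreal_mult_top)
  also have "\<dots> = (\<integral>\<^sup>+x. ennreal (t / 2) * (npow (real DIM('a)) (x::'a) * indicator {x. M \<le> norm x} x) \<partial>lborel)"
    by (rule nn_integral_cmult[symmetric]) simp
  also have "\<dots> \<le> (\<integral>\<^sup>+x. npow (\<beta> + 2 * \<sigma>) (x::'a) * occ t (npow \<beta>') x \<partial>lborel)"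
  proof (rule nn_integral_mono, goal_cases)
    case (1 x)
    show ?case
    proof (cases "M \<le> norm x")
      case True
      then have x: "x \<noteq> 0" using M(1) by auto
      have "ennreal t * (ennreal (1 - 1 / 2) * npow \<beta>' x) \<le> ennreal t * P t (npow \<beta>') x"
        using M(2)[OF True] by (rule mult_left_mono) simp
      also have "\<dots> \<le> occ t (npow \<beta>') x"
        using b by (intro occ_npow_ge x t) auto
      finally have "npow (\<beta> + 2 * \<sigma>) x * (ennreal t * (ennreal (1 - 1 / 2) * npow \<beta>' x)) \<le> npow (\<beta> + 2 * \<sigma>) x * occ t (npow \<beta>') x"
        by (rule mult_left_mono) simp
      moreover have "npow (real DIM('a)) x = npow (\<beta> + 2 * \<sigma>) x * npow \<beta>' x"
        by (simp add: npow_mult b(3)[symmetric] add_ac)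
      moreover have "ennreal (t / 2) = ennreal t * ennreal (1 - 1 / 2)"
        using t by (subst ennreal_mult[symmetric]) auto
      ultimately show ?thesis using True by (simp add: mult_ac)
    qed simp
  qed
  finally show ?thesis by (simp add: top_unique)
qed

lemma nn_integral_trunc_tendsto:
  assumes p: "1 < p" and b: "0 < \<beta>" and [measurable]: "(W :: 'a::euclidean_space \<Rightarrow> ennreal) \<in> borel_measurable borel"
  shows "(\<lambda>n. \<integral>\<^sup>+x. ennreal (trunc \<beta> (real (Suc n)) (x::'a) powr (p - 1)) * W x \<partial>lborel)
     \<longlonglongrightarrow> (\<integral>\<^sup>+x. npow (\<beta> * (p - 1)) x * W x \<partial>lborel)"
proof (rule nn_integral_LIMSEQ)
  let ?f = "\<lambda>n (x::'a). trunc \<beta> (real (Suc n)) x"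
  show "incseq (\<lambda>n x. ennreal (?f n x powr (p - 1)) * W x)"
  proof (rule incseq_SucI, rule le_funI)
    fix n and x :: 'a
    have "real (Suc (Suc n)) powr (- \<beta>) \<le> real (Suc n) powr (- \<beta>)"
      using b by (intro powr_mono2') auto
    then have "?f n x \<le> ?f (Suc n) x"
      by (auto simp: trunc_def)
    then show "ennreal (?f n x powr (p - 1)) * W x \<le> ennreal (?f (Suc n) x powr (p - 1)) * W x"
      using p by (intro mult_right_mono ennreal_leI powr_mono2) auto
  qed
next
  fix x :: 'a
  let ?f = "\<lambda>n (x::'a). trunc \<beta> (real (Suc n)) x"
  have "(\<lambda>n. ?f n x powr (p - 1)) \<longlonglongrightarrow> norm x powr (- (\<beta> * (p - 1)))"
  proof (cases "x = 0")
    case True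
    then have "?f n x = 0" for n by (simp add: trunc_def)
    then show ?thesis using True by simp
  next
    case False
    have "(\<lambda>n. real (Suc n) powr (- \<beta>)) \<longlonglongrightarrow> 0"
      using b by (intro tendsto_neg_powr filterlim_compose[OF filterlim_real_sequentially filterlim_Suc]) auto
    then have "(\<lambda>n. ?f n x) \<longlonglongrightarrow> max 0 (norm x powr (- \<beta>) - 0)"
      unfolding trunc_def by (intro tendsto_intros)
    then have "(\<lambda>n. ?f n x powr (p - 1)) \<longlonglongrightarrow> (max 0 (norm x powr (- \<beta>) - 0)) powr (p - 1)"
      using False by (intro tendsto_powr tendsto_const) (auto simp: max_def)
    then show ?thesis by (simp add: powr_powr)
  qed
  then have lim: "(\<lambda>n. ennreal (?f n x powr (p - 1))) \<longlonglongrightarrow> npow (\<beta> * (p - 1)) x"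
    unfolding npow_def by (rule tendsto_ennrealI)
  show "(\<lambda>n. ennreal (?f n x powr (p - 1)) * W x) \<longlonglongrightarrow> npow (\<beta> * (p - 1)) x * W x"
  proof (cases "x = 0")
    case False
    show ?thesis
      by (rule tendsto_mult_ennreal[OF lim tendsto_const]) (use False in \<open>simp add: npow_def\<close>)
  next
    case True
    then have "?f n x = 0" for n by (simp add: trunc_def)
    then show ?thesis using True by (simp add: npow_def)
  qed
qed simp

text \<open>
  Suppose the inequality fails. By \<open>P_trunc_ge\<close>, the left-hand side of the occupation bound is at least
  \<open>L\<close> times the mass \<open>m\<close> of the occupation integral on an annulus, for some \<open>L > k\<close>; the right-hand side
  is at most \<open>k * (m + B)\<close>, where \<open>B\<close> bounds the mass off the annulus for all \<open>R\<close>. So the total mass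
  is bounded in \<open>R\<close>, although it tends to infinity by monotone convergence.
\<close>

theorem contraction_imp_kappa_le:
  fixes \<delta> p t \<beta> :: real
  assumes p: "1 < p" and b: "0 < \<beta>" "\<beta> * p + 2 * \<sigma> = real DIM('a::euclidean_space)" and t: "t > 0"
    and contr: "Lp_contraction p (feynman_kac_kernel \<eta> (2 * \<sigma>) \<delta> t :: 'a \<Rightarrow> 'a \<Rightarrow> ennreal)"
  shows "kappa DIM('a) (2 * \<sigma>) \<delta> \<le> kappa DIM('a) (2 * \<sigma>) \<beta>"
proof (rule ccontr)
  define K where "K = kappa DIM('a) (2 * \<sigma>) \<delta>"
  define k where "k = kappa DIM('a) (2 * \<sigma>) \<beta>"
  define \<beta>' where "\<beta>' = \<beta> * (p - 1)"
  define F :: "'a \<Rightarrow> ennreal" where "F = npow (\<beta> + 2 * \<sigma>)"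
  assume "\<not> ?thesis"
  then have kK: "k < K" by (simp add: k_def K_def)
  have b': "0 < \<beta>'" "\<beta> + \<beta>' + 2 * \<sigma> = real DIM('a)"
    using p b by (auto simp: \<beta>'_def algebra_simps)
  then have b1: "\<beta> + 2 * \<sigma> < real DIM('a)" "\<beta>' + 2 * \<sigma> < real DIM('a)" using b by auto
  have k0: "0 < k" using riesz_kappa(2)[OF b(1) b1(1)] by (simp add: k_def)
  \<comment> \<open>this choice makes \<open>L = K * (1 - 2 * \<epsilon>)\<close> the midpoint of \<open>k\<close> and \<open>K\<close>\<close>
  define \<epsilon> where "\<epsilon> = (K - k) / (4 * K)"
  have e: "0 < \<epsilon>" "\<epsilon> < 1 / 2" using kK k0 by (auto simp: \<epsilon>_def field_simps)
  define L where "L = K * (1 - 2 * \<epsilon>)"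
  have "L = (K + k) / 2" using kK k0 by (simp add: L_def \<epsilon>_def field_simps)
  then have kL: "k < L" using kK by simp
  obtain M where M: "M > 0" "\<And>x::'a. M \<le> norm x \<Longrightarrow> ennreal (1 - \<epsilon>) * npow \<beta> x \<le> P t (npow \<beta>) x"
    using P_npow_eventually_ge[OF b(1) t e(1), where 'a='a] e by auto
  define c where "c = \<epsilon> powr (1 / \<beta>)"
  have c: "c > 0" using e by (simp add: c_def)
  let ?h = "\<lambda>z::'a. ennreal (1 - 2 * \<epsilon>) * npow \<beta> z"
  define B where "B = (\<integral>\<^sup>+x. F x * occ t (npow \<beta>') x * indicator {x. norm x < M} x \<partial>lborel)
    + ennreal (c powr (- (\<beta> + 2 * \<sigma>)) * t) * (\<integral>\<^sup>+x. npow \<beta>' (x::'a) * indicator {x. norm x < 1} x \<partial>lborel)"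
  have B: "B < \<infinity>"
    using occ_npow_near_zero[OF b(1) b' t, of M] nn_integral_npow_ball_finite[of \<beta>' 1, where 'a='a] b' b1 \<sigma>
    by (simp add: B_def F_def ennreal_mult_less_top)
  have bound: "(\<integral>\<^sup>+z. F z * occ t (\<lambda>x. ennreal (trunc \<beta> R x powr (p - 1))) z \<partial>lborel) \<le> ennreal (k / (L - k)) * B + B"
    if R: "R > 0" for R
  proof -
    define f where "f = (\<lambda>x::'a. ennreal (trunc \<beta> R x))"
    define g where "g = (\<lambda>x::'a. ennreal (trunc \<beta> R x powr (p - 1)))"
    define q where "q = (\<lambda>x::'a. ennreal (hardy_potential (2 * \<sigma>) \<delta> x))"
    define A where "A = {z::'a. M \<le> norm z \<and> norm z \<le> c * R}"
    have [measurable]: "f \<in> borel_measurable borel" "g \<in> borel_measurable borel" "q \<in> borel_measurable borel" "F \<in> borel_measurable borel" "A \<in> sets borel"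
      unfolding f_def g_def q_def F_def A_def by measurable
    let ?u = "\<lambda>z. F z * occ t g z" and ?PP = "\<lambda>z. \<integral>\<^sup>+s\<in>{0<..<t}. P s g z * P (t - s) f z \<partial>lborel"
    have g_le: "g x \<le> npow \<beta>' x" for x
    proof -
      have "g x \<le> npow \<beta>' x * indicator {x. norm x < R} x"
        unfolding g_def \<beta>'_def using b R p by (intro trunc_powr_le_npow) auto
      also have "\<dots> \<le> npow \<beta>' x" by (simp split: split_indicator)
      finally show ?thesis .
    qed
    have occ_le: "occ t g z \<le> occ t (npow \<beta>') z" for z
      using g_le by (intro occ_mono) auto
    define m where "m = (\<integral>\<^sup>+z. ?u z * indicator A z \<partial>lborel)"
    define tot where "tot = (\<integral>\<^sup>+z. ?u z \<partial>lborel)"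
    have split: "tot \<le> m + B"
    proof -
      have "tot \<le> (\<integral>\<^sup>+z. ?u z * indicator A z + (F z * occ t (npow \<beta>') z * indicator {x. norm x < M} z + ?u z * indicator {z. c * R < norm z} z) \<partial>lborel)"
        unfolding tot_def
      proof (rule nn_integral_mono)
        fix z :: 'a
        have "?u z \<le> F z * occ t (npow \<beta>') z" by (intro mult_left_mono occ_le) simp
        then show "?u z \<le> ?u z * indicator A z + (F z * occ t (npow \<beta>') z * indicator {x. norm x < M} z + ?u z * indicator {z. c * R < norm z} z)"
          by (auto simp: A_def add_increasing2 split: split_indicator)
      qed
      also have "\<dots> = m + ((\<integral>\<^sup>+z. F z * occ t (npow \<beta>') z * indicator {x. norm x < M} z \<partial>lborel) + (\<integral>\<^sup>+z. ?u z * indicator {z. c * R < norm z} z \<partial>lborel))"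
        unfolding m_def by (simp add: nn_integral_add)
      also have "\<dots> \<le> m + B"
        unfolding B_def \<beta>'_def F_def g_def
        by (intro add_left_mono occupation_far_bound[OF p b R t c])
      finally show ?thesis .
    qed
    have m: "m < \<infinity>"
    proof -
      have "m \<le> (\<integral>\<^sup>+z. ennreal (t * M powr (- real DIM('a))) * indicator (cball 0 (c * R)) (z::'a) \<partial>lborel)"
        unfolding m_def
      proof (rule nn_integral_mono, goal_cases)
        case (1 z)
        show ?case
        proof (cases "z \<in> A")
          case True
          then have z: "z \<noteq> 0" "M \<le> norm z" "norm z \<le> c * R" using M(1) by (auto simp: A_def)
          have "?u z \<le> F z * (ennreal t * npow \<beta>' z)"
            by (intro mult_left_mono order_trans[OF occ_le] occ_npow_le b' b1 z t) simp
          also have "\<dots> = ennreal t * npow (real DIM('a)) z"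
            by (simp add: F_def mult.left_commute npow_mult b'(2)[symmetric] add_ac)
          also have "\<dots> \<le> ennreal t * ennreal (M powr (- real DIM('a)))"
            unfolding npow_def using z M(1) by (intro mult_left_mono ennreal_leI powr_mono2') auto
          finally show ?thesis using True z t by (simp add: ennreal_mult)
        qed simp
      qed
      also have "\<dots> = ennreal (t * M powr (- real DIM('a))) * emeasure lborel (cball (0::'a) (c * R))"
        by (rule nn_integral_cmult_indicator) simp
      also have "\<dots> < \<infinity>"
        using emeasure_lborel_cball_finite[of "0::'a" "c * R"] by (simp add: ennreal_mult_eq_top_iff less_top[symmetric])
      finally show ?thesis .
    qed
    have "ennreal L * m = (\<integral>\<^sup>+z. ennreal L * (?u z * indicator A z) \<partial>lborel)"
      unfolding m_def by (rule nn_integral_cmult[symmetric]) simp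
    also have "\<dots> \<le> (\<integral>\<^sup>+z. q z * ?PP z \<partial>lborel)"
    proof (rule nn_integral_mono, goal_cases)
      case (1 z)
      show ?case
      proof (cases "z \<in> A")
        case True
        then have z: "z \<noteq> 0" "M \<le> norm z" "norm z \<le> c * R" using M(1) by (auto simp: A_def)
        have "?h z * occ t g z = (\<integral>\<^sup>+s. ?h z * (P s g z * indicator {0<..<t} s) \<partial>lborel)"
          unfolding occ_def by (rule nn_integral_cmult[symmetric]) simp
        also have "\<dots> \<le> ?PP z"
        proof (rule nn_integral_mono, goal_cases)
          case (1 s)
          show ?case
          proof (cases "0 < s \<and> s < t")
            case True
            have "?h z \<le> P (t - s) f z"
              unfolding f_def using True by (intro P_trunc_ge[OF b(1) b1(1) _ _ R z(1) e M(2)[OF z(2)]] z(3)[unfolded c_def]) auto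
            then have "P s g z * ?h z \<le> P s g z * P (t - s) f z"
              by (rule mult_left_mono) simp
            then show ?thesis using True by (simp add: mult_ac)
          qed auto
        qed
        finally have "q z * (?h z * occ t g z) \<le> q z * ?PP z"
          by (rule mult_left_mono) simp
        moreover have "q z * (?h z * occ t g z) = ennreal L * (?u z)"
        proof -
          have "q z = ennreal K * npow (2 * \<sigma>) z"
            using k0 kK by (simp add: q_def hardy_potential_def npow_def K_def ennreal_mult)
          moreover have "ennreal L = ennreal K * ennreal (1 - 2 * \<epsilon>)"
            using k0 kK e by (simp add: L_def ennreal_mult)
          moreover have "F z = npow (2 * \<sigma>) z * npow \<beta> z"
            by (simp add: F_def npow_mult add.commute)
          ultimately show ?thesis by (simp add: mult_ac)
        qed
        ultimately show ?thesis using True by simp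
      qed simp
    qed
    also have "\<dots> \<le> ennreal k * tot"
      unfolding k_def tot_def F_def f_def g_def q_def
      by (rule contraction_imp_occupation_bound[OF p b R t contr])
    also have "\<dots> \<le> ennreal k * (m + B)"
      using split by (rule mult_left_mono) simp
    finally have "m \<le> ennreal (k / (L - k)) * B"
      by (intro ennreal_absorb_le k0 kL m B)
    with split have "tot \<le> ennreal (k / (L - k)) * B + B"
      by (meson add_right_mono order_trans)
    then show ?thesis by (simp add: tot_def g_def)
  qed
  have [measurable]: "F \<in> borel_measurable borel" unfolding F_def by measurable
  let ?I = "\<integral>\<^sup>+x. npow \<beta>' x * occ t F x \<partial>lborel" and ?B = "ennreal (k / (L - k)) * B + B"
  have "(\<lambda>n. \<integral>\<^sup>+x. ennreal (trunc \<beta> (real (Suc n)) (x::'a) powr (p - 1)) * occ t F x \<partial>lborel)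
      \<longlonglongrightarrow> ?I"
    unfolding \<beta>'_def by (rule nn_integral_trunc_tendsto[OF p b(1)]) simp
  moreover have "(\<integral>\<^sup>+x. ennreal (trunc \<beta> (real (Suc n)) (x::'a) powr (p - 1)) * occ t F x \<partial>lborel) \<le> ?B" for n
    using bound[of "real (Suc n)"] by (subst occ_symmetric) auto
  ultimately have "?I \<le> ?B"
    by (intro LIMSEQ_le_const2) auto
  also have "?I = (\<integral>\<^sup>+x. F x * occ t (npow \<beta>') x \<partial>lborel)"
    by (rule occ_symmetric) auto
  also have "\<dots> = \<infinity>"
    unfolding F_def by (rule nn_integral_npow_occ_infinite[OF b(1) b' t])
  finally show False
    using B by (auto simp: top_unique ennreal_mult_eq_top_iff)
qed

end

section \<open>The contraction criterion\<close>

theorem theorem3: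
  fixes \<alpha> \<delta> p t :: real and \<eta> :: "real \<Rightarrow> real \<Rightarrow> real"
  assumes "0 < \<alpha>" and "\<alpha> < min 2 (real DIM('a::euclidean_space))"
    and "0 \<le> \<delta>" and "\<delta> \<le> (real DIM('a) - \<alpha>) / 2"
    and "1 < p" and "0 < t"
    and "stable_subordinator_density (\<alpha> / 2) \<eta>"
  shows "Lp_contraction p (feynman_kac_kernel \<eta> \<alpha> \<delta> t :: 'a \<Rightarrow> 'a \<Rightarrow> ennreal) \<longleftrightarrow>
    kappa DIM('a) \<alpha> \<delta> \<le> kappa DIM('a) \<alpha> ((real DIM('a) - \<alpha>) / p)"
proof -
  interpret stable_subordinator "\<alpha> / 2" \<eta>
    using assms by unfold_locales auto
  have b: "0 < (real DIM('a) - \<alpha>) / p" "(real DIM('a) - \<alpha>) / p * p + 2 * (\<alpha> / 2) = real DIM('a)"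
    using assms by auto
  show ?thesis
    using contraction_imp_kappa_le[OF \<open>1 < p\<close> b \<open>0 < t\<close>, of \<delta>] contraction_if_kappa_le[OF \<open>1 < p\<close> b \<open>0 < t\<close>, of \<delta>]
    by auto
qed

end
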